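(* Let $n\ge 0$ and let $Q$ be a Dynkin quiver of type $\mathbb{A}_{n+2}$. Then there is an equivalence of categories $F\colon \mathcal{C}_{P(Q)}\to \mathrm{ind}\,Q$ from the category of line segments of the polygon $P(Q)$ to the category of indecomposable representations of $Q$.
   Context: $\Bbbk$ is an algebraically closed field. A Dynkin quiver $Q$ of type $\mathbb{A}_{n+2}$ has vertices $1,2,\dots,n+2$ and, for each $1\le i\le n+1$, exactly one arrow between $i$ and $i+1$, in either direction. $\mathrm{rep}\,Q$ is the category of finite-dimensional $\Bbbk$-linear representations of $Q$; $\mathrm{ind}\,Q$ is a full subcategory whose objects are one representative of each isomorphism class of indecomposable representations. Polygon $P(Q)$: put $\overline{[n+1]}=\{i\in[n+1] : i\to (i+1)\text{ in }Q\}$ (upper-barred) and $\underline{[n+1]}=\{i\in[n+1]: i\leftarrow (i+1)\text{ in }Q\}$ (lower-barred), where $[n+1]=\{1,\dots,n+1\}$. $P(Q)$ is a convex $(n+3)$-gon in the plane with vertices labeled $0,1,\dots,n+2$ placed from left to right in this order, with $0$ and $n+2$ on a common horizontal line $L$, the upper-barred vertices above $L$ and the lower-barred vertices below $L$. For a vertex $\ell$ of $P(Q)$, $R(\ell)$ and $R^{-1}(\ell)$ denote its clockwise and counterclockwise neighbor on the boundary, respectively. Line segments: $\mathcal{E}=\{\gamma(i,j)\mid 0\le i<j\le n+2\}$, where $\gamma(i,j)$ is the line segment from vertex $i$ to vertex $j$ of $P(Q)$ (boundary edges and diagonals). A pivot of $\gamma(i,j)\in\mathcal{E}$ is $\gamma(i,R^{-1}(j))$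 if $i<R^{-1}(j)$, and $\gamma(R^{-1}(i),j)$ if $R^{-1}(i)<j$. The translation quiver $(\Gamma_{P(Q)},R)$ has vertex set $\mathcal{E}$, an arrow $\gamma\to\gamma'$ whenever $\gamma'$ is a pivot of $\gamma$, and translation $R(\gamma(i,j))=\gamma(R(i),R(j))$ defined on those $\gamma(i,j)$ with $R(i)<R(j)$. Mesh category: for a translation quiver $(\Gamma,\tau)$ without multiple arrows, with $\tau$ defined on a subset $\Gamma_0'\subseteq\Gamma_0$, each arrow $\alpha\colon y\to x$ with $x\in\Gamma_0'$ has an associated arrow $\sigma(\alpha)\colon \tau x\to y$. The path category has the vertices of $\Gamma$ as objects, and the morphism space from $x$ to $y$ is the $\Bbbk$-vector space with basis the paths from $x$ to $y$. The mesh category is the quotient of the path category by the ideal generated by the mesh relations $m_x=\sum_{\alpha\colon y\to x}\sigma(\alpha)\alpha$ (the path $\tau x\to y\to x$), for all $x\in\Gamma_0'$. The category of line segments $\mathcal{C}_{P(Q)}$ is the mesh category of $(\Gamma_{P(Q)},R)$. *)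

theory Defs
  imports "HOL-Analysis.Analysis" "HOL-Computational_Algebra.Polynomial"
begin

section \<open>Categories\<close>

text \<open>Composition takes the three objects as arguments, because morphisms in a quotient category
  are cosets, which do not determine their source and target.
  \<open>cmp C X Y Z g f\<close> is $g \circ f$ for $f : X \to Y$ and $g : Y \to Z$.\<close>

record ('o, 'm) category_data =
  obj :: "'o set"
  hom :: "'o \<Rightarrow> 'o \<Rightarrow> 'm set"
  cmp :: "'o \<Rightarrow> 'o \<Rightarrow> 'o \<Rightarrow> 'm \<Rightarrow> 'm \<Rightarrow> 'm"
  idm :: "'o \<Rightarrow> 'm"

record ('o, 'm, 'k) linear_category_data = "('o, 'm) category_data" +
  hadd :: "'o \<Rightarrow> 'o \<Rightarrow> 'm \<Rightarrow> 'm \<Rightarrow> 'm"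
  hscale :: "'o \<Rightarrow> 'o \<Rightarrow> 'k \<Rightarrow> 'm \<Rightarrow> 'm"

definition is_category :: "('o, 'm, 'x) category_data_scheme \<Rightarrow> bool" where
  "is_category C \<longleftrightarrow>
     (\<forall>X\<in>obj C. idm C X \<in> hom C X X) \<and>
     (\<forall>X\<in>obj C. \<forall>Y\<in>obj C. \<forall>Z\<in>obj C. \<forall>f\<in>hom C X Y. \<forall>g\<in>hom C Y Z.
        cmp C X Y Z g f \<in> hom C X Z) \<and>
     (\<forall>X\<in>obj C. \<forall>Y\<in>obj C. \<forall>f\<in>hom C X Y.
        cmp C X X Y f (idm C X) = f \<and> cmp C X Y Y (idm C Y) f = f) \<and>
     (\<forall>W\<in>obj C. \<forall>X\<in>obj C. \<forall>Y\<in>obj C. \<forall>Z\<in>obj C.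
        \<forall>f\<in>hom C W X. \<forall>g\<in>hom C X Y. \<forall>h\<in>hom C Y Z.
        cmp C W Y Z h (cmp C W X Y g f) = cmp C W X Z (cmp C X Y Z h g) f)"

definition isomorphism_in :: "('o, 'm, 'x) category_data_scheme \<Rightarrow> 'o \<Rightarrow> 'o \<Rightarrow> 'm \<Rightarrow> bool" where
  "isomorphism_in C X Y f \<longleftrightarrow> f \<in> hom C X Y \<and>
     (\<exists>g\<in>hom C Y X. cmp C X Y X g f = idm C X \<and> cmp C Y X Y f g = idm C Y)"

definition isomorphic_in :: "('o, 'm, 'x) category_data_scheme \<Rightarrow> 'o \<Rightarrow> 'o \<Rightarrow> bool" where
  "isomorphic_in C X Y \<longleftrightarrow> (\<exists>f. isomorphism_in C X Y f)"

definition full_subcategory ::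
    "('o, 'm, 'x) category_data_scheme \<Rightarrow> 'o set \<Rightarrow> ('o, 'm, 'x) category_data_scheme" where
  "full_subcategory C S = C\<lparr>obj := S\<rparr>"

record ('o, 'm, 'p, 'q) functor_data =
  fobj :: "'o \<Rightarrow> 'p"
  fmor :: "'o \<Rightarrow> 'o \<Rightarrow> 'm \<Rightarrow> 'q"

definition is_functor :: "('o, 'm, 'x) category_data_scheme \<Rightarrow> ('p, 'q, 'y) category_data_scheme
    \<Rightarrow> ('o, 'm, 'p, 'q) functor_data \<Rightarrow> bool" where
  "is_functor C D F \<longleftrightarrow>
     is_category C \<and> is_category D \<and>
     (\<forall>X\<in>obj C. fobj F X \<in> obj D \<and> fmor F X X (idm C X) = idm D (fobj F X)) \<and>
     (\<forall>X\<in>obj C. \<forall>Y\<in>obj C. \<forall>f\<in>hom C X Y. fmor F X Y f \<in> hom D (fobj F X) (fobj F Y)) \<and>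
     (\<forall>X\<in>obj C. \<forall>Y\<in>obj C. \<forall>Z\<in>obj C. \<forall>f\<in>hom C X Y. \<forall>g\<in>hom C Y Z.
        fmor F X Z (cmp C X Y Z g f) =
        cmp D (fobj F X) (fobj F Y) (fobj F Z) (fmor F Y Z g) (fmor F X Y f))"

definition id_functor :: "('o, 'm, 'o, 'm) functor_data" where
  "id_functor = \<lparr>fobj = (\<lambda>X. X), fmor = (\<lambda>X Y f. f)\<rparr>"

definition comp_functor :: "('p, 'q, 'r, 's) functor_data \<Rightarrow> ('o, 'm, 'p, 'q) functor_data
    \<Rightarrow> ('o, 'm, 'r, 's) functor_data" where
  "comp_functor G F = \<lparr>fobj = (\<lambda>X. fobj G (fobj F X)),
     fmor = (\<lambda>X Y f. fmor G (fobj F X) (fobj F Y) (fmor F X Y f))\<rparr>"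

definition naturally_isomorphic ::
    "('o, 'm, 'x) category_data_scheme \<Rightarrow> ('p, 'q, 'y) category_data_scheme
    \<Rightarrow> ('o, 'm, 'p, 'q) functor_data \<Rightarrow> ('o, 'm, 'p, 'q) functor_data \<Rightarrow> bool" where
  "naturally_isomorphic C D F G \<longleftrightarrow>
     (\<exists>\<eta>. (\<forall>X\<in>obj C. isomorphism_in D (fobj F X) (fobj G X) (\<eta> X)) \<and>
          (\<forall>X\<in>obj C. \<forall>Y\<in>obj C. \<forall>f\<in>hom C X Y.
             cmp D (fobj F X) (fobj F Y) (fobj G Y) (\<eta> Y) (fmor F X Y f) =
             cmp D (fobj F X) (fobj G X) (fobj G Y) (fmor G X Y f) (\<eta> X)))"

definition is_equivalence :: "('o, 'm, 'x) category_data_scheme \<Rightarrow> ('p, 'q, 'y) category_data_scheme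
    \<Rightarrow> ('o, 'm, 'p, 'q) functor_data \<Rightarrow> bool" where
  "is_equivalence C D F \<longleftrightarrow> is_functor C D F \<and>
     (\<exists>G. is_functor D C G \<and>
          naturally_isomorphic C C (comp_functor G F) id_functor \<and>
          naturally_isomorphic D D (comp_functor F G) id_functor)"

definition preserves_linear_structure ::
    "('o, 'm, 'k, 'x) linear_category_data_scheme \<Rightarrow> ('p, 'q, 'k, 'y) linear_category_data_scheme
    \<Rightarrow> ('o, 'm, 'p, 'q) functor_data \<Rightarrow> bool" where
  "preserves_linear_structure C D F \<longleftrightarrow>
     (\<forall>X\<in>obj C. \<forall>Y\<in>obj C. \<forall>f\<in>hom C X Y.
        (\<forall>g\<in>hom C X Y. fmor F X Y (hadd C X Y f g) =
           hadd D (fobj F X) (fobj F Y) (fmor F X Y f) (fmor F X Y g)) \<and>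
        (\<forall>c. fmor F X Y (hscale C X Y c f) = hscale D (fobj F X) (fobj F Y) c (fmor F X Y f)))"


section \<open>Quivers and their representations\<close>

text \<open>All quivers here have no multiple arrows, so an arrow is the pair of its source and target.\<close>

record 'a quiver =
  qverts :: "'a set"
  qarrows :: "('a \<times> 'a) set"

definition dynkin_A :: "nat \<Rightarrow> nat quiver \<Rightarrow> bool" where
  "dynkin_A m Q \<longleftrightarrow> qverts Q = {1..m} \<and>
     qarrows Q \<subseteq> (\<Union>i\<in>{1..<m}. {(i, i + 1), (i + 1, i)}) \<and>
     (\<forall>i\<in>{1..<m}. card (qarrows Q \<inter> {(i, i + 1), (i + 1, i)}) = 1)"

text \<open>A representation places a finite-dimensional vector space at every vertex. These spaces are
  taken to be subspaces of one ambient vector space, which the main statement assumes to be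
  infinite-dimensional but otherwise arbitrary; then every finite-dimensional representation is
  isomorphic to one of this form.\<close>

record ('a, 'v) rep =
  space_at :: "'a \<Rightarrow> 'v set"
  map_at :: "'a \<times> 'a \<Rightarrow> 'v \<Rightarrow> 'v"

definition linear_between ::
    "('k::field \<Rightarrow> 'v::ab_group_add \<Rightarrow> 'v) \<Rightarrow> 'v set \<Rightarrow> 'v set \<Rightarrow> ('v \<Rightarrow> 'v) \<Rightarrow> bool" where
  "linear_between s V W f \<longleftrightarrow> f ` V \<subseteq> W \<and>
     (\<forall>x\<in>V. \<forall>y\<in>V. f (x + y) = f x + f y) \<and> (\<forall>c. \<forall>x\<in>V. f (s c x) = s c (f x))"

definition is_rep ::
    "('k::field \<Rightarrow> 'v::ab_group_add \<Rightarrow> 'v) \<Rightarrow> 'a quiver \<Rightarrow> ('a, 'v) rep \<Rightarrow> bool" where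
  "is_rep s Q M \<longleftrightarrow>
     (\<forall>i\<in>qverts Q. module.subspace s (space_at M i) \<and>
        (\<exists>B. finite B \<and> module.span s B = space_at M i)) \<and>
     (\<forall>(i, j)\<in>qarrows Q. linear_between s (space_at M i) (space_at M j) (map_at M (i, j)))"

text \<open>To make equality of morphisms the right one, the component at a vertex is required to vanish
  outside its domain, and the components at indices that are not vertices are zero.\<close>

definition rep_hom :: "('k::field \<Rightarrow> 'v::ab_group_add \<Rightarrow> 'v) \<Rightarrow> 'a quiver
    \<Rightarrow> ('a, 'v) rep \<Rightarrow> ('a, 'v) rep \<Rightarrow> ('a \<Rightarrow> 'v \<Rightarrow> 'v) set" where
  "rep_hom s Q M N = {f.
     (\<forall>i\<in>qverts Q. linear_between s (space_at M i) (space_at N i) (f i) \<and>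
        (\<forall>x. x \<notin> space_at M i \<longrightarrow> f i x = 0)) \<and>
     (\<forall>i. i \<notin> qverts Q \<longrightarrow> f i = (\<lambda>x. 0)) \<and>
     (\<forall>(i, j)\<in>qarrows Q. \<forall>x\<in>space_at M i. f j (map_at M (i, j) x) = map_at N (i, j) (f i x))}"

definition rep_category :: "('k::field \<Rightarrow> 'v::ab_group_add \<Rightarrow> 'v) \<Rightarrow> 'a quiver
    \<Rightarrow> (('a, 'v) rep, 'a \<Rightarrow> 'v \<Rightarrow> 'v, 'k) linear_category_data" where
  "rep_category s Q =
     \<lparr>obj = {M. is_rep s Q M},
      hom = rep_hom s Q,
      cmp = (\<lambda>L M N g f i x. g i (f i x)),
      idm = (\<lambda>M i x. if i \<in> qverts Q \<and> x \<in> space_at M i then x else 0),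
      hadd = (\<lambda>M N f g i x. f i x + g i x),
      hscale = (\<lambda>M N c f i x. s c (f i x))\<rparr>"

definition subrep :: "('k::field \<Rightarrow> 'v::ab_group_add \<Rightarrow> 'v) \<Rightarrow> 'a quiver
    \<Rightarrow> ('a, 'v) rep \<Rightarrow> ('a \<Rightarrow> 'v set) \<Rightarrow> bool" where
  "subrep s Q M U \<longleftrightarrow>
     (\<forall>i\<in>qverts Q. module.subspace s (U i) \<and> U i \<subseteq> space_at M i) \<and>
     (\<forall>(i, j)\<in>qarrows Q. map_at M (i, j) ` U i \<subseteq> U j)"

definition zero_family :: "'a quiver \<Rightarrow> ('a \<Rightarrow> 'v::zero set) \<Rightarrow> bool" where
  "zero_family Q U \<longleftrightarrow> (\<forall>i\<in>qverts Q. U i = {0})"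

definition indecomposable ::
    "('k::field \<Rightarrow> 'v::ab_group_add \<Rightarrow> 'v) \<Rightarrow> 'a quiver \<Rightarrow> ('a, 'v) rep \<Rightarrow> bool" where
  "indecomposable s Q M \<longleftrightarrow> is_rep s Q M \<and> \<not> zero_family Q (space_at M) \<and>
     (\<forall>U W. subrep s Q M U \<and> subrep s Q M W \<and>
        (\<forall>i\<in>qverts Q. U i \<inter> W i = {0} \<and> {u + w | u w. u \<in> U i \<and> w \<in> W i} = space_at M i)
        \<longrightarrow> zero_family Q U \<or> zero_family Q W)"

definition ind_representatives :: "('k::field \<Rightarrow> 'v::ab_group_add \<Rightarrow> 'v) \<Rightarrow> 'a quiver
    \<Rightarrow> ('a, 'v) rep set \<Rightarrow> bool" where
  "ind_representatives s Q I \<longleftrightarrow>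
     (\<forall>M\<in>I. indecomposable s Q M) \<and>
     (\<forall>M. indecomposable s Q M \<longrightarrow> (\<exists>!N. N \<in> I \<and> isomorphic_in (rep_category s Q) M N))"

abbreviation ind_category :: "('k::field \<Rightarrow> 'v::ab_group_add \<Rightarrow> 'v) \<Rightarrow> 'a quiver
    \<Rightarrow> ('a, 'v) rep set \<Rightarrow> (('a, 'v) rep, 'a \<Rightarrow> 'v \<Rightarrow> 'v, 'k) linear_category_data" where
  "ind_category s Q I \<equiv> full_subcategory (rep_category s Q) I"


section \<open>Path categories and mesh categories\<close>

text \<open>A path is the nonempty list of the vertices it visits, in order.\<close>

definition qpaths :: "('a, 'x) quiver_scheme \<Rightarrow> 'a \<Rightarrow> 'a \<Rightarrow> 'a list set" where
  "qpaths \<Gamma> x y = {p. p \<noteq> [] \<and> hd p = x \<and> last p = y \<and> set p \<subseteq> qverts \<Gamma> \<and>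
     successively (\<lambda>u v. (u, v) \<in> qarrows \<Gamma>) p}"

text \<open>The vector space with basis \<open>qpaths \<Gamma> x y\<close>, as finitely supported coefficient functions.\<close>

definition path_hom :: "('a, 'x) quiver_scheme \<Rightarrow> 'a \<Rightarrow> 'a \<Rightarrow> ('a list \<Rightarrow> 'k::field) set" where
  "path_hom \<Gamma> x y = {f. finite {p. f p \<noteq> 0} \<and> {p. f p \<noteq> 0} \<subseteq> qpaths \<Gamma> x y}"

text \<open>Bilinear extension of concatenation, first \<open>f\<close> and then \<open>g\<close>: the sum runs over the ways of
  cutting the path at one of its vertices, which belongs to both pieces.\<close>

definition path_comp :: "('a list \<Rightarrow> 'k::field) \<Rightarrow> ('a list \<Rightarrow> 'k) \<Rightarrow> 'a list \<Rightarrow> 'k" where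
  "path_comp g f = (\<lambda>p. \<Sum>k<length p. g (drop k p) * f (take (Suc k) p))"

record 'a translation_quiver = "'a quiver" +
  tdom :: "'a set"
  tau :: "'a \<Rightarrow> 'a"

definition mesh_relation :: "('a, 'x) translation_quiver_scheme \<Rightarrow> 'a \<Rightarrow> 'a list \<Rightarrow> 'k::field" where
  "mesh_relation \<Gamma> x = (\<lambda>p. if \<exists>y. (y, x) \<in> qarrows \<Gamma> \<and> p = [tau \<Gamma> x, y, x] then 1 else 0)"

inductive mesh_ideal ::
    "('a, 'x) translation_quiver_scheme \<Rightarrow> 'a \<Rightarrow> 'a \<Rightarrow> ('a list \<Rightarrow> 'k::field) \<Rightarrow> bool"
  for \<Gamma> where
  mesh: "x \<in> tdom \<Gamma> \<Longrightarrow> mesh_ideal \<Gamma> (tau \<Gamma> x) x (mesh_relation \<Gamma> x)"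
| zero: "mesh_ideal \<Gamma> x y (\<lambda>p. 0)"
| add: "mesh_ideal \<Gamma> x y f \<Longrightarrow> mesh_ideal \<Gamma> x y g \<Longrightarrow> mesh_ideal \<Gamma> x y (\<lambda>p. f p + g p)"
| scale: "mesh_ideal \<Gamma> x y f \<Longrightarrow> mesh_ideal \<Gamma> x y (\<lambda>p. c * f p)"
| post: "mesh_ideal \<Gamma> x y f \<Longrightarrow> g \<in> path_hom \<Gamma> y z \<Longrightarrow> mesh_ideal \<Gamma> x z (path_comp g f)"
| pre: "mesh_ideal \<Gamma> y z f \<Longrightarrow> g \<in> path_hom \<Gamma> x y \<Longrightarrow> mesh_ideal \<Gamma> x z (path_comp f g)"

definition mesh_class :: "('a, 'x) translation_quiver_scheme \<Rightarrow> 'a \<Rightarrow> 'a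
    \<Rightarrow> ('a list \<Rightarrow> 'k::field) \<Rightarrow> ('a list \<Rightarrow> 'k) set" where
  "mesh_class \<Gamma> x y f = {g \<in> path_hom \<Gamma> x y. mesh_ideal \<Gamma> x y (\<lambda>p. g p - f p)}"

definition mesh_category :: "('a, 'x) translation_quiver_scheme
    \<Rightarrow> ('a, ('a list \<Rightarrow> 'k::field) set, 'k) linear_category_data" where
  "mesh_category \<Gamma> =
     \<lparr>obj = qverts \<Gamma>,
      hom = (\<lambda>x y. mesh_class \<Gamma> x y ` path_hom \<Gamma> x y),
      cmp = (\<lambda>x y z G F. \<Union>g\<in>G. \<Union>f\<in>F. mesh_class \<Gamma> x z (path_comp g f)),
      idm = (\<lambda>x. mesh_class \<Gamma> x x (\<lambda>p. if p = [x] then 1 else 0)),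
      hadd = (\<lambda>x y F G. \<Union>f\<in>F. \<Union>g\<in>G. mesh_class \<Gamma> x y (\<lambda>p. f p + g p)),
      hscale = (\<lambda>x y c F. \<Union>f\<in>F. mesh_class \<Gamma> x y (\<lambda>p. c * f p))\<rparr>"


section \<open>The polygon and its line segments\<close>

definition upper_barred :: "nat \<Rightarrow> nat quiver \<Rightarrow> nat set" where
  "upper_barred n Q = {i \<in> {1..n + 1}. (i, i + 1) \<in> qarrows Q}"

definition lower_barred :: "nat \<Rightarrow> nat quiver \<Rightarrow> nat set" where
  "lower_barred n Q = {i \<in> {1..n + 1}. (i + 1, i) \<in> qarrows Q}"

text \<open>\<open>P i\<close> is the point with label \<open>i\<close>. The first condition says that \<open>P 0, \<dots>, P (n + 2)\<close> are the
  vertices of a convex polygon, i.e. each is an extreme point of their convex hull.\<close>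

definition is_polygon :: "nat \<Rightarrow> nat quiver \<Rightarrow> (nat \<Rightarrow> real \<times> real) \<Rightarrow> bool" where
  "is_polygon n Q P \<longleftrightarrow>
     (\<forall>i\<le>n + 2. P i \<notin> convex hull (P ` ({..n + 2} - {i}))) \<and>
     (\<forall>i j. i < j \<and> j \<le> n + 2 \<longrightarrow> fst (P i) < fst (P j)) \<and>
     snd (P 0) = snd (P (n + 2)) \<and>
     (\<forall>i\<in>upper_barred n Q. snd (P i) > snd (P 0)) \<and>
     (\<forall>i\<in>lower_barred n Q. snd (P i) < snd (P 0))"

definition right_of :: "real \<times> real \<Rightarrow> real \<times> real \<Rightarrow> real \<times> real \<Rightarrow> bool" where
  "right_of a b c \<longleftrightarrow>
     (fst b - fst a) * (snd c - snd a) - (snd b - snd a) * (fst c - fst a) < 0"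

text \<open>Going clockwise from a vertex along the edge to the next one, the rest of the polygon lies on
  the right-hand side.\<close>

definition clockwise_edge :: "nat \<Rightarrow> (nat \<Rightarrow> real \<times> real) \<Rightarrow> nat \<Rightarrow> nat \<Rightarrow> bool" where
  "clockwise_edge n P l m \<longleftrightarrow> l \<le> n + 2 \<and> m \<le> n + 2 \<and> l \<noteq> m \<and>
     (\<forall>q\<le>n + 2. q \<noteq> l \<and> q \<noteq> m \<longrightarrow> right_of (P l) (P m) (P q))"

definition cw_neighbor :: "nat \<Rightarrow> (nat \<Rightarrow> real \<times> real) \<Rightarrow> nat \<Rightarrow> nat" where
  "cw_neighbor n P l = (THE m. clockwise_edge n P l m)"

definition ccw_neighbor :: "nat \<Rightarrow> (nat \<Rightarrow> real \<times> real) \<Rightarrow> nat \<Rightarrow> nat" where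
  "ccw_neighbor n P l = (THE m. clockwise_edge n P m l)"

text \<open>The line segment joining \<open>P i\<close> and \<open>P j\<close>, \<open>i < j\<close>, is recorded as the pair \<open>(i, j)\<close>; in a
  convex polygon distinct pairs give distinct segments.\<close>

definition line_segments :: "nat \<Rightarrow> (nat \<times> nat) set" where
  "line_segments n = {(i, j). i < j \<and> j \<le> n + 2}"

definition pivots :: "nat \<Rightarrow> (nat \<Rightarrow> real \<times> real) \<Rightarrow> nat \<times> nat \<Rightarrow> (nat \<times> nat) set" where
  "pivots n P = (\<lambda>(i, j).
     {(i, j') | j'. j' = ccw_neighbor n P j \<and> i < j'} \<union>
     {(i', j) | i'. i' = ccw_neighbor n P i \<and> i' < j})"

definition segment_quiver :: "nat \<Rightarrow> (nat \<Rightarrow> real \<times> real) \<Rightarrow> (nat \<times> nat) translation_quiver" where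
  "segment_quiver n P =
     \<lparr>qverts = line_segments n,
      qarrows = {(\<gamma>, \<gamma>'). \<gamma> \<in> line_segments n \<and> \<gamma>' \<in> pivots n P \<gamma>},
      tdom = {(i, j) \<in> line_segments n. cw_neighbor n P i < cw_neighbor n P j},
      tau = (\<lambda>(i, j). (cw_neighbor n P i, cw_neighbor n P j))\<rparr>"

abbreviation segment_category :: "nat \<Rightarrow> (nat \<Rightarrow> real \<times> real)
    \<Rightarrow> (nat \<times> nat, ((nat \<times> nat) list \<Rightarrow> 'k::field) set, 'k) linear_category_data" where
  "segment_category n P \<equiv> mesh_category (segment_quiver n P)"

end

(*
  Counting the boundary vertices counterclockwise from n + 2 for left endpoints and from 0 for right
  endpoints embeds the translation quiver of line segments into the grid Z x Z, with convex rows and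
  columns, pivots as unit steps and R as the diagonal shift.  In the mesh category of such a quiver two
  paths with the same ends agree up to sign when the rectangle they span lies in the quiver, and vanish
  otherwise; hence every morphism space has dimension one or zero, according to this condition.

  The segment from a to b corresponds to the representation with support {a + 1, ..., b}.  An
  indecomposable representation has spaces of dimension at most one: the part of the representation on
  either side of a vertex i induces a flag in the space at i, a decomposition compatible with both flags
  extends to the whole representation, and two flags always admit a compatible splitting with a
  one-dimensional summand.  There is a nonzero morphism between two interval representations, unique up to
  scalars, exactly under the rectangle condition, so that sending the signed sum of the coefficients of a
  path combination to the corresponding multiple of this morphism is an equivalence.
*)
theory Submission
  imports Defs
begin

text \<open>A mesh with two middle vertices gives a sum of paths, not a difference, so paths with
  equal ends cannot simply be identified; attaching signs to the vertical steps repairs this.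
  Rewriting paths bounds the quotient from above only. That nothing further collapses needs an
  invariant of cosets, the signed sum of coefficients, which vanishes on the generators and is
  multiplicative.

  The boundary order is cyclic whereas a grid needs linear coordinates. It can be cut open because
  \<open>n + 2\<close> is never a left endpoint and \<open>0\<close> never a right one: leaving out
  a different vertex for each coordinate removes the wrap-around.

  The orientation of the quiver is arbitrary, so summands are not peeled off from a sink or source.
  A flag records through images and kernels all that one side of a vertex demands of a splitting
  there, which is why compatibility with two flags suffices.

  Both kinds of morphism spaces end up parametrised by the same scalars, and the category laws for
  cosets are inherited from representations through this bijection.\<close>

section \<open>Transport of category structure along bijections\<close>

text \<open>Only \<open>D\<close> is assumed to be a category: injectivity of \<open>m\<close> pulls
  the unit and associativity laws back to \<open>C\<close>, so they never have to be checked for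
  cosets. The inverse is strict, hence identities serve as the natural isomorphisms.\<close>

lemma transported_equivalence:
  fixes C :: "('o, 'm, 'x) category_data_scheme" and D :: "('p, 'q, 'y) category_data_scheme"
  assumes D: "is_category D"
    and b: "bij_betw b (obj C) (obj D)"
    and m: "\<And>X Y. X \<in> obj C \<Longrightarrow> Y \<in> obj C \<Longrightarrow>
              bij_betw (m X Y) (hom C X Y) (hom D (b X) (b Y))"
    and id_hom: "\<And>X. X \<in> obj C \<Longrightarrow> idm C X \<in> hom C X X"
    and id_m: "\<And>X. X \<in> obj C \<Longrightarrow> m X X (idm C X) = idm D (b X)"
    and cmp_hom: "\<And>X Y Z f g. \<lbrakk>X \<in> obj C; Y \<in> obj C; Z \<in> obj C; f \<in> hom C X Y; g \<in> hom C Y Z\<rbrakk>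
              \<Longrightarrow> cmp C X Y Z g f \<in> hom C X Z"
    and cmp_m: "\<And>X Y Z f g. \<lbrakk>X \<in> obj C; Y \<in> obj C; Z \<in> obj C; f \<in> hom C X Y; g \<in> hom C Y Z\<rbrakk>
              \<Longrightarrow> m X Z (cmp C X Y Z g f) = cmp D (b X) (b Y) (b Z) (m Y Z g) (m X Y f)"
  shows "is_equivalence C D \<lparr>fobj = b, fmor = m\<rparr>"
proof -
  have bD: "b X \<in> obj D" if "X \<in> obj C" for X
    using b that by (auto dest: bij_betwE)
  have mD: "m X Y f \<in> hom D (b X) (b Y)" if "X \<in> obj C" "Y \<in> obj C" "f \<in> hom C X Y" for X Y f
    using m[OF that(1,2)] that(3) by (auto dest: bij_betwE)
  have m_inj: "f = g" if "X \<in> obj C" "Y \<in> obj C" "f \<in> hom C X Y" "g \<in> hom C X Y"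
    "m X Y f = m X Y g" for X Y f g
    using m[OF that(1,2)] that(3-5) by (auto simp: bij_betw_def inj_on_def)
  have idl: "cmp D X X Y f (idm D X) = f" and idr: "cmp D X Y Y (idm D Y) f = f"
    if "X \<in> obj D" "Y \<in> obj D" "f \<in> hom D X Y" for X Y f
    using D that unfolding is_category_def by auto
  have idD: "idm D X \<in> hom D X X" if "X \<in> obj D" for X
    using D that unfolding is_category_def by auto
  have cD: "cmp D X Y Z g f \<in> hom D X Z"
    if "X \<in> obj D" "Y \<in> obj D" "Z \<in> obj D" "f \<in> hom D X Y" "g \<in> hom D Y Z" for X Y Z f g
    using D that unfolding is_category_def by blast
  have assocD: "cmp D W Y Z h (cmp D W X Y g f) = cmp D W X Z (cmp D X Y Z h g) f"
    if "W \<in> obj D" "X \<in> obj D" "Y \<in> obj D" "Z \<in> obj D" "f \<in> hom D W X" "g \<in> hom D X Y" "h \<in> hom D Y Z"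
    for W X Y Z f g h
    using D that unfolding is_category_def by blast
  have idlC: "cmp C X X Y f (idm C X) = f" if "X \<in> obj C" "Y \<in> obj C" "f \<in> hom C X Y" for X Y f
    by (rule m_inj[of X Y]) (simp_all add: that id_hom cmp_hom cmp_m id_m idl bD mD)
  have idrC: "cmp C X Y Y (idm C Y) f = f" if "X \<in> obj C" "Y \<in> obj C" "f \<in> hom C X Y" for X Y f
    by (rule m_inj[of X Y]) (simp_all add: that id_hom cmp_hom cmp_m id_m idr bD mD)
  have assocC: "cmp C W Y Z h (cmp C W X Y g f) = cmp C W X Z (cmp C X Y Z h g) f"
    if "W \<in> obj C" "X \<in> obj C" "Y \<in> obj C" "Z \<in> obj C" "f \<in> hom C W X" "g \<in> hom C X Y" "h \<in> hom C Y Z"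
    for W X Y Z f g h
  proof (rule m_inj[of W Z])
    have gf: "cmp C W X Y g f \<in> hom C W Y" and hg: "cmp C X Y Z h g \<in> hom C X Z"
      using that cmp_hom by blast+
    show "cmp C W Y Z h (cmp C W X Y g f) \<in> hom C W Z" "cmp C W X Z (cmp C X Y Z h g) f \<in> hom C W Z"
      using that gf hg cmp_hom by blast+
    show "m W Z (cmp C W Y Z h (cmp C W X Y g f)) = m W Z (cmp C W X Z (cmp C X Y Z h g) f)"
      using cmp_m[OF that(1,3,4) gf that(7)] cmp_m[OF that(1,2,4,5) hg]
        cmp_m[OF that(1,2,3,5,6)] cmp_m[OF that(2,3,4,6,7)]
        assocD[OF bD bD bD bD mD mD mD, OF that(1,2,3,4,1,2,5,2,3,6,3,4,7)] by simp
  qed (use that in auto)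
  have C: "is_category C"
    unfolding is_category_def using id_hom cmp_hom idlC idrC assocC by simp
  define b' where "b' = inv_into (obj C) b"
  define m' where "m' X Y = inv_into (hom C (b' X) (b' Y)) (m (b' X) (b' Y))" for X Y
  have b'C: "b' X \<in> obj C" and bb': "b (b' X) = X" if "X \<in> obj D" for X
    using b that by (auto simp: b'_def bij_betw_def inv_into_into f_inv_into_f)
  have b'b: "b' (b X) = X" if "X \<in> obj C" for X
    using b that by (auto simp: b'_def bij_betw_def)
  have mm': "m (b' X) (b' Y) (m' X Y f) = f" and m'C: "m' X Y f \<in> hom C (b' X) (b' Y)"
    if "X \<in> obj D" "Y \<in> obj D" "f \<in> hom D X Y" for X Y f
    using m[OF b'C b'C, OF that(1,2)] that bb'
    by (auto simp: m'_def bij_betw_def inv_into_into f_inv_into_f)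
  have m'm: "m' (b X) (b Y) (m X Y f) = f" if "X \<in> obj C" "Y \<in> obj C" "f \<in> hom C X Y" for X Y f
    using m[OF that(1,2)] that b'b by (auto simp: m'_def bij_betw_def)
  let ?F = "\<lparr>fobj = b, fmor = m\<rparr>"
  let ?G = "\<lparr>fobj = b', fmor = m'\<rparr>"
  have F: "is_functor C D ?F"
    unfolding is_functor_def using C D bD mD id_m cmp_m by simp
  have G1: "m' X X (idm D X) = idm C (b' X)" if "X \<in> obj D" for X
    by (rule m_inj[of "b' X" "b' X"]) (simp_all add: that b'C m'C mm' idD id_hom id_m bb')
  have G2: "m' X Z (cmp D X Y Z g f) = cmp C (b' X) (b' Y) (b' Z) (m' Y Z g) (m' X Y f)"
    if "X \<in> obj D" "Y \<in> obj D" "Z \<in> obj D" "f \<in> hom D X Y" "g \<in> hom D Y Z" for X Y Z f g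
    using that by (intro m_inj[of "b' X" "b' Z"]) (simp_all add: b'C m'C mm' cD cmp_hom cmp_m bb')
  have G: "is_functor D C ?G"
    unfolding is_functor_def using C D b'C m'C G1 G2 by simp
  have isoC: "isomorphism_in C X X (idm C X)" if "X \<in> obj C" for X
    unfolding isomorphism_in_def using that id_hom idlC by (metis (full_types))
  have isoD: "isomorphism_in D X X (idm D X)" if "X \<in> obj D" for X
    unfolding isomorphism_in_def using that idD idl by (metis (full_types))
  have GF: "naturally_isomorphic C C (comp_functor ?G ?F) id_functor"
    unfolding naturally_isomorphic_def comp_functor_def id_functor_def
    by (rule exI[of _ "idm C"]) (simp add: isoC b'b m'm idlC idrC)
  have FG: "naturally_isomorphic D D (comp_functor ?F ?G) id_functor"
    unfolding naturally_isomorphic_def comp_functor_def id_functor_def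
    by (rule exI[of _ "idm D"]) (simp add: isoD bb' mm' idl idr)
  show ?thesis
    unfolding is_equivalence_def using F G GF FG by blast
qed

definition pbasis :: "'a list \<Rightarrow> 'a list \<Rightarrow> 'k::field" where
  "pbasis p = (\<lambda>q. if q = p then 1 else 0)"

section \<open>Mesh categories of grid quivers\<close>

text \<open>Operations on cosets are unions over representatives; such a union collapses once all
  representatives yield the same coset.\<close>

lemma UN_UN_const:
  "a \<in> A \<Longrightarrow> b \<in> B \<Longrightarrow> (\<And>a b. a \<in> A \<Longrightarrow> b \<in> B \<Longrightarrow> C a b = X) \<Longrightarrow> (\<Union>a\<in>A. \<Union>b\<in>B. C a b) = X"
  by auto

section \<open>Composition of path combinations\<close>

lemma path_comp_diff_left: "path_comp (\<lambda>p. g p - h p) f = (\<lambda>p. path_comp g f p - path_comp h f p)"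
  and path_comp_scale_left: "path_comp (\<lambda>p. c * g p) f = (\<lambda>p. c * path_comp g f p)"
  and path_comp_add_right: "path_comp g (\<lambda>p. f p + h p) = (\<lambda>p. path_comp g f p + path_comp g h p)"
  by (auto simp: path_comp_def algebra_simps sum_subtractf sum.distrib sum_distrib_left)

text \<open>The sum runs over all cuts of the path; the last hypothesis kills every cut except the
  one at the end of \<open>p\<close>.\<close>

lemma path_comp_append:
  assumes "p \<noteq> []" "q \<noteq> []" "last p = hd q"
    and "\<And>k. k < length (p @ tl q) \<Longrightarrow> Suc k \<noteq> length p \<Longrightarrow> f (take (Suc k) (p @ tl q)) = 0"
  shows "path_comp g f (p @ tl q) = g q * f p"
proof -
  obtain p' where p': "p = p' @ [hd q]"
    using assms(1,3) by (metis append_butlast_last_id)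
  hence pq: "p @ tl q = p' @ q" using assms(2) by simp
  have "path_comp g f (p @ tl q) = (\<Sum>k<length (p @ tl q). if k = length p' then g q * f p else 0)"
    unfolding path_comp_def
  proof (rule sum.cong)
    fix k assume k: "k \<in> {..<length (p @ tl q)}"
    show "g (drop k (p @ tl q)) * f (take (Suc k) (p @ tl q)) = (if k = length p' then g q * f p else 0)"
    proof (cases "k = length p'")
      case True
      hence "drop k (p @ tl q) = q" unfolding pq by simp
      moreover have "take (Suc k) (p @ tl q) = p" using True p' by simp
      ultimately show ?thesis using True by simp
    qed (use assms(4)[of k] k p' in auto)
  qed simp
  also have "\<dots> = g q * f p" using p' by simp
  finally show ?thesis .
qed

lemma path_comp_nonzero:
  assumes "path_comp g f p \<noteq> 0"
  obtains q r where "f q \<noteq> 0" "g r \<noteq> 0" "p = q @ tl r" "r \<noteq> []"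
proof -
  obtain k where k: "k < length p" "g (drop k p) * f (take (Suc k) p) \<noteq> 0"
    using assms unfolding path_comp_def by (metis (no_types, lifting) lessThan_iff sum.neutral)
  have "tl (drop k p) = drop (Suc k) p" by (simp add: drop_Suc tl_drop)
  hence "p = take (Suc k) p @ tl (drop k p)" by (simp only: append_take_drop_id)
  thus thesis using that[of "take (Suc k) p" "drop k p"] k by simp
qed

lemma path_comp_basis:
  assumes "p \<noteq> []" "q \<noteq> []" "last p = hd q"
  shows "path_comp (pbasis q) (pbasis p) = (pbasis (p @ tl q) :: 'a list \<Rightarrow> 'k::field)"
proof
  fix r
  show "path_comp (pbasis q) (pbasis p) r = (pbasis (p @ tl q) r :: 'k)"
  proof (cases "r = p @ tl q")
    case True
    have "take (Suc k) (p @ tl q) \<noteq> p" if "k < length (p @ tl q)" "Suc k \<noteq> length p" for k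
      using that by (metis Suc_leI length_take min.absorb2)
    hence "path_comp (pbasis q) (pbasis p) (p @ tl q) = pbasis q q * (pbasis p p :: 'k)"
      by (intro path_comp_append[OF assms]) (simp add: pbasis_def)
    thus ?thesis using True by (simp add: pbasis_def)
  next
    case False
    have "path_comp (pbasis q) (pbasis p) r = (0 :: 'k)"
    proof (rule ccontr)
      assume "path_comp (pbasis q) (pbasis p) r \<noteq> (0 :: 'k)"
      then obtain p' q' where "pbasis p p' \<noteq> (0 :: 'k)" "pbasis q q' \<noteq> (0 :: 'k)" "r = p' @ tl q'"
        by (rule path_comp_nonzero)
      thus False using False by (simp add: pbasis_def split: if_splits)
    qed
    thus ?thesis using False by (simp add: pbasis_def)
  qed
qed

lemma pbasis_hom: "p \<in> qpaths \<Gamma> x y \<Longrightarrow> pbasis p \<in> path_hom \<Gamma> x y"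
  by (auto simp: pbasis_def path_hom_def)

lemma path_hom_zero: "(\<lambda>p. 0) \<in> path_hom \<Gamma> x y"
  by (simp add: path_hom_def)

lemma path_hom_add:
  assumes "f \<in> path_hom \<Gamma> x y" "g \<in> path_hom \<Gamma> x y"
  shows "(\<lambda>p. f p + g p) \<in> path_hom \<Gamma> x y"
proof -
  have sub: "{p. f p + g p \<noteq> 0} \<subseteq> {p. f p \<noteq> 0} \<union> {p. g p \<noteq> 0}" by auto
  moreover have fin: "finite ({p. f p \<noteq> 0} \<union> {p. g p \<noteq> 0})"
    and paths: "{p. f p \<noteq> 0} \<union> {p. g p \<noteq> 0} \<subseteq> qpaths \<Gamma> x y"
    using assms unfolding path_hom_def by simp_all
  show ?thesis unfolding path_hom_def mem_Collect_eq
    using finite_subset[OF sub fin] subset_trans[OF sub paths] by blast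
qed

lemma path_hom_scale:
  assumes "f \<in> path_hom \<Gamma> x y"
  shows "(\<lambda>p. c * f p) \<in> path_hom \<Gamma> x y"
proof -
  have "{p. c * f p \<noteq> 0} \<subseteq> {p. f p \<noteq> 0}" by auto
  thus ?thesis using assms finite_subset unfolding path_hom_def by fastforce
qed

lemma path_hom_diff:
  assumes "f \<in> path_hom \<Gamma> x y" "g \<in> path_hom \<Gamma> x y"
  shows "(\<lambda>p. f p - g p) \<in> path_hom \<Gamma> x y"
  using path_hom_add[OF assms(1) path_hom_scale[OF assms(2), of "-1"]] by simp

lemma qpaths_append:
  assumes "p \<in> qpaths \<Gamma> x y" "q \<in> qpaths \<Gamma> y z"
  shows "p @ tl q \<in> qpaths \<Gamma> x z"
proof (cases q)
  case (Cons a q')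
  thus ?thesis using assms unfolding qpaths_def
    by (cases q') (auto simp: successively_append_iff)
qed (use assms in \<open>simp add: qpaths_def\<close>)

lemma path_hom_comp:
  assumes "f \<in> path_hom \<Gamma> x y" "g \<in> path_hom \<Gamma> y z"
  shows "path_comp g f \<in> path_hom \<Gamma> x z"
proof -
  have "{p. path_comp g f p \<noteq> 0} \<subseteq> (\<lambda>(q, r). q @ tl r) ` ({p. f p \<noteq> 0} \<times> {p. g p \<noteq> 0})"
  proof
    fix p assume "p \<in> {p. path_comp g f p \<noteq> 0}"
    then obtain q r where "f q \<noteq> 0" "g r \<noteq> 0" "p = q @ tl r"
      using path_comp_nonzero[of g f p] by blast
    thus "p \<in> (\<lambda>(q, r). q @ tl r) ` ({p. f p \<noteq> 0} \<times> {p. g p \<noteq> 0})" by force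
  qed
  moreover have "(\<lambda>(q, r). q @ tl r) ` ({p. f p \<noteq> 0} \<times> {p. g p \<noteq> 0}) \<subseteq> qpaths \<Gamma> x z"
    using assms qpaths_append unfolding path_hom_def by fast
  moreover have "finite ((\<lambda>(q, r). q @ tl r) ` ({p. f p \<noteq> 0} \<times> {p. g p \<noteq> 0}))"
    using assms by (simp add: path_hom_def)
  ultimately show ?thesis unfolding path_hom_def using finite_subset by blast
qed

lemma mesh_ideal_sum:
  assumes "finite A" "\<And>a. a \<in> A \<Longrightarrow> mesh_ideal \<Gamma> x y (F a)"
  shows "mesh_ideal \<Gamma> x y (\<lambda>p. \<Sum>a\<in>A. c a * F a p)"
  using assms
proof (induction A)
  case (insert a A)
  hence "mesh_ideal \<Gamma> x y (\<lambda>p. c a * F a p + (\<Sum>a\<in>A. c a * F a p))"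
    by (intro mesh_ideal.add mesh_ideal.scale) auto
  with insert show ?case by simp
qed (simp add: mesh_ideal.zero)

text \<open>A vertex is in the domain of the translation as soon as its diagonal predecessor is a
  vertex, whether or not the two other corners of the unit square are. A mesh with only one middle
  vertex has a monomial relation, and this is the source of vanishing paths.\<close>

locale grid_quiver =
  fixes \<Gamma> :: "('a, 'x) translation_quiver_scheme" and cx cy :: "'a \<Rightarrow> int"
  assumes coord_inj: "\<lbrakk>u \<in> qverts \<Gamma>; v \<in> qverts \<Gamma>; cx u = cx v; cy u = cy v\<rbrakk> \<Longrightarrow> u = v"
    and arrow_iff: "(u, v) \<in> qarrows \<Gamma> \<longleftrightarrow> u \<in> qverts \<Gamma> \<and> v \<in> qverts \<Gamma> \<and>
          (cx v = cx u + 1 \<and> cy v = cy u \<or> cx v = cx u \<and> cy v = cy u + 1)"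
    and tdom_iff: "v \<in> tdom \<Gamma> \<longleftrightarrow> v \<in> qverts \<Gamma> \<and>
          (\<exists>u\<in>qverts \<Gamma>. cx v = cx u + 1 \<and> cy v = cy u + 1)"
    and tau_eq: "\<lbrakk>u \<in> qverts \<Gamma>; v \<in> qverts \<Gamma>; cx v = cx u + 1; cy v = cy u + 1\<rbrakk> \<Longrightarrow> tau \<Gamma> v = u"
    and finite_verts: "finite (qverts \<Gamma>)"
    and row_convex: "\<lbrakk>u \<in> qverts \<Gamma>; v \<in> qverts \<Gamma>; cy u = cy v; cx u \<le> t; t \<le> cx v\<rbrakk>
          \<Longrightarrow> \<exists>w\<in>qverts \<Gamma>. cx w = t \<and> cy w = cy v"
    and column_convex: "\<lbrakk>u \<in> qverts \<Gamma>; v \<in> qverts \<Gamma>; cx u = cx v; cy u \<le> t; t \<le> cy v\<rbrakk>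
          \<Longrightarrow> \<exists>w\<in>qverts \<Gamma>. cx w = cx v \<and> cy w = t"
begin

abbreviation "V \<equiv> qverts \<Gamma>"
abbreviation "arr x y \<equiv> (x, y) \<in> qarrows \<Gamma>"
abbreviation "paths \<equiv> qpaths \<Gamma>"
abbreviation "homs \<equiv> path_hom \<Gamma>"
abbreviation "ideal \<equiv> mesh_ideal \<Gamma>"
abbreviation "cls \<equiv> mesh_class \<Gamma>"

definition occ :: "int \<Rightarrow> int \<Rightarrow> bool" where
  "occ r s \<longleftrightarrow> (\<exists>v\<in>V. cx v = r \<and> cy v = s)"

text \<open>By convexity of rows and columns, \<open>rect u v\<close> means that the whole coordinate rectangle spanned by
  \<open>u\<close> and \<open>v\<close> consists of vertices.\<close>

definition rect :: "'a \<Rightarrow> 'a \<Rightarrow> bool" where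
  "rect u v \<longleftrightarrow> u \<in> V \<and> v \<in> V \<and> cx u \<le> cx v \<and> cy u \<le> cy v \<and> occ (cx u) (cy v) \<and> occ (cx v) (cy u)"

lemma occ_vert: "v \<in> V \<Longrightarrow> occ (cx v) (cy v)"
  by (auto simp: occ_def)

lemma occ_row: "occ r s \<Longrightarrow> occ r' s \<Longrightarrow> r \<le> t \<Longrightarrow> t \<le> r' \<Longrightarrow> occ t s"
  unfolding occ_def using row_convex by metis

lemma occ_column: "occ r s \<Longrightarrow> occ r s' \<Longrightarrow> s \<le> t \<Longrightarrow> t \<le> s' \<Longrightarrow> occ r t"
  unfolding occ_def using column_convex by metis

lemma occ_rect:
  assumes "rect u v" "cx u \<le> r" "r \<le> cx v" "cy u \<le> s" "s \<le> cy v"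
  shows "occ r s"
proof -
  have "occ r (cy u)" "occ r (cy v)"
    using assms occ_row[of "cx u" _ "cx v" r] occ_vert by (auto simp: rect_def)
  thus ?thesis using occ_column assms by blast
qed

lemma rect_inner:
  assumes "rect u v" "w \<in> V" "w' \<in> V" "cx u \<le> cx w" "cx w \<le> cx w'" "cx w' \<le> cx v"
    "cy u \<le> cy w" "cy w \<le> cy w'" "cy w' \<le> cy v"
  shows "rect w w'"
  using assms occ_rect[OF assms(1)] by (auto simp: rect_def)

lemma rect_refl: "v \<in> V \<Longrightarrow> rect v v"
  by (auto simp: rect_def occ_vert)

section \<open>Paths in the grid\<close>

lemma path_Cons: "q \<in> paths u y \<Longrightarrow> arr x u \<Longrightarrow> x # q \<in> paths x y"
  by (cases q) (auto simp: qpaths_def arrow_iff)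

lemma path_single: "x \<in> V \<Longrightarrow> [x] \<in> paths x x"
  by (auto simp: qpaths_def)

lemma path_cases:
  assumes "p \<in> paths x y"
  obtains "x = y" "p = [x]" "x \<in> V" | u q where "p = x # q" "arr x u" "q \<in> paths u y"
proof -
  from assms obtain q where q: "p = x # q" by (cases p) (auto simp: qpaths_def)
  show thesis
  proof (cases q)
    case Nil
    thus ?thesis using that(1) assms q by (auto simp: qpaths_def)
  next
    case (Cons u r)
    thus ?thesis using that(2)[of q u] assms q by (auto simp: qpaths_def)
  qed
qed

lemma path_induct [consumes 1, case_names single Cons]:
  assumes "p \<in> paths x y"
    and "\<And>x. x \<in> V \<Longrightarrow> R x x [x]"
    and "\<And>x u q y. \<lbrakk>arr x u; q \<in> paths u y; R u y q\<rbrakk> \<Longrightarrow> R x y (x # q)"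
  shows "R x y p"
  using assms(1)
proof (induction p arbitrary: x)
  case Nil
  thus ?case by (simp add: qpaths_def)
next
  case (Cons a p)
  from Cons.prems show ?case
    by (cases rule: path_cases) (use Cons.IH assms(2,3) in auto)
qed

lemma path_coords: "p \<in> paths x y \<Longrightarrow> cx x \<le> cx y \<and> cy x \<le> cy y \<and> x \<in> V \<and> y \<in> V"
  by (induction rule: path_induct) (auto simp: arrow_iff)

text \<open>Every arrow raises the coordinate sum by one. Hence paths with equal ends have equal
  length, so a path can be cut at a given intermediate vertex in only one place, and an induction on
  length may pass from a path to any other with the same ends.\<close>

lemma path_length: "p \<in> paths x y \<Longrightarrow> int (length p) = cx y - cx x + (cy y - cy x) + 1"
  by (induction rule: path_induct) (auto simp: arrow_iff)

lemma path_exists: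
  assumes "rect x y"
  shows "\<exists>p. p \<in> paths x y"
  using assms
proof (induction "nat (cx y - cx x + (cy y - cy x))" arbitrary: x rule: less_induct)
  case less
  have V: "x \<in> V" "y \<in> V" and le: "cx x \<le> cx y" "cy x \<le> cy y" using less.prems by (auto simp: rect_def)
  show ?case
  proof (cases "x = y")
    case True
    thus ?thesis using path_single V by blast
  next
    case False
    hence "cx x < cx y \<or> cy x < cy y" using coord_inj V le by fastforce
    hence "\<exists>u\<in>V. arr x u \<and> cx u \<le> cx y \<and> cy u \<le> cy y"
    proof
      assume "cx x < cx y"
      hence "occ (cx x + 1) (cy x)" using occ_rect[OF less.prems] le by simp
      thus ?thesis using V le \<open>cx x < cx y\<close> by (auto simp: occ_def arrow_iff)
    next
      assume "cy x < cy y"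
      hence "occ (cx x) (cy x + 1)" using occ_rect[OF less.prems] le by simp
      thus ?thesis using V le \<open>cy x < cy y\<close> by (auto simp: occ_def arrow_iff)
    qed
    then obtain u where u: "u \<in> V" "arr x u" "cx u \<le> cx y" "cy u \<le> cy y" by blast
    hence "rect u y" using rect_inner[OF less.prems] V by (auto simp: arrow_iff)
    moreover have "nat (cx y - cx u + (cy y - cy u)) < nat (cx y - cx x + (cy y - cy x))"
      using u by (auto simp: arrow_iff)
    ultimately show ?thesis using less.hyps path_Cons u(2) by blast
  qed
qed

text \<open>With these signs the two paths around a unit square have opposite signs, so that the mesh
  relations become the vanishing of a signed sum.\<close>

definition step_sign :: "'a \<Rightarrow> 'a \<Rightarrow> 'k::field" where
  "step_sign x y = (if cx x = cx y \<and> odd (cx x) then -1 else 1)"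

fun psign :: "'a list \<Rightarrow> 'k::field" where
  "psign (x # y # p) = step_sign x y * psign (y # p)"
| "psign p = 1"

lemma psign_square [simp]: "psign p * psign p = (1 :: 'k::field)"
proof (induction p rule: psign.induct)
  case (1 x y p)
  have "psign (x # y # p) * psign (x # y # p) = 
    (step_sign x y * step_sign x y :: 'k) * (psign (y # p) * psign (y # p))" by (simp only: psign.simps mult_ac)
  also have "\<dots> = step_sign x y * (step_sign x y :: 'k)"
    by (simp only: 1 mult_1_right)
  also have "\<dots> = 1" by (simp add: step_sign_def)
  finally show ?case .
qed auto

lemma psign_append: "p \<noteq> [] \<Longrightarrow> q \<noteq> [] \<Longrightarrow> last p = hd q \<Longrightarrow>
    psign (p @ tl q) = psign p * psign q"
proof (induction p rule: psign.induct)
  case (1 x y p)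
  thus ?case by simp
next
  case ("2_2" v)
  thus ?case by (cases q) auto
qed auto

section \<open>Paths modulo the mesh ideal\<close>

text \<open>The argument of type \<open>'k itself\<close> fixes the coefficient field, which the two
  vertex lists do not determine.\<close>

definition homotopic :: "'k::field itself \<Rightarrow> 'a \<Rightarrow> 'a \<Rightarrow> 'a list \<Rightarrow> 'a list \<Rightarrow> bool" where
  "homotopic k x y p q \<longleftrightarrow>
     ideal x y (\<lambda>r. psign p * pbasis p r - psign q * (pbasis q r :: 'k))"

lemma homotopic_refl: "homotopic k x y p p"
  unfolding homotopic_def by (simp add: mesh_ideal.zero)

lemma homotopic_sym: "homotopic k x y p q \<Longrightarrow> homotopic k x y q p"
  unfolding homotopic_def by (drule mesh_ideal.scale[where c = "-1"]) simp

lemma homotopic_trans: "homotopic k x y p q \<Longrightarrow> homotopic k x y q r \<Longrightarrow> homotopic k x y p r"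
  unfolding homotopic_def by (drule (1) mesh_ideal.add) simp

lemma mesh_ideal_Cons:
  assumes "arr x u" "p \<in> paths u y" "ideal u y (pbasis p :: 'a list \<Rightarrow> 'k::field)"
  shows "ideal x y (pbasis (x # p) :: 'a list \<Rightarrow> 'k)"
proof -
  have xu: "[x, u] \<in> paths x u" using path_Cons[OF path_single assms(1)] assms(1) by (simp add: arrow_iff)
  have "p \<noteq> []" "hd p = u" using assms(2) by (auto simp: qpaths_def)
  hence "path_comp (pbasis p) (pbasis [x, u]) = (pbasis (x # p) :: 'a list \<Rightarrow> 'k)"
    by (subst path_comp_basis) auto
  thus ?thesis using mesh_ideal.pre[OF assms(3) pbasis_hom[OF xu]] by simp
qed

lemma homotopic_Cons:
  assumes "arr x u" "p \<in> paths u y" "q \<in> paths u y"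
    and "homotopic TYPE('k::field) u y p q"
  shows "homotopic TYPE('k) x y (x # p) (x # q)"
proof -
  have xu: "[x, u] \<in> paths x u" using path_Cons[OF path_single assms(1)] assms(1) by (simp add: arrow_iff)
  have ne: "p \<noteq> []" "hd p = u" "q \<noteq> []" "hd q = u" using assms(2,3) by (auto simp: qpaths_def)
  hence sgn: "psign (x # p) = step_sign x u * (psign p :: 'k)"
    "psign (x # q) = step_sign x u * (psign q :: 'k)"
    by (cases p; cases q; simp)+
  have "path_comp (pbasis p) (pbasis [x, u]) = (pbasis (x # p) :: 'a list \<Rightarrow> 'k)"
    "path_comp (pbasis q) (pbasis [x, u]) = (pbasis (x # q) :: 'a list \<Rightarrow> 'k)"
    by (subst path_comp_basis; use ne in \<open>cases p; cases q; auto\<close>)+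
  hence "ideal x y (\<lambda>r. psign p * pbasis (x # p) r - psign q * (pbasis (x # q) r :: 'k))"
    using mesh_ideal.pre[OF assms(4)[unfolded homotopic_def] pbasis_hom[OF xu]]
    by (simp add: path_comp_diff_left path_comp_scale_left)
  from mesh_ideal.scale[OF this, of "step_sign x u"] show ?thesis
    unfolding homotopic_def sgn by (simp add: algebra_simps)
qed

lemma mesh_ideal_homotopic:
  assumes "homotopic TYPE('k::field) x y p q" "ideal x y (pbasis q :: 'a list \<Rightarrow> 'k)"
  shows "ideal x y (pbasis p :: 'a list \<Rightarrow> 'k)"
proof -
  have "ideal x y (\<lambda>r. psign p * ((psign p * pbasis p r - psign q * pbasis q r) +
      psign q * (pbasis q r :: 'k)))"
    using assms unfolding homotopic_def by (intro mesh_ideal.intros)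
  moreover have "psign p * ((psign p * pbasis p r - psign q * pbasis q r) +
      psign q * (pbasis q r :: 'k)) = pbasis p r" for r
  proof -
    have "psign p * ((psign p * pbasis p r - psign q * pbasis q r) +
      psign q * (pbasis q r :: 'k)) = (psign p * psign p) * pbasis p r"
      by (simp only: diff_add_cancel mult.assoc)
    thus ?thesis by (simp only: psign_square) simp
  qed
  ultimately show ?thesis by (simp only:)
qed

definition diag :: "'a \<Rightarrow> 'a \<Rightarrow> bool" where
  "diag x w \<longleftrightarrow> x \<in> V \<and> w \<in> V \<and> cx w = cx x + 1 \<and> cy w = cy x + 1"

text \<open>A vertex one step before \<open>w\<close> is automatically one step after the opposite
  corner \<open>x\<close>, so each term of the relation is a genuine path.\<close>

lemma mesh_relation_diag:
  assumes "diag x w"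
  shows "mesh_relation \<Gamma> w = (\<lambda>p. if \<exists>y. arr x y \<and> arr y w \<and> p = [x, y, w] then 1 else 0)"
  using assms tau_eq[of x w] unfolding mesh_relation_def diag_def
  by (intro ext if_cong) (auto simp: arrow_iff)

lemma square_unique:
  assumes "diag x w" "arr x u" "arr x u'" "arr x u''" "u \<noteq> u'"
  shows "u'' = u \<or> u'' = u'"
  using assms coord_inj[of u u'] coord_inj[of u u''] coord_inj[of u' u''] by (auto simp: arrow_iff)

lemma arrow_diag:
  assumes "diag x w" "arr x u"
  shows "arr u w"
  using assms by (auto simp: diag_def arrow_iff)

lemma mesh_relation_two:
  assumes "diag x w" "arr x u" "arr x u'" "u \<noteq> u'"
  shows "mesh_relation \<Gamma> w = (\<lambda>p. pbasis [x, u, w] p + pbasis [x, u', w] p)"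
proof
  fix p
  have "arr x y \<and> arr y w \<longleftrightarrow> y = u \<or> y = u'" for y
    using square_unique[OF assms(1-3)] assms arrow_diag[OF assms(1)] by blast
  hence "(\<exists>y. arr x y \<and> arr y w \<and> p = [x, y, w]) \<longleftrightarrow>
      p = [x, u, w] \<or> p = [x, u', w]" by blast
  thus "mesh_relation \<Gamma> w p = pbasis [x, u, w] p + pbasis [x, u', w] p"
    using assms(4) by (simp add: mesh_relation_diag[OF assms(1)] pbasis_def)
qed

lemma mesh_relation_one:
  assumes "diag x w" "arr x u" "\<And>u'. arr x u' \<Longrightarrow> u' = u"
  shows "mesh_relation \<Gamma> w = pbasis [x, u, w]"
proof
  fix p
  have "arr x y \<and> arr y w \<longleftrightarrow> y = u" for y
    using assms arrow_diag[OF assms(1)] by blast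
  hence "(\<exists>y. arr x y \<and> arr y w \<and> p = [x, y, w]) \<longleftrightarrow> p = [x, u, w]"
    by blast
  thus "mesh_relation \<Gamma> w p = pbasis [x, u, w] p"
    by (simp add: mesh_relation_diag[OF assms(1)] pbasis_def)
qed

text \<open>Horizontal steps have sign 1, and the two vertical sides of the square lie in
  neighbouring columns, exactly one of which is odd.\<close>

lemma psign_square_neg:
  assumes "diag x w" "arr x u" "arr x u'" "u \<noteq> u'"
  shows "psign [x, u, w] = - (psign [x, u', w] :: 'k::field)"
proof -
  have "\<not> (cx u = cx u' \<and> cy u = cy u')" using coord_inj assms(2-4) unfolding arrow_iff by blast
  hence "cx u = cx x + 1 \<and> cx u' = cx x \<or> cx u = cx x \<and> cx u' = cx x + 1"
    using assms(2,3) unfolding arrow_iff by linarith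
  moreover have "cx w = cx x + 1" using assms(1) by (simp add: diag_def)
  ultimately show ?thesis by (elim disjE conjE) (simp_all add: step_sign_def)
qed

lemma mesh_square:
  assumes "diag x w"
  shows "ideal x w (mesh_relation \<Gamma> w)"
  using mesh_ideal.mesh[of w \<Gamma>] assms tau_eq[of x w] tdom_iff by (auto simp: diag_def)

text \<open>The mesh relation prolonged by \<open>r\<close> puts the plain sum of the two paths into
  the ideal; as their signs are opposite, this is the signed difference up to a sign.\<close>

lemma homotopic_square:
  assumes "diag x w" "arr x u" "arr x u'" "u \<noteq> u'" "r \<in> paths w y"
  shows "homotopic TYPE('k::field) x y (x # u # r) (x # u' # r)"
proof -
  have r: "r \<noteq> []" "hd r = w" using assms(5) by (auto simp: qpaths_def)
  hence b: "path_comp (pbasis r) (pbasis [x, u, w]) = (pbasis (x # u # r) :: _ \<Rightarrow> 'k)"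
    "path_comp (pbasis r) (pbasis [x, u', w]) = (pbasis (x # u' # r) :: _ \<Rightarrow> 'k)"
    by (subst path_comp_basis; cases r; simp)+
  have "ideal x y (path_comp (pbasis r) (mesh_relation \<Gamma> w) :: _ \<Rightarrow> 'k)"
    by (rule mesh_ideal.post[OF mesh_square[OF assms(1)] pbasis_hom[OF assms(5)]])
  hence "ideal x y (\<lambda>p. pbasis (x # u # r) p + (pbasis (x # u' # r) p :: 'k))"
    by (simp add: mesh_relation_two[OF assms(1-4)] path_comp_add_right b)
  from mesh_ideal.scale[OF this, of "psign (x # u # r)"]
  have *: "ideal x y (\<lambda>p. psign (x # u # r) * pbasis (x # u # r) p +
      psign (x # u # r) * (pbasis (x # u' # r) p :: 'k))"
    by (simp only: distrib_left)
  have "psign (x # u # r) = psign [x, u, w] * (psign r :: 'k)"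
    "psign (x # u' # r) = psign [x, u', w] * (psign r :: 'k)"
    using psign_append[of "[x, u, w]" r] psign_append[of "[x, u', w]" r] r by (cases r; simp)+
  hence "psign (x # u # r) = - (psign (x # u' # r) :: 'k)"
    using psign_square_neg[OF assms(1-4), where 'k = 'k] by (simp only: mult_minus_left)
  thus ?thesis using * unfolding homotopic_def
    by (metis (no_types, lifting) diff_minus_eq_add minus_mult_left minus_minus ext)
qed

lemma zero_square:
  assumes "diag x w" "arr x u" "\<And>u'. arr x u' \<Longrightarrow> u' = u" "r \<in> paths w y"
  shows "ideal x y (pbasis (x # u # r) :: _ \<Rightarrow> 'k::field)"
proof -
  have r: "r \<noteq> []" "hd r = w" using assms(4) by (auto simp: qpaths_def)
  hence b: "path_comp (pbasis r) (pbasis [x, u, w]) = (pbasis (x # u # r) :: _ \<Rightarrow> 'k)"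
    by (subst path_comp_basis; cases r; simp)+
  have "ideal x y (path_comp (pbasis r) (mesh_relation \<Gamma> w) :: _ \<Rightarrow> 'k)"
    by (rule mesh_ideal.post[OF mesh_square[OF assms(1)] pbasis_hom[OF assms(4)]])
  thus ?thesis by (simp add: mesh_relation_one[OF assms(1-3)] b)
qed

text \<open>Paths whose first steps differ are compared through the far corner \<open>w\<close> of
  their first unit square: by induction each tail may be rerouted through \<open>w\<close> and then
  along a common path \<open>r\<close>, and the two rerouted paths differ by one mesh.\<close>

lemma rect_paths_homotopic:
  assumes "p \<in> paths x y" "q \<in> paths x y" "rect x y"
  shows "homotopic TYPE('k::field) x y p q"
  using assms
proof (induction "length p" arbitrary: x p q)
  case 0
  thus ?case by (simp add: qpaths_def)
next
  case (Suc m)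
  have len: "length p = length q" using path_length[OF Suc.prems(1)] path_length[OF Suc.prems(2)] by linarith
  show ?case
    using Suc.prems(1)
  proof (cases rule: path_cases)
    case 1
    hence "q = [x]" using len Suc.prems(2) by (cases q) (auto simp: qpaths_def)
    thus ?thesis using 1 homotopic_refl by simp
  next
    case p: (2 u p')
    show ?thesis
      using Suc.prems(2)
    proof (cases rule: path_cases)
      case 1
      thus ?thesis using p len by (auto simp: qpaths_def)
    next
      case q: (2 u' q')
      have m: "m = length p'" "m = length q'" using p q len Suc.hyps(2) by auto
      have V: "x \<in> V" "y \<in> V" using Suc.prems(3) by (auto simp: rect_def)
      have c: "cx u \<le> cx y" "cy u \<le> cy y" "u \<in> V" "cx u' \<le> cx y" "cy u' \<le> cy y" "u' \<in> V"
        using path_coords[OF p(3)] path_coords[OF q(3)] by auto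
      have rec: "rect u y" "rect u' y"
        using rect_inner[OF Suc.prems(3)] c V p(2) q(2) by (auto simp: arrow_iff)
      show ?thesis
      proof (cases "u = u'")
        case True
        thus ?thesis using Suc.hyps(1)[OF m(1) p(3)] q p rec homotopic_Cons by blast
      next
        case False
        hence ge: "cx x + 1 \<le> cx y" "cy x + 1 \<le> cy y"
          using p(2) q(2) c coord_inj[of u u'] by (auto simp: arrow_iff)
        hence "occ (cx x + 1) (cy x + 1)" using occ_rect[OF Suc.prems(3)] by simp
        then obtain w where w: "diag x w" using V by (auto simp: occ_def diag_def)
        have "rect w y" using rect_inner[OF Suc.prems(3), of w y] w ge V by (auto simp: diag_def)
        then obtain r where r: "r \<in> paths w y" using path_exists by blast
        have "homotopic TYPE('k) x y p (x # u # r)"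
          using Suc.hyps(1)[OF m(1) p(3) path_Cons[OF r arrow_diag[OF w p(2)]] rec(1)]
            homotopic_Cons[OF p(2,3) path_Cons[OF r arrow_diag[OF w p(2)]]] p(1) by simp
        moreover have "homotopic TYPE('k) x y q (x # u' # r)"
          using Suc.hyps(1)[OF m(2) q(3) path_Cons[OF r arrow_diag[OF w q(2)]] rec(2)]
            homotopic_Cons[OF q(2,3) path_Cons[OF r arrow_diag[OF w q(2)]]] q(1) by simp
        ultimately show ?thesis
          using homotopic_square[OF w p(2) q(2) False r] homotopic_trans homotopic_sym by blast
      qed
    qed
  qed
qed

text \<open>The step to \<open>u\<close> leaves the row or column of \<open>x\<close> that contains
  the missing corner; the other corner belongs to the rectangle of \<open>u\<close> as well. A
  different step \<open>u'\<close> stays in that line and still misses the corner, while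
  \<open>w\<close> lies inside the rectangle of \<open>u\<close>.\<close>

lemma non_rect_square:
  assumes "\<not> rect x y" "arr x u" "rect u y"
  shows "\<exists>w. diag x w \<and> rect w y \<and> (\<forall>u'. arr x u' \<and> u' \<noteq> u \<longrightarrow> \<not> rect u' y)"
proof -
  have V: "x \<in> V" "u \<in> V" "y \<in> V" and le: "cx u \<le> cx y" "cy u \<le> cy y"
    and oc: "occ (cx u) (cy y)" "occ (cx y) (cy u)"
    using assms(2,3) by (auto simp: rect_def arrow_iff)
  have "cx u = cx x + 1 \<and> cy u = cy x \<or> cx u = cx x \<and> cy u = cy x + 1"
    using assms(2) by (auto simp: arrow_iff)
  hence "cx x + 1 \<le> cx y \<and> cy x + 1 \<le> cy y \<and>
      (\<forall>u'. arr x u' \<and> u' \<noteq> u \<longrightarrow> \<not> rect u' y)"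
  proof
    assume u: "cx u = cx x + 1 \<and> cy u = cy x"
    hence no: "\<not> occ (cx x) (cy y)" using assms(1) V le oc by (auto simp: rect_def)
    hence "cy x \<noteq> cy y" using occ_vert[OF V(1)] by auto
    moreover have "\<not> rect u' y" if "arr x u'" "u' \<noteq> u" for u'
      using that no u V coord_inj[of u' u] by (auto simp: rect_def arrow_iff)
    ultimately show ?thesis using u le by auto
  next
    assume u: "cx u = cx x \<and> cy u = cy x + 1"
    hence no: "\<not> occ (cx y) (cy x)" using assms(1) V le oc by (auto simp: rect_def)
    hence "cx x \<noteq> cx y" using occ_vert[OF V(1)] by auto
    moreover have "\<not> rect u' y" if "arr x u'" "u' \<noteq> u" for u'
      using that no u V coord_inj[of u' u] by (auto simp: rect_def arrow_iff)
    ultimately show ?thesis using u le by auto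
  qed
  hence lt: "cx x + 1 \<le> cx y" "cy x + 1 \<le> cy y"
    and no: "\<forall>u'. arr x u' \<and> u' \<noteq> u \<longrightarrow> \<not> rect u' y" by auto
  have u: "cx u \<le> cx x + 1" "cy u \<le> cy x + 1" using assms(2) by (auto simp: arrow_iff)
  obtain w where w: "w \<in> V" "cx w = cx x + 1" "cy w = cy x + 1"
    using occ_rect[OF assms(3) u(1) lt(1) u(2) lt(2)] by (auto simp: occ_def)
  hence "rect w y" using rect_inner[OF assms(3), of w y] V lt u by simp
  thus ?thesis using w V no by (auto simp: diag_def)
qed

text \<open>The path is moved across unit squares until it meets a square with a single middle vertex,
  whose mesh relation is a monomial.\<close>

lemma non_rect_path_zero:
  assumes "p \<in> paths x y" "\<not> rect x y"
  shows "ideal x y (pbasis p :: _ \<Rightarrow> 'k::field)"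
  using assms
proof (induction "length p" arbitrary: x p)
  case 0
  thus ?case by (simp add: qpaths_def)
next
  case (Suc m)
  show ?case
    using Suc.prems(1)
  proof (cases rule: path_cases)
    case 1
    thus ?thesis using Suc.prems(2) rect_refl by simp
  next
    case p: (2 u p')
    have m: "m = length p'" using p Suc.hyps(2) by simp
    show ?thesis
    proof (cases "rect u y")
      case False
      thus ?thesis using Suc.hyps(1)[OF m p(3)] mesh_ideal_Cons[OF p(2,3)] p(1) by simp
    next
      case True
      then obtain w where w: "diag x w" "rect w y"
        "\<And>u'. arr x u' \<Longrightarrow> u' \<noteq> u \<Longrightarrow> \<not> rect u' y"
        using non_rect_square[OF Suc.prems(2) p(2)] by blast
      obtain r where r: "r \<in> paths w y" using path_exists w(2) by blast
      have ur: "u # r \<in> paths u y" using path_Cons[OF r arrow_diag[OF w(1) p(2)]] .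
      have "homotopic TYPE('k) x y p (x # u # r)"
        using homotopic_Cons[OF p(2,3) ur rect_paths_homotopic[OF p(3) ur True]] p(1) by simp
      moreover have "ideal x y (pbasis (x # u # r) :: _ \<Rightarrow> 'k)"
      proof (cases "\<exists>u'. arr x u' \<and> u' \<noteq> u")
        case False
        thus ?thesis using zero_square[OF w(1) p(2) _ r] by blast
      next
        case True
        then obtain u' where u': "arr x u'" "u \<noteq> u'" by blast
        have ur': "u' # r \<in> paths u' y" using path_Cons[OF r arrow_diag[OF w(1) u'(1)]] .
        \<comment> \<open>The path \<open>u' # r\<close> is not a tail of \<open>p\<close>; the
          induction hypothesis reaches it because length depends only on the coordinates of the
          ends.\<close>
        have "length (u' # r) = m" using path_length[OF p(3)] path_length[OF ur] m by simp
        hence "ideal u' y (pbasis (u' # r) :: _ \<Rightarrow> 'k)"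
          using Suc.hyps(1)[OF _ ur'] w(3) u' by auto
        hence "ideal x y (pbasis (x # u' # r) :: _ \<Rightarrow> 'k)"
          by (rule mesh_ideal_Cons[OF u'(1) ur'])
        thus ?thesis
          using mesh_ideal_homotopic homotopic_square[OF w(1) p(2) u' r] by blast
      qed
      ultimately show ?thesis using mesh_ideal_homotopic by blast
    qed
  qed
qed

section \<open>The signed coefficient sum as a complete invariant\<close>

definition weight :: "('a list \<Rightarrow> 'k::field) \<Rightarrow> 'k" where
  "weight f = (\<Sum>p | f p \<noteq> 0. f p * psign p)"

definition coeff :: "'a \<Rightarrow> 'a \<Rightarrow> ('a list \<Rightarrow> 'k::field) \<Rightarrow> 'k" where
  "coeff x y f = (if rect x y then weight f else 0)"

lemma weight_superset:
  assumes "finite A" "{p. f p \<noteq> 0} \<subseteq> A"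
  shows "weight f = (\<Sum>p\<in>A. f p * psign p)"
  unfolding weight_def by (rule sum.mono_neutral_left) (use assms in auto)

lemma weight_zero: "weight (\<lambda>p. 0) = 0"
  by (simp add: weight_def)

lemma weight_basis: "weight (pbasis p) = psign p"
  by (subst weight_superset[of "{p}"]) (auto simp: pbasis_def)

lemma weight_add:
  assumes "f \<in> homs x y" "g \<in> homs x y"
  shows "weight (\<lambda>p. f p + g p) = weight f + weight g"
proof -
  let ?A = "{p. f p \<noteq> 0} \<union> {p. g p \<noteq> 0}"
  have A: "finite ?A" using assms by (simp add: path_hom_def)
  hence "weight f = (\<Sum>p\<in>?A. f p * psign p)" "weight g = (\<Sum>p\<in>?A. g p * psign p)"
    "weight (\<lambda>p. f p + g p) = (\<Sum>p\<in>?A. (f p + g p) * psign p)"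
    by (intro weight_superset; auto)+
  thus ?thesis by (simp add: distrib_right sum.distrib)
qed

lemma weight_scale:
  assumes "f \<in> homs x y"
  shows "weight (\<lambda>p. c * f p) = c * weight f"
proof -
  let ?A = "{p. f p \<noteq> 0}"
  have "finite ?A" using assms by (simp add: path_hom_def)
  hence "weight (\<lambda>p. c * f p) = (\<Sum>p\<in>?A. (c * f p) * psign p)"
    by (intro weight_superset; auto)
  thus ?thesis by (simp add: weight_def sum_distrib_left mult.assoc)
qed

text \<open>All paths in the support of \<open>f\<close> have the same length, so concatenation is
  injective on pairs of support paths and only one cut contributes to each coefficient; the sum over
  concatenations then factors.\<close>

lemma weight_comp:
  fixes f g :: "'a list \<Rightarrow> 'k::field"
  assumes f: "f \<in> homs x y" and g: "g \<in> homs y z"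
  shows "weight (path_comp g f) = weight g * weight f"
proof -
  let ?A = "{p. f p \<noteq> 0}" and ?B = "{p. g p \<noteq> 0}"
  let ?j = "\<lambda>(q, r). q @ tl r"
  have fA: "q \<in> paths x y" if "f q \<noteq> 0" for q using that f by (auto simp: path_hom_def)
  have gB: "r \<in> paths y z" if "g r \<noteq> 0" for r using that g by (auto simp: path_hom_def)
  have fin: "finite ?A" "finite ?B" using f g by (auto simp: path_hom_def)
  have len: "length q = length q'" if "f q \<noteq> 0" "f q' \<noteq> 0" for q q'
    using path_length[OF fA[OF that(1)]] path_length[OF fA[OF that(2)]] by simp
  have ne: "q \<noteq> []" "r \<noteq> []" "last q = y" "hd r = y" if "f q \<noteq> 0" "g r \<noteq> 0" for q r
    using fA[OF that(1)] gB[OF that(2)] by (auto simp: qpaths_def)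
  have inj: "inj_on ?j (?A \<times> ?B)"
  proof (rule inj_onI, clarify)
    fix q r q' r'
    assume *: "f q \<noteq> 0" "g r \<noteq> 0" "f q' \<noteq> 0" "g r' \<noteq> 0" "q @ tl r = q' @ tl r'"
    hence "q = q' \<and> tl r = tl r'" using len[of q q'] by simp
    thus "q = q' \<and> r = r'" using ne[OF *(1,2)] ne[OF *(3,4)] by (metis list.expand)
  qed
  have val: "path_comp g f (q @ tl r) = g r * f q" if "f q \<noteq> 0" "g r \<noteq> 0" for q r
  proof (rule path_comp_append)
    fix k assume k: "k < length (q @ tl r)" "Suc k \<noteq> length q"
    hence "length (take (Suc k) (q @ tl r)) \<noteq> length q" by simp
    thus "f (take (Suc k) (q @ tl r)) = 0" using len[OF that(1)] by metis
  qed (use ne[OF that] in auto)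
  have "{p. path_comp g f p \<noteq> 0} \<subseteq> ?j ` (?A \<times> ?B)"
  proof
    fix p assume "p \<in> {p. path_comp g f p \<noteq> 0}"
    then obtain q r where "f q \<noteq> 0" "g r \<noteq> 0" "p = q @ tl r"
      using path_comp_nonzero[of g f p] by blast
    thus "p \<in> ?j ` (?A \<times> ?B)" by force
  qed
  hence "weight (path_comp g f) = (\<Sum>p\<in>?j ` (?A \<times> ?B). path_comp g f p * psign p)"
    using fin by (intro weight_superset) auto
  also have "\<dots> = (\<Sum>(q, r)\<in>?A \<times> ?B. path_comp g f (q @ tl r) * psign (q @ tl r))"
    by (subst sum.reindex[OF inj]) (simp add: case_prod_unfold)
  also have "\<dots> = (\<Sum>(q, r)\<in>?A \<times> ?B. (f q * psign q) * (g r * psign r))"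
  proof (rule sum.cong, simp, clarify)
    fix q r assume qr: "f q \<noteq> 0" "g r \<noteq> 0"
    show "path_comp g f (q @ tl r) * psign (q @ tl r) = (f q * psign q) * (g r * psign r)"
      using val[OF qr] psign_append[OF ne(1,2)[OF qr], where 'b = 'k] ne(3,4)[OF qr] by (simp add: mult_ac)
  qed
  also have "\<dots> = weight f * weight g"
    by (simp add: weight_def sum_product sum.cartesian_product)
  finally show ?thesis by (simp add: mult.commute)
qed

text \<open>Nonzero weights provide paths into and out of \<open>y\<close>, which place
  \<open>y\<close> inside the rectangle of \<open>x\<close> and \<open>z\<close>; the two smaller
  rectangles are then filled too.\<close>

lemma coeff_comp:
  assumes f: "f \<in> homs x y" and g: "g \<in> homs y z"
  shows "coeff x z (path_comp g f) = (if rect x z then coeff y z g * coeff x y f else 0)"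
proof (cases "rect x z \<and> weight f \<noteq> 0 \<and> weight g \<noteq> 0")
  case True
  hence "{p. f p \<noteq> 0} \<noteq> {}" "{p. g p \<noteq> 0} \<noteq> {}" unfolding weight_def by (metis sum.empty)+
  then obtain p q where "p \<in> paths x y" "q \<in> paths y z"
    using f g unfolding path_hom_def by blast
  hence "rect x y" "rect y z" using rect_inner[of x z] True path_coords by (meson order_refl)+
  thus ?thesis using True by (simp add: coeff_def weight_comp[OF f g])
next
  case False
  thus ?thesis by (auto simp: coeff_def weight_comp[OF f g])
qed

lemma mesh_relation_hom:
  assumes "w \<in> tdom \<Gamma>"
  shows "mesh_relation \<Gamma> w \<in> homs (tau \<Gamma> w) w"
proof -
  obtain x where x: "diag x w" using assms by (auto simp: tdom_iff diag_def)
  hence t: "tau \<Gamma> w = x" using tau_eq by (auto simp: diag_def)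
  have "{p. mesh_relation \<Gamma> w p \<noteq> 0} \<subseteq> (\<lambda>y. [x, y, w]) ` V"
    unfolding mesh_relation_diag[OF x] by (auto simp: arrow_iff)
  hence "finite {p. mesh_relation \<Gamma> w p \<noteq> 0}"
    using finite_verts finite_subset by blast
  moreover have "{p. mesh_relation \<Gamma> w p \<noteq> 0} \<subseteq> paths x w"
    unfolding mesh_relation_diag[OF x] by (auto simp: qpaths_def arrow_iff)
  ultimately show ?thesis by (simp add: path_hom_def t)
qed

lemma mesh_relation_coeff:
  assumes "w \<in> tdom \<Gamma>"
  shows "coeff (tau \<Gamma> w) w (mesh_relation \<Gamma> w :: _ \<Rightarrow> 'k::field) = 0"
proof -
  obtain x where x: "diag x w" using assms by (auto simp: tdom_iff diag_def)
  hence t: "tau \<Gamma> w = x" using tau_eq by (auto simp: diag_def)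
  show ?thesis
  proof (cases "rect x w")
    case True
    then obtain u u' where u: "u \<in> V" "cx u = cx x" "cy u = cy w" "u' \<in> V" "cx u' = cx w" "cy u' = cy x"
      by (auto simp: rect_def occ_def)
    hence a: "arr x u" "arr x u'" "u \<noteq> u'"
      using x by (auto simp: diag_def arrow_iff)
    have b: "pbasis [x, u, w] \<in> homs x w" "pbasis [x, u', w] \<in> homs x w"
      using a arrow_diag[OF x] by (intro pbasis_hom; auto simp: qpaths_def arrow_iff)+
    thus ?thesis
      using psign_square_neg[OF x a, where 'k = 'k]
      by (simp only: t coeff_def True if_True mesh_relation_two[OF x a] weight_add[OF b] weight_basis) simp
  qed (simp add: t coeff_def)
qed

text \<open>The invariant vanishes on the generators and is linear and multiplicative. Membership in
  \<open>homs\<close> is carried through the induction because these rules need it.\<close>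

lemma mesh_ideal_coeff:
  "ideal x y f \<Longrightarrow> f \<in> homs x y \<and> coeff x y f = 0"
proof (induction rule: mesh_ideal.induct)
  case (mesh x)
  thus ?case using mesh_relation_hom mesh_relation_coeff by blast
next
  case (zero x y)
  thus ?case by (simp add: path_hom_zero coeff_def weight_zero)
next
  case (add x y f g)
  thus ?case using path_hom_add weight_add unfolding coeff_def by fastforce
next
  case (scale x y f c)
  thus ?case using path_hom_scale weight_scale unfolding coeff_def by fastforce
next
  case (post x y f g z)
  thus ?case using path_hom_comp coeff_comp by fastforce
next
  case (pre y z f g x)
  thus ?case using path_hom_comp coeff_comp by fastforce
qed

lemma path_hom_eq_sum:
  assumes "f \<in> homs x y"
  shows "f = (\<lambda>r. \<Sum>p | f p \<noteq> 0. f p * pbasis p r)"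
proof
  fix r
  have "finite {p. f p \<noteq> 0}" using assms by (simp add: path_hom_def)
  moreover have "(\<Sum>p | f p \<noteq> 0. f p * pbasis p r) = (\<Sum>p | f p \<noteq> 0. if p = r then f r else 0)"
    by (rule sum.cong) (auto simp: pbasis_def)
  ultimately show "f r = (\<Sum>p | f p \<noteq> 0. f p * pbasis p r)" by simp
qed

lemma mesh_ideal_iff_coeff:
  assumes f: "f \<in> homs x y"
  shows "ideal x y f \<longleftrightarrow> coeff x y f = (0 :: 'k::field)"
proof
  assume c: "coeff x y f = 0"
  have fin: "finite {p. f p \<noteq> 0}" and path: "p \<in> paths x y" if "f p \<noteq> 0" for p
    using f that by (auto simp: path_hom_def)
  have fin: "finite {p. f p \<noteq> 0}" using f by (auto simp: path_hom_def)
  show "ideal x y f"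
  proof (cases "rect x y")
    case False
    have "ideal x y (\<lambda>r. \<Sum>p | f p \<noteq> 0. f p * pbasis p r)"
      by (rule mesh_ideal_sum[OF fin]) (use path non_rect_path_zero False in blast)
    thus ?thesis using path_hom_eq_sum[OF f] by simp
  next
    case True
    then obtain q where q: "q \<in> paths x y" using path_exists by blast
    \<comment> \<open>The path \<open>q\<close> is a fixed reference. Its total coefficient in this
      combination is a multiple of \<open>weight f\<close>, which is zero here, so the combination
      of homotopies equals \<open>f\<close>.\<close>
    have "ideal x y (\<lambda>r. \<Sum>p | f p \<noteq> 0. (f p * psign p) *
        (psign p * pbasis p r - psign q * (pbasis q r :: 'k)))"
      by (rule mesh_ideal_sum[OF fin])
        (use rect_paths_homotopic[OF path q True, unfolded homotopic_def] in simp)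
    moreover have "(\<Sum>p | f p \<noteq> 0. (f p * psign p) *
        (psign p * pbasis p r - psign q * pbasis q r)) = f r" for r
    proof -
      have "(\<Sum>p | f p \<noteq> 0. (f p * psign p) * (psign p * pbasis p r - psign q * pbasis q r))
        = (\<Sum>p | f p \<noteq> 0. f p * (psign p * psign p) * pbasis p r
            - (f p * psign p) * (psign q * pbasis q r))"
        by (simp only: right_diff_distrib mult_ac)
      also have "\<dots> = (\<Sum>p | f p \<noteq> 0. f p * pbasis p r) - weight f * (psign q * pbasis q r)"
        by (simp add: weight_def sum_subtractf sum_distrib_right)
      also have "\<dots> = f r"
        using c True path_hom_eq_sum[OF f, THEN fun_cong, of r] by (simp add: coeff_def)
      finally show ?thesis .
    qed
    ultimately show ?thesis by simp
  qed
qed (use mesh_ideal_coeff in blast)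

lemma coeff_add:
  "f \<in> homs x y \<Longrightarrow> g \<in> homs x y \<Longrightarrow>
     coeff x y (\<lambda>p. f p + g p) = coeff x y f + coeff x y g"
  by (simp add: coeff_def weight_add)

lemma coeff_scale: "f \<in> homs x y \<Longrightarrow> coeff x y (\<lambda>p. c * f p) = c * coeff x y f"
  by (simp add: coeff_def weight_scale)

lemma mesh_class_eq:
  assumes "f \<in> homs x y"
  shows "cls x y f = {g \<in> homs x y. coeff x y g = coeff x y f}"
proof -
  have "ideal x y (\<lambda>p. g p - f p) \<longleftrightarrow> coeff x y g = coeff x y f"
    if g: "g \<in> homs x y" for g
  proof -
    have "coeff x y (\<lambda>p. g p + (- 1) * f p) = coeff x y g + (- 1) * coeff x y f"
      using coeff_add[OF g path_hom_scale[OF assms]] coeff_scale[OF assms] by metis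
    hence "coeff x y (\<lambda>p. g p - f p) = coeff x y g - coeff x y f" by simp
    thus ?thesis using mesh_ideal_iff_coeff[OF path_hom_diff[OF g assms]] by simp
  qed
  thus ?thesis by (auto simp: mesh_class_def)
qed

section \<open>Morphism spaces of the mesh category as scalars\<close>

abbreviation "mesh_cat \<equiv> mesh_category \<Gamma>"

text \<open>A coset has no distinguished representative, so the common value of \<open>coeff\<close>
  on it is obtained by description.\<close>

definition class_coeff :: "'a \<Rightarrow> 'a \<Rightarrow> ('a list \<Rightarrow> 'k::field) set \<Rightarrow> 'k" where
  "class_coeff x y F = (THE c. \<forall>f\<in>F. coeff x y f = c)"

lemma class_coeff_class:
  assumes "f \<in> homs x y"
  shows "class_coeff x y (cls x y f) = coeff x y f"
  unfolding class_coeff_def mesh_class_eq[OF assms] by (rule the_equality) (use assms in auto)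

lemma mesh_class_cong:
  "f \<in> homs x y \<Longrightarrow> g \<in> homs x y \<Longrightarrow> coeff x y f = coeff x y g \<Longrightarrow>
     cls x y f = cls x y g"
  by (simp add: mesh_class_eq)

lemma mesh_class_self: "f \<in> homs x y \<Longrightarrow> f \<in> cls x y f"
  by (simp add: mesh_class_eq)

lemma hom_mesh_cat: "hom mesh_cat x y = cls x y ` homs x y"
  by (simp add: mesh_category_def)

lemma cmp_mesh_class:
  assumes f: "f \<in> homs x y" and g: "g \<in> homs y z"
  shows "cmp mesh_cat x y z (cls y z g) (cls x y f) = cls x z (path_comp g f)"
proof -
  have "cls x z (path_comp g' f') = cls x z (path_comp g f)"
    if "g' \<in> cls y z g" "f' \<in> cls x y f" for g' f'
    using that f g by (intro mesh_class_cong) (auto simp: mesh_class_eq coeff_comp intro!: path_hom_comp)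
  thus ?thesis
    unfolding mesh_category_def linear_category_data.simps category_data.simps
    by (intro UN_UN_const[OF mesh_class_self[OF g] mesh_class_self[OF f]]) blast
qed

lemma hadd_mesh_class:
  assumes f: "f \<in> homs x y" and g: "g \<in> homs x y"
  shows "hadd mesh_cat x y (cls x y f) (cls x y g) = cls x y (\<lambda>p. f p + g p)"
proof -
  have "cls x y (\<lambda>p. f' p + g' p) = cls x y (\<lambda>p. f p + g p)"
    if "g' \<in> cls x y g" "f' \<in> cls x y f" for g' f'
    using that f g by (intro mesh_class_cong) (auto simp: mesh_class_eq coeff_add intro!: path_hom_add)
  thus ?thesis
    unfolding mesh_category_def linear_category_data.simps category_data.simps
    by (intro UN_UN_const[OF mesh_class_self[OF f] mesh_class_self[OF g]]) blast
qed

lemma hscale_mesh_class: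
  assumes f: "f \<in> homs x y"
  shows "hscale mesh_cat x y c (cls x y f) = cls x y (\<lambda>p. c * f p)"
proof -
  have "cls x y (\<lambda>p. c * f' p) = cls x y (\<lambda>p. c * f p)"
    if "f' \<in> cls x y f" for f'
    using that f by (intro mesh_class_cong) (auto simp: mesh_class_eq coeff_scale intro!: path_hom_scale)
  hence "(\<Union>f'\<in>cls x y f. cls x y (\<lambda>p. c * f' p)) = cls x y (\<lambda>p. c * f p)"
    using mesh_class_self[OF f] by blast
  thus ?thesis by (simp add: mesh_category_def)
qed

lemma class_coeff_bij:
  assumes "x \<in> V" "y \<in> V"
  shows "bij_betw (class_coeff x y) (hom mesh_cat x y) {c :: 'k::field. rect x y \<or> c = 0}"
  unfolding bij_betw_def
proof
  show "inj_on (class_coeff x y :: _ \<Rightarrow> 'k) (hom mesh_cat x y)"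
  proof (rule inj_onI)
    fix F G :: "('a list \<Rightarrow> 'k) set"
    assume "F \<in> hom mesh_cat x y" "G \<in> hom mesh_cat x y" and eq: "class_coeff x y F = class_coeff x y G"
    then obtain f g where f: "f \<in> homs x y" "F = cls x y f"
      and g: "g \<in> homs x y" "G = cls x y g"
      unfolding hom_mesh_cat by blast
    thus "F = G" using mesh_class_cong[OF f(1) g(1)] eq by (simp add: class_coeff_class)
  qed
  show "class_coeff x y ` hom mesh_cat x y = {c :: 'k. rect x y \<or> c = 0}"
  proof
    show "class_coeff x y ` hom mesh_cat x y \<subseteq> {c :: 'k. rect x y \<or> c = 0}"
      unfolding hom_mesh_cat by (auto simp: class_coeff_class) (auto simp: coeff_def split: if_splits)
    show "{c :: 'k. rect x y \<or> c = 0} \<subseteq> class_coeff x y ` hom mesh_cat x y"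
    proof
      fix c :: 'k assume "c \<in> {c. rect x y \<or> c = 0}"
      moreover have "\<exists>f\<in>homs x y. coeff x y f = c" if r: "rect x y"
      proof -
        obtain p where p: "p \<in> paths x y" using path_exists r by blast
        have "coeff x y (\<lambda>q. (c * psign p) * pbasis p q) = c * psign p * psign p"
          using coeff_scale[OF pbasis_hom[OF p]] r by (simp add: coeff_def weight_basis)
        thus ?thesis using path_hom_scale[OF pbasis_hom[OF p]] by (metis mult.assoc mult.right_neutral psign_square)
      qed
      moreover have "coeff x y (\<lambda>p. 0 :: 'k) = 0" by (simp add: coeff_def weight_zero)
      ultimately obtain f where f: "f \<in> homs x y" "coeff x y f = c"
        using path_hom_zero[of \<Gamma> x y] by blast
      hence "c = class_coeff x y (cls x y f)" by (simp add: class_coeff_class)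
      thus "c \<in> class_coeff x y ` hom mesh_cat x y"
        unfolding hom_mesh_cat using f(1) by blast
    qed
  qed
qed

lemma idm_mesh_cat:
  assumes "x \<in> V"
  shows "idm mesh_cat x \<in> hom mesh_cat x x" "class_coeff x x (idm mesh_cat x) = 1"
proof -
  have id: "idm mesh_cat x = cls x x (pbasis [x])"
    by (simp add: mesh_category_def pbasis_def)
  have b: "pbasis [x] \<in> homs x x" by (rule pbasis_hom[OF path_single[OF assms]])
  show "idm mesh_cat x \<in> hom mesh_cat x x" unfolding hom_mesh_cat id using b by (rule imageI)
  show "class_coeff x x (idm mesh_cat x) = 1"
    unfolding id class_coeff_class[OF b] coeff_def weight_basis using rect_refl[OF assms] by simp
qed

lemma cmp_mesh_cat:
  assumes "F \<in> hom mesh_cat x y" "G \<in> hom mesh_cat y z"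
  shows "cmp mesh_cat x y z G F \<in> hom mesh_cat x z"
    and "class_coeff x z (cmp mesh_cat x y z G F) = (if rect x z then class_coeff y z G * class_coeff x y F else 0)"
  using assms by (auto simp: hom_mesh_cat cmp_mesh_class class_coeff_class coeff_comp path_hom_comp)

lemma hadd_mesh_cat:
  assumes "F \<in> hom mesh_cat x y" "G \<in> hom mesh_cat x y"
  shows "class_coeff x y (hadd mesh_cat x y F G) = class_coeff x y F + class_coeff x y G"
  using assms by (auto simp: hom_mesh_cat hadd_mesh_class class_coeff_class coeff_add path_hom_add)

lemma hscale_mesh_cat:
  assumes "F \<in> hom mesh_cat x y"
  shows "class_coeff x y (hscale mesh_cat x y c F) = c * class_coeff x y F"
  using assms by (auto simp: hom_mesh_cat hscale_mesh_class class_coeff_class coeff_scale path_hom_scale)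

end

section \<open>The boundary of the polygon\<close>

text \<open>Twice the signed area of the triangle, positive when \<open>a\<close>, \<open>b\<close>,
  \<open>c\<close> run counterclockwise.\<close>

definition orient :: "real \<times> real \<Rightarrow> real \<times> real \<Rightarrow> real \<times> real \<Rightarrow> real" where
  "orient a b c = (fst b - fst a) * (snd c - snd a) - (snd b - snd a) * (fst c - fst a)"

lemma right_of_iff_orient: "right_of a b c \<longleftrightarrow> orient b a c > 0"
  by (simp add: right_of_def orient_def algebra_simps)

lemma vertical_slice_in_hull:
  fixes p q :: "real \<times> real"
  assumes "fst p < x" "x < fst q"
  shows "(x, snd p + (snd q - snd p) * (x - fst p) / (fst q - fst p)) \<in> convex hull {p, q}"
proof -
  define u where "u = (x - fst p) / (fst q - fst p)"
  have u: "0 \<le> u" "u \<le> 1" and ux: "u * (fst q - fst p) = x - fst p"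
    using assms by (auto simp: u_def field_simps)
  have "(1 - u) *\<^sub>R p + u *\<^sub>R q = (x, snd p + (snd q - snd p) * u)"
    using ux by (auto simp: prod_eq_iff algebra_simps)
  moreover have "(1 - u) *\<^sub>R p + u *\<^sub>R q \<in> convex hull {p, q}"
    unfolding convex_hull_2_alt using u by (auto simp: algebra_simps intro!: exI[of _ u])
  ultimately show ?thesis by (simp add: u_def)
qed

text \<open>The vertical line through \<open>r\<close> meets both chords in points of the hull, at
  heights \<open>snd a\<close> and \<open>y\<close>. The sign of \<open>orient p r q\<close> is that
  of \<open>y - snd r\<close>, so the hypothesis places \<open>r\<close> between these two
  points.\<close>

lemma between_chords_in_hull:
  fixes a b p q r :: "real \<times> real"
  assumes x: "fst a < fst r" "fst r < fst b" "fst p < fst r" "fst r < fst q" and ab: "snd a = snd b"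
    and r: "snd r \<ge> snd a \<and> orient p r q \<ge> 0 \<or> snd r \<le> snd a \<and> orient p r q \<le> 0"
    and S: "{a, b, p, q} \<subseteq> S"
  shows "r \<in> convex hull S"
proof -
  define y where "y = snd p + (snd q - snd p) * (fst r - fst p) / (fst q - fst p)"
  have d: "fst q - fst p > 0" using x by simp
  have y: "(y - snd r) * (fst q - fst p) = orient p r q"
    using d by (simp add: y_def orient_def divide_simps) (simp add: algebra_simps)
  have A: "(fst r, snd a) \<in> convex hull S"
    using vertical_slice_in_hull[of a "fst r" b] x ab S hull_mono[of "{a, b}" S convex] by auto
  have B: "(fst r, y) \<in> convex hull S"
    using vertical_slice_in_hull[of p "fst r" q] x S hull_mono[of "{p, q}" S convex]
    by (auto simp: y_def)
  have "snd r \<in> closed_segment (snd a) y"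
    using r
  proof
    assume h: "snd r \<ge> snd a \<and> orient p r q \<ge> 0"
    hence "y \<ge> snd r" using y d by (metis diff_ge_0_iff_ge zero_le_mult_iff not_le)
    with h show ?thesis by (simp add: closed_segment_eq_real_ivl)
  next
    assume h: "snd r \<le> snd a \<and> orient p r q \<le> 0"
    hence "y \<le> snd r" using y d by (metis diff_le_0_iff_le mult_le_0_iff not_le)
    with h show ?thesis by (auto simp: closed_segment_eq_real_ivl)
  qed
  then obtain u where u: "0 \<le> u" "u \<le> 1" "snd r = (1 - u) * snd a + u * y"
    by (auto simp: in_segment)
  have "(1 - u) *\<^sub>R (fst r, snd a) + u *\<^sub>R (fst r, y) \<in> convex hull S"
    by (rule convexD[OF convex_convex_hull A B]) (use u in auto)
  moreover have "(1 - u) *\<^sub>R (fst r, snd a) + u *\<^sub>R (fst r, y) = r"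
    using u(3) by (simp add: prod_eq_iff) (simp add: algebra_simps)
  ultimately show ?thesis by simp
qed

section \<open>The cyclic boundary order and its linear ranks\<close>

lemma dynkin_A_arrow:
  assumes "dynkin_A m Q" "1 \<le> i" "i < m"
  shows "((i, Suc i) \<in> qarrows Q) \<noteq> ((Suc i, i) \<in> qarrows Q)"
proof -
  have "card (qarrows Q \<inter> {(i, i + 1), (i + 1, i)}) = 1" using assms by (auto simp: dynkin_A_def)
  then obtain z where z: "qarrows Q \<inter> {(i, i + 1), (i + 1, i)} = {z}" by (auto simp: card_1_singleton_iff)
  hence "y \<in> qarrows Q \<longleftrightarrow> y = z" if "y \<in> {(i, i + 1), (i + 1, i)}" for y using that by blast
  moreover have "z = (i, i + 1) \<or> z = (i + 1, i)" using z by blast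
  ultimately show ?thesis by fastforce
qed

text \<open>Counterclockwise, the boundary of the polygon runs through the upper vertices from right to left,
  then \<open>0\<close>, then the lower vertices from left to right, then \<open>n + 2\<close>; \<open>pos\<close> is increasing in this order.\<close>

definition pos :: "nat set \<Rightarrow> nat \<Rightarrow> int" where
  "pos U i = (if i \<in> U then - int i else int i)"

definition cyc :: "int \<Rightarrow> int \<Rightarrow> int \<Rightarrow> bool" where
  "cyc x y z \<longleftrightarrow> x < y \<and> y < z \<or> y < z \<and> z < x \<or> z < x \<and> x < y"

text \<open>Positions have gaps; ranks make neighbours on the boundary differ by exactly one, as
  grid coordinates must.\<close>

definition rank :: "('a \<Rightarrow> int) \<Rightarrow> 'a set \<Rightarrow> 'a \<Rightarrow> int" where
  "rank p A a = int (card {a' \<in> A. p a' < p a})"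

lemma rank_less_iff:
  assumes "finite A" "a \<in> A" "b \<in> A"
  shows "rank p A a < rank p A b \<longleftrightarrow> p a < p b"
proof
  assume "p a < p b"
  hence "{a' \<in> A. p a' < p a} \<subset> {a' \<in> A. p a' < p b}" using assms(2) by force
  thus "rank p A a < rank p A b" unfolding rank_def using assms(1) by (simp add: psubset_card_mono)
next
  assume *: "rank p A a < rank p A b"
  show "p a < p b"
  proof (rule ccontr)
    assume "\<not> p a < p b"
    hence "{a' \<in> A. p a' < p b} \<subseteq> {a' \<in> A. p a' < p a}" by force
    hence "rank p A b \<le> rank p A a" unfolding rank_def using assms(1) by (simp add: card_mono)
    with * show False by simp
  qed
qed

lemma rank_le_iff:
  assumes "finite A" "a \<in> A" "b \<in> A"
  shows "rank p A a \<le> rank p A b \<longleftrightarrow> p a \<le> p b"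
  using rank_less_iff[OF assms(1,3,2), of p] by linarith

lemma rank_eq_iff:
  assumes "finite A" "inj_on p A" "a \<in> A" "b \<in> A"
  shows "rank p A a = rank p A b \<longleftrightarrow> a = b"
  using rank_le_iff[OF assms(1,3,4), of p] rank_le_iff[OF assms(1,4,3), of p] assms(2-4)
  by (metis inj_onD order_antisym order_refl)

lemma rank_image:
  assumes "finite A" "inj_on p A"
  shows "rank p A ` A = {0..<int (card A)}"
proof (rule card_subset_eq)
  have "{a' \<in> A. p a' < p a} \<subset> A" if "a \<in> A" for a using that by auto
  thus "rank p A ` A \<subseteq> {0..<int (card A)}"
    unfolding rank_def using psubset_card_mono[OF assms(1)] by fastforce
  have "inj_on (rank p A) A" using rank_eq_iff[OF assms] by (auto simp: inj_on_def)
  thus "card (rank p A ` A) = card {0..<int (card A)}" by (simp add: card_image)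
qed simp

lemma rank_between:
  assumes "finite A" "inj_on p A" "a \<in> A" "b \<in> A" "rank p A a \<le> t" "t \<le> rank p A b"
  obtains c where "c \<in> A" "rank p A c = t" "p a \<le> p c" "p c \<le> p b"
proof -
  have "rank p A a \<in> {0..<int (card A)}" "rank p A b \<in> {0..<int (card A)}"
    using rank_image[OF assms(1,2)] assms(3,4) by blast+
  hence "t \<in> rank p A ` A" unfolding rank_image[OF assms(1,2)] using assms(5,6) by auto
  then obtain c where "c \<in> A" "rank p A c = t" by auto
  with that assms show thesis using rank_le_iff by metis
qed

lemma rank_Suc_iff:
  assumes "finite A" "inj_on p A" "a \<in> A" "b \<in> A"
  shows "rank p A b = rank p A a + 1 \<longleftrightarrow> p a < p b \<and> (\<forall>q\<in>A. \<not> (p a < p q \<and> p q < p b))"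
proof
  assume s: "rank p A b = rank p A a + 1"
  have "\<not> (p a < p q \<and> p q < p b)" if "q \<in> A" for q
    using rank_less_iff[OF assms(1) that assms(4), of p] rank_less_iff[OF assms(1,3) that, of p] s by linarith
  thus "p a < p b \<and> (\<forall>q\<in>A. \<not> (p a < p q \<and> p q < p b))"
    using rank_less_iff[OF assms(1,3,4), of p] s by auto
next
  assume r: "p a < p b \<and> (\<forall>q\<in>A. \<not> (p a < p q \<and> p q < p b))"
  hence l: "rank p A a < rank p A b" using rank_less_iff[OF assms(1,3,4)] by blast
  show "rank p A b = rank p A a + 1"
  proof (rule ccontr)
    assume "rank p A b \<noteq> rank p A a + 1"
    with l obtain c where c: "c \<in> A" "rank p A c = rank p A a + 1"
      using rank_between[OF assms, of "rank p A a + 1"] by (metis add_le_cancel_left linorder_le_less_linear order_less_le zless_imp_add1_zle le_add_same_cancel1 zero_le_one)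
    hence "p a < p c" "p c < p b"
      using rank_less_iff[OF assms(1,3) c(1), of p] rank_less_iff[OF assms(1) c(1) assms(4), of p] l
        \<open>rank p A b \<noteq> rank p A a + 1\<close> by linarith+
    with r c(1) show False by blast
  qed
qed

locale polygon =
  fixes n :: nat and Q :: "nat quiver" and P :: "nat \<Rightarrow> real \<times> real"
  assumes dynkin: "dynkin_A (n + 2) Q" and polygon: "is_polygon n Q P"
begin

abbreviation "up \<equiv> upper_barred n Q"
abbreviation "pL \<equiv> pos up"
abbreviation "segs \<equiv> line_segments n"

lemma up_range: "i \<in> up \<Longrightarrow> 0 < i \<and> i < n + 2"
  by (auto simp: upper_barred_def)

lemma up_iff: "0 < i \<Longrightarrow> i < n + 2 \<Longrightarrow> i \<notin> up \<longleftrightarrow> i \<in> lower_barred n Q"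
  using dynkin_A_arrow[OF dynkin, of i] by (auto simp: upper_barred_def lower_barred_def)

lemma pos_inj: "i \<le> n + 2 \<Longrightarrow> j \<le> n + 2 \<Longrightarrow> pL i = pL j \<Longrightarrow> i = j"
  using up_range by (auto simp: pos_def split: if_splits)

text \<open>Otherwise \<open>P j\<close> would lie vertically between the chords from \<open>P 0\<close> to \<open>P (n + 2)\<close> and from
  \<open>P i\<close> to \<open>P k\<close>, hence in the convex hull of the other vertices.\<close>

lemma orient_middle:
  assumes "i < j" "j < k" "k \<le> n + 2"
  shows "if j \<in> up then orient (P i) (P j) (P k) < 0 else orient (P i) (P j) (P k) > 0"
proof -
  have lt: "\<And>i j. i < j \<Longrightarrow> j \<le> n + 2 \<Longrightarrow> fst (P i) < fst (P j)"
    and flat: "snd (P 0) = snd (P (n + 2))"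
    and out: "P j \<notin> convex hull (P ` ({..n + 2} - {j}))"
    and uplow: "j \<in> up \<Longrightarrow> snd (P j) > snd (P 0)" "j \<notin> up \<Longrightarrow> snd (P j) < snd (P 0)"
    using polygon assms up_iff[of j] unfolding is_polygon_def by auto
  have S: "{P 0, P (n + 2), P i, P k} \<subseteq> P ` ({..n + 2} - {j})" using assms by auto
  have "\<not> (snd (P j) \<ge> snd (P 0) \<and> orient (P i) (P j) (P k) \<ge> 0 \<or>
           snd (P j) \<le> snd (P 0) \<and> orient (P i) (P j) (P k) \<le> 0)"
    using between_chords_in_hull[OF _ _ _ _ flat _ S, of "P j"] out lt assms by auto
  thus ?thesis using uplow by auto
qed

text \<open>The side of the vertex with the middle label fixes the sign. Rotating or transposing the
  arguments of \<open>orient\<close> reduces all orders of the three labels to that case.\<close>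

lemma orient_increasing:
  assumes "a \<le> n + 2" "b \<le> n + 2" "c \<le> n + 2" "pL a < pL b" "pL b < pL c"
  shows "orient (P a) (P b) (P c) > 0"
proof -
  have "a \<noteq> b" "b \<noteq> c" "a \<noteq> c" using assms by auto
  moreover have "orient (P b) (P c) (P a) = orient (P a) (P b) (P c)"
    "orient (P c) (P a) (P b) = orient (P a) (P b) (P c)"
    "orient (P b) (P a) (P c) = - orient (P a) (P b) (P c)"
    "orient (P a) (P c) (P b) = - orient (P a) (P b) (P c)"
    "orient (P c) (P b) (P a) = - orient (P a) (P b) (P c)"
    by (simp_all add: orient_def algebra_simps)
  ultimately show ?thesis
    using orient_middle[of a b c] orient_middle[of c b a] orient_middle[of b a c]
      orient_middle[of c a b] orient_middle[of a c b] orient_middle[of b c a] assms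
    unfolding pos_def by (auto split: if_splits) (metis linorder_neqE_nat)+
qed

lemma orient_iff_cyc:
  assumes "a \<le> n + 2" "b \<le> n + 2" "c \<le> n + 2" "a \<noteq> b" "b \<noteq> c" "a \<noteq> c"
  shows "orient (P a) (P b) (P c) > 0 \<longleftrightarrow> cyc (pL a) (pL b) (pL c)"
proof -
  have "pL a \<noteq> pL b" "pL b \<noteq> pL c" "pL a \<noteq> pL c" using pos_inj assms by metis+
  moreover have "orient (P b) (P c) (P a) = orient (P a) (P b) (P c)" 
    "orient (P c) (P a) (P b) = orient (P a) (P b) (P c)" 
    "orient (P b) (P a) (P c) = - orient (P a) (P b) (P c)" 
    "orient (P a) (P c) (P b) = - orient (P a) (P b) (P c)" 
    "orient (P c) (P b) (P a) = - orient (P a) (P b) (P c)" 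
    by (simp_all add: orient_def algebra_simps)
  ultimately show ?thesis
    using orient_increasing[OF assms(1,2,3)] orient_increasing[OF assms(2,3,1)]
      orient_increasing[OF assms(3,1,2)] orient_increasing[OF assms(2,1,3)]
      orient_increasing[OF assms(1,3,2)] orient_increasing[OF assms(3,2,1)]
    unfolding cyc_def by (elim linorder_neqE) auto
qed

text \<open>Read backwards, an edge says that \<open>m\<close> follows \<open>l\<close> immediately
  in counterclockwise order.\<close>

lemma clockwise_edge_iff:
  "clockwise_edge n P m l \<longleftrightarrow> m \<le> n + 2 \<and> l \<le> n + 2 \<and> m \<noteq> l \<and>
     (\<forall>q\<le>n + 2. q \<noteq> l \<and> q \<noteq> m \<longrightarrow> cyc (pL l) (pL m) (pL q))"
  unfolding clockwise_edge_def right_of_iff_orient using orient_iff_cyc by metis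

lemma clockwise_edge_unique:
  assumes "clockwise_edge n P m l"
  shows "clockwise_edge n P m' l \<Longrightarrow> m' = m" and "clockwise_edge n P m l' \<Longrightarrow> l' = l"
  using assms unfolding clockwise_edge_iff cyc_def by (smt (verit))+

lemma ccw_ex:
  assumes "l \<le> n + 2"
  shows "\<exists>m. clockwise_edge n P m l"
proof -
  \<comment> \<open>\<open>n + 2\<close> has the largest position, so its successor is the smallest
    of all other vertices; any other vertex is followed by the next larger position.\<close>
  define S where "S = (if l = n + 2 then {..n + 1} else {q. q \<le> n + 2 \<and> pL q > pL l})"
  have top: "pL (n + 2) = int (n + 2)" using up_range by (auto simp: pos_def)
  have lt: "pL q < int (n + 2)" if "q < n + 2" for q using that by (auto simp: pos_def)
  have fin: "finite S" by (auto simp: S_def)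
  have ne: "S \<noteq> {}"
    using assms top lt[of l] by (auto simp: S_def intro!: exI[of _ "n + 2"])
  obtain m where m: "m \<in> S" "\<And>q. q \<in> S \<Longrightarrow> pL m \<le> pL q"
    using arg_min_if_finite[OF fin ne, of pL] by (metis not_le)
  have mn: "m \<le> n + 2" "m \<noteq> l" using m(1) by (auto simp: S_def split: if_splits)
  have "cyc (pL l) (pL m) (pL q)" if q: "q \<le> n + 2" "q \<noteq> l" "q \<noteq> m" for q
  proof (cases "l = n + 2")
    case True
    hence "q \<in> S" using q by (auto simp: S_def)
    hence "pL m < pL q" using m(2) pos_inj[of m q] q mn by fastforce
    thus ?thesis using lt[of q] q True top by (auto simp: cyc_def)
  next
    case False
    have "pL q \<noteq> pL m" "pL q \<noteq> pL l" using pos_inj mn q assms by metis+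
    moreover have "pL l < pL m" using m False by (auto simp: S_def)
    moreover have "pL l < pL q \<Longrightarrow> pL m \<le> pL q" using m(2)[of q] False q by (auto simp: S_def)
    ultimately show ?thesis by (auto simp: cyc_def)
  qed
  thus ?thesis unfolding clockwise_edge_iff using mn assms by blast
qed

text \<open>The counterclockwise successor is an injective self-map of a finite set, hence
  surjective.\<close>

lemma cw_ex:
  assumes "m \<le> n + 2"
  shows "\<exists>l. clockwise_edge n P m l"
proof -
  define f where "f l = (SOME m. clockwise_edge n P m l)" for l
  have f: "clockwise_edge n P (f l) l" if "l \<le> n + 2" for l
    unfolding f_def using ccw_ex[OF that] by (rule someI_ex)
  have "inj_on f {..n + 2}"
    using f clockwise_edge_unique(2) by (metis inj_onI atMost_iff)
  moreover have "f ` {..n + 2} \<subseteq> {..n + 2}" using f by (auto simp: clockwise_edge_iff)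
  ultimately have "f ` {..n + 2} = {..n + 2}" by (intro endo_inj_surj) auto
  thus ?thesis using f assms by (metis atMost_iff imageE)
qed

lemma ccw_neighbor_eq_iff: "l \<le> n + 2 \<Longrightarrow> ccw_neighbor n P l = m \<longleftrightarrow> clockwise_edge n P m l"
  unfolding ccw_neighbor_def using ccw_ex[of l] clockwise_edge_unique(1)
  by (metis the_equality)

lemma cw_neighbor_eq_iff: "m \<le> n + 2 \<Longrightarrow> cw_neighbor n P m = l \<longleftrightarrow> clockwise_edge n P m l"
  unfolding cw_neighbor_def using cw_ex[of m] clockwise_edge_unique(2)
  by (metis the_equality)

text \<open>While \<open>pos\<close> starts the counterclockwise boundary walk after \<open>n + 2\<close>, \<open>pR\<close> starts it after \<open>0\<close>.
  Left endpoints of segments are compared by the former, right endpoints by the latter.\<close>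

definition pR :: "nat \<Rightarrow> int" where
  "pR j = (if j = 0 then int (n + 2) else if j \<in> up then int (n + 2) - int j else int j - int (n + 2))"

definition rL :: "nat \<Rightarrow> int" where
  "rL = rank pL {..<n + 2}"

definition rR :: "nat \<Rightarrow> int" where
  "rR = rank pR {0<..n + 2}"

lemma pL_inj: "inj_on pL {..<n + 2}"
  using pos_inj by (auto simp: inj_on_def)

lemma pR_eq_iff: "a \<le> n + 2 \<Longrightarrow> b \<le> n + 2 \<Longrightarrow> pR a = pR b \<longleftrightarrow> a = b"
  using up_range[of a] up_range[of b] by (auto simp: pR_def split: if_splits)

lemma pR_inj: "inj_on pR {0<..n + 2}"
  using pR_eq_iff by (auto simp: inj_on_def)

text \<open>If \<open>p\<close> cuts the cyclic order open right after \<open>t\<close>, then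
  removing \<open>t\<close> leaves no wrap-around edge, and the remaining edges are the steps of
  rank one. The cut is made at \<open>t = n + 2\<close> for left endpoints and at
  \<open>t = 0\<close> for right ones.\<close>

lemma clockwise_edge_iff_rank:
  assumes top: "t \<le> n + 2" "\<And>q. q \<le> n + 2 \<Longrightarrow> q \<noteq> t \<Longrightarrow> p q < p t"
    and inj: "\<And>a b. a \<le> n + 2 \<Longrightarrow> b \<le> n + 2 \<Longrightarrow> p a = p b \<Longrightarrow> a = b"
    and A: "A = {..n + 2} - {t}"
    and cyc: "\<And>a b c. a \<le> n + 2 \<Longrightarrow> b \<le> n + 2 \<Longrightarrow> c \<le> n + 2 \<Longrightarrow>
      cyc (pL a) (pL b) (pL c) \<longleftrightarrow> cyc (p a) (p b) (p c)"
    and lm: "l \<in> A" "m \<in> A"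
  shows "clockwise_edge n P m l \<longleftrightarrow> rank p A m = rank p A l + 1"
proof -
  have le: "l \<le> n + 2" "m \<le> n + 2" and lt: "p l < p t" "p m < p t" using lm A top by auto
  have "inj_on p A" using inj A by (auto simp: inj_on_def)
  hence "rank p A m = rank p A l + 1 \<longleftrightarrow> p l < p m \<and> (\<forall>q\<in>A. \<not> (p l < p q \<and> p q < p m))"
    using rank_Suc_iff[OF _ _ lm] A by auto
  moreover have "clockwise_edge n P m l \<longleftrightarrow> p l < p m \<and> (\<forall>q\<in>A. \<not> (p l < p q \<and> p q < p m))"
  proof
    assume "clockwise_edge n P m l"
    hence e: "cyc (p l) (p m) (p q)" if "q \<le> n + 2" "q \<noteq> l" "q \<noteq> m" for q
      using that cyc[OF le] by (auto simp: clockwise_edge_iff)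
    have "p l < p m" using e[OF top(1)] lt lm A by (auto simp: cyc_def)
    moreover have "\<not> (p l < p q \<and> p q < p m)" if "q \<in> A" for q
      using e[of q] that A by (cases "q = l \<or> q = m") (auto simp: cyc_def)
    ultimately show "p l < p m \<and> (\<forall>q\<in>A. \<not> (p l < p q \<and> p q < p m))" by blast
  next
    assume r: "p l < p m \<and> (\<forall>q\<in>A. \<not> (p l < p q \<and> p q < p m))"
    have "cyc (p l) (p m) (p q)" if q: "q \<le> n + 2" "q \<noteq> l" "q \<noteq> m" for q
    proof (cases "q = t")
      case True
      thus ?thesis using r lt by (simp add: cyc_def)
    next
      case False
      hence "\<not> (p l < p q \<and> p q < p m)" using r q A by simp
      moreover have "p q \<noteq> p l" "p q \<noteq> p m" using inj[of q l] inj[of q m] q le by auto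
      ultimately show ?thesis using r unfolding cyc_def by linarith
    qed
    thus "clockwise_edge n P m l" using r le cyc[OF le] by (auto simp: clockwise_edge_iff)
  qed
  ultimately show ?thesis by blast
qed

lemma clockwise_edge_iff_rL:
  assumes "l < n + 2" "m < n + 2"
  shows "clockwise_edge n P m l \<longleftrightarrow> rL m = rL l + 1"
  unfolding rL_def
  by (rule clockwise_edge_iff_rank[where t = "n + 2"])
    (use assms pos_inj up_range in \<open>auto simp: pos_def\<close>)

lemma clockwise_edge_iff_rR:
  assumes "l \<le> n + 2" "m \<le> n + 2" "0 < l" "0 < m"
  shows "clockwise_edge n P m l \<longleftrightarrow> rR m = rR l + 1"
  unfolding rR_def
proof (rule clockwise_edge_iff_rank[where t = 0])
  fix a b c assume "a \<le> n + 2" "b \<le> n + 2" "c \<le> n + 2"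
  thus "cyc (pL a) (pL b) (pL c) \<longleftrightarrow> cyc (pR a) (pR b) (pR c)"
    using up_range[of a] up_range[of b] up_range[of c] unfolding cyc_def pos_def pR_def
    by (auto split: if_splits)
qed (use assms pR_eq_iff in \<open>auto simp: pR_def\<close>)

lemma rL_le_iff: "a < n + 2 \<Longrightarrow> b < n + 2 \<Longrightarrow> rL a \<le> rL b \<longleftrightarrow> pL a \<le> pL b"
  unfolding rL_def by (rule rank_le_iff) auto

lemma rR_le_iff: "a \<in> {0<..n + 2} \<Longrightarrow> b \<in> {0<..n + 2} \<Longrightarrow> rR a \<le> rR b \<longleftrightarrow> pR a \<le> pR b"
  unfolding rR_def by (rule rank_le_iff) auto

lemma rL_eq_iff: "a < n + 2 \<Longrightarrow> b < n + 2 \<Longrightarrow> rL a = rL b \<longleftrightarrow> a = b"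
  unfolding rL_def by (rule rank_eq_iff[OF _ pL_inj]) auto

lemma rR_eq_iff: "a \<in> {0<..n + 2} \<Longrightarrow> b \<in> {0<..n + 2} \<Longrightarrow> rR a = rR b \<longleftrightarrow> a = b"
  unfolding rR_def by (rule rank_eq_iff[OF _ pR_inj]) auto

lemma segment_iff: "(a, b) \<in> segs \<longleftrightarrow> a < b \<and> a < n + 2 \<and> b \<in> {0<..n + 2}"
  by (auto simp: line_segments_def)

lemma ccw_left_iff:
  assumes "a < n + 2" "c < n + 2"
  shows "c = ccw_neighbor n P a \<longleftrightarrow> rL c = rL a + 1"
  using ccw_neighbor_eq_iff[of a c] clockwise_edge_iff_rL[OF assms] assms by auto

lemma ccw_right_iff:
  assumes "b \<in> {0<..n + 2}" "d \<in> {0<..n + 2}"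
  shows "d = ccw_neighbor n P b \<longleftrightarrow> rR d = rR b + 1"
  using ccw_neighbor_eq_iff[of b d] clockwise_edge_iff_rR[of b d] assms by auto

lemma cw_left_iff:
  assumes "a < n + 2" "c < n + 2"
  shows "c = cw_neighbor n P a \<longleftrightarrow> rL a = rL c + 1"
  using cw_neighbor_eq_iff[of a c] clockwise_edge_iff_rL[OF assms(2,1)] assms by auto

lemma cw_right_iff:
  assumes "b \<in> {0<..n + 2}" "d \<in> {0<..n + 2}"
  shows "d = cw_neighbor n P b \<longleftrightarrow> rR b = rR d + 1"
  using cw_neighbor_eq_iff[of b d] clockwise_edge_iff_rR[of d b] assms by auto

lemma cw_neighbor_le: "a \<le> n + 2 \<Longrightarrow> cw_neighbor n P a \<le> n + 2"
  using cw_neighbor_eq_iff[of a "cw_neighbor n P a"] by (auto simp: clockwise_edge_iff)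

text \<open>The strict inequality demanded of a pivot keeps the moving endpoint away from the vertex
  missing in its rank order: a left endpoint cannot become \<open>n + 2\<close>, nor a right one
  \<open>0\<close>.\<close>

lemma segment_arrow_iff:
  "((a, b), (c, d)) \<in> qarrows (segment_quiver n P) \<longleftrightarrow>
     (a, b) \<in> segs \<and> (c, d) \<in> segs \<and>
     (rL c = rL a + 1 \<and> rR d = rR b \<or> rL c = rL a \<and> rR d = rR b + 1)"
proof (cases "(a, b) \<in> segs")
  case True
  hence ab: "a < n + 2" "b \<in> {0<..n + 2}" "a < b" by (auto simp: segment_iff)
  have "(c, d) \<in> pivots n P (a, b) \<longleftrightarrow>
      c = a \<and> d = ccw_neighbor n P b \<and> a < d \<or> d = b \<and> c = ccw_neighbor n P a \<and> c < b"
    by (auto simp: pivots_def)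
  also have "\<dots> \<longleftrightarrow> (c, d) \<in> segs \<and> (rL c = rL a + 1 \<and> rR d = rR b \<or> rL c = rL a \<and> rR d = rR b + 1)"
    (is "?l \<longleftrightarrow> ?r")
  proof
    assume ?l
    thus ?r
    proof
      assume h: "c = a \<and> d = ccw_neighbor n P b \<and> a < d"
      hence d: "d \<in> {0<..n + 2}"
        using ccw_neighbor_eq_iff[of b d] ab by (auto simp: clockwise_edge_iff)
      with h ab show ?r using ccw_right_iff[OF ab(2) d] by (auto simp: segment_iff)
    next
      assume h: "d = b \<and> c = ccw_neighbor n P a \<and> c < b"
      hence c: "c < n + 2" using ab by auto
      with h ab show ?r using ccw_left_iff[OF ab(1) c] by (auto simp: segment_iff)
    qed
  next
    assume r: ?r
    hence cd: "c < n + 2" "d \<in> {0<..n + 2}" "c < d" by (auto simp: segment_iff)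
    thus ?l
      using r rL_eq_iff[OF cd(1) ab(1)] rR_eq_iff[OF cd(2) ab(2)]
        ccw_left_iff[OF ab(1) cd(1)] ccw_right_iff[OF ab(2) cd(2)] by auto
  qed
  finally show ?thesis using True by (simp add: segment_quiver_def)
qed (simp add: segment_quiver_def)

text \<open>The order of the two clockwise neighbours again rules out \<open>n + 2\<close> on the
  left and \<open>0\<close> on the right, so both shifts are measured by ranks.\<close>

lemma segment_tau_iff:
  assumes "(c, d) \<in> segs"
  shows "(cw_neighbor n P c < cw_neighbor n P d \<and> cw_neighbor n P c = a \<and> cw_neighbor n P d = b) \<longleftrightarrow>
    (a, b) \<in> segs \<and> rL c = rL a + 1 \<and> rR d = rR b + 1"
proof -
  have cd: "c < n + 2" "d \<in> {0<..n + 2}" "c < d" using assms by (auto simp: segment_iff)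
  show ?thesis
  proof
    assume h: "cw_neighbor n P c < cw_neighbor n P d \<and> cw_neighbor n P c = a \<and> cw_neighbor n P d = b"
    moreover have "b \<le> n + 2" using h cd cw_neighbor_le[of d] by auto
    ultimately have ab: "a < n + 2" "b \<in> {0<..n + 2}" "a < b" by auto
    thus "(a, b) \<in> segs \<and> rL c = rL a + 1 \<and> rR d = rR b + 1"
      using cw_left_iff[OF cd(1) ab(1)] cw_right_iff[OF cd(2) ab(2)] h by (auto simp: segment_iff)
  next
    assume h: "(a, b) \<in> segs \<and> rL c = rL a + 1 \<and> rR d = rR b + 1"
    hence ab: "a < n + 2" "b \<in> {0<..n + 2}" "a < b" by (auto simp: segment_iff)
    thus "cw_neighbor n P c < cw_neighbor n P d \<and> cw_neighbor n P c = a \<and> cw_neighbor n P d = b"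
      using cw_left_iff[OF cd(1) ab(1)] cw_right_iff[OF cd(2) ab(2)] h by auto
  qed
qed

text \<open>An intermediate \<open>e\<close> on the upper side satisfies \<open>e \<le> a\<close>,
  and any other one \<open>e \<le> c\<close>; either way \<open>e < b\<close>.\<close>

lemma segment_row_convex:
  assumes "(a, b) \<in> segs" "(c, b) \<in> segs" "rL a \<le> t" "t \<le> rL c"
  shows "\<exists>e. (e, b) \<in> segs \<and> rL e = t"
proof -
  have ac: "a < n + 2" "c < n + 2" "a < b" "c < b" "b \<le> n + 2" using assms(1,2) by (auto simp: segment_iff)
  then obtain e where e: "e < n + 2" "rL e = t" "pL a \<le> pL e" "pL e \<le> pL c"
    using rank_between[OF _ pL_inj, of a c t] assms(3,4) unfolding rL_def by auto
  hence "e < b" using ac by (auto simp: pos_def split: if_splits)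
  thus ?thesis using e ac by (auto simp: segment_iff)
qed

text \<open>Dually, an intermediate \<open>e\<close> on the upper side is at least \<open>d\<close>,
  and any other one at least \<open>b\<close>, hence beyond \<open>a\<close>.\<close>

lemma segment_column_convex:
  assumes "(a, b) \<in> segs" "(a, d) \<in> segs" "rR b \<le> t" "t \<le> rR d"
  shows "\<exists>e. (a, e) \<in> segs \<and> rR e = t"
proof -
  have bd: "b \<in> {0<..n + 2}" "d \<in> {0<..n + 2}" "a < b" "a < d" using assms(1,2) by (auto simp: segment_iff)
  then obtain e where e: "e \<in> {0<..n + 2}" "rR e = t" "pR b \<le> pR e" "pR e \<le> pR d"
    using rank_between[OF _ pR_inj, of b d t] assms(3,4) unfolding rR_def by auto
  hence "a < e" using bd by (auto simp: pR_def split: if_splits)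
  thus ?thesis using e bd by (auto simp: segment_iff)
qed

sublocale grid: grid_quiver "segment_quiver n P" "\<lambda>s. rL (fst s)" "\<lambda>s. rR (snd s)"
proof
  let ?G = "segment_quiver n P"
  have V: "qverts ?G = segs" by (simp add: segment_quiver_def)
  fix u v
  show "u = v" if "u \<in> qverts ?G" "v \<in> qverts ?G" "rL (fst u) = rL (fst v)" "rR (snd u) = rR (snd v)"
    using that rL_eq_iff[of "fst u" "fst v"] rR_eq_iff[of "snd u" "snd v"]
    by (cases u; cases v) (auto simp: V segment_iff)
  show "(u, v) \<in> qarrows ?G \<longleftrightarrow> u \<in> qverts ?G \<and> v \<in> qverts ?G \<and>
      (rL (fst v) = rL (fst u) + 1 \<and> rR (snd v) = rR (snd u) \<or>
       rL (fst v) = rL (fst u) \<and> rR (snd v) = rR (snd u) + 1)"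
    unfolding V by (cases u; cases v) (simp add: segment_arrow_iff)
  show "v \<in> tdom ?G \<longleftrightarrow> v \<in> qverts ?G \<and>
      (\<exists>u\<in>qverts ?G. rL (fst v) = rL (fst u) + 1 \<and> rR (snd v) = rR (snd u) + 1)"
  proof -
    obtain c d where v: "v = (c, d)" by (cases v)
    have "cw_neighbor n P c < cw_neighbor n P d \<longleftrightarrow>
        (\<exists>a b. (a, b) \<in> segs \<and> rL c = rL a + 1 \<and> rR d = rR b + 1)"
      if "(c, d) \<in> segs"
      using segment_tau_iff[OF that] by blast
    moreover have "(\<exists>u\<in>segs. rL c = rL (fst u) + 1 \<and> rR d = rR (snd u) + 1) \<longleftrightarrow>
        (\<exists>a b. (a, b) \<in> segs \<and> rL c = rL a + 1 \<and> rR d = rR b + 1)"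
      by (simp add: Bex_def)
    moreover have "v \<in> tdom ?G \<longleftrightarrow> (c, d) \<in> segs \<and> cw_neighbor n P c < cw_neighbor n P d"
      by (simp add: v segment_quiver_def)
    ultimately show ?thesis unfolding V v fst_conv snd_conv by blast
  qed
  show "tau ?G v = u" if "u \<in> qverts ?G" "v \<in> qverts ?G" "rL (fst v) = rL (fst u) + 1" "rR (snd v) = rR (snd u) + 1"
    using that unfolding V using segment_tau_iff[of "fst v" "snd v" "fst u" "snd u"]
    by (cases u; cases v) (simp add: segment_quiver_def)
  have "segs \<subseteq> {..n + 2} \<times> {..n + 2}" by (auto simp: line_segments_def)
  thus "finite (qverts ?G)" unfolding V using finite_subset by blast
  fix t
  show "\<exists>w\<in>qverts ?G. rL (fst w) = t \<and> rR (snd w) = rR (snd v)"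
    if h: "u \<in> qverts ?G" "v \<in> qverts ?G" "rR (snd u) = rR (snd v)" "rL (fst u) \<le> t" "t \<le> rL (fst v)"
  proof -
    have "snd u = snd v" using h rR_eq_iff[of "snd u" "snd v"] by (cases u; cases v) (auto simp: V segment_iff)
    then obtain e where "(e, snd v) \<in> segs" "rL e = t"
      using h segment_row_convex[of "fst u" "snd v" "fst v" t] unfolding V by (metis prod.collapse)
    thus ?thesis unfolding V by (intro bexI[of _ "(e, snd v)"]) simp_all
  qed
  show "\<exists>w\<in>qverts ?G. rL (fst w) = rL (fst v) \<and> rR (snd w) = t"
    if h: "u \<in> qverts ?G" "v \<in> qverts ?G" "rL (fst u) = rL (fst v)" "rR (snd u) \<le> t" "t \<le> rR (snd v)"
  proof -
    have "fst u = fst v" using h rL_eq_iff[of "fst u" "fst v"] by (cases u; cases v) (auto simp: V segment_iff)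
    then obtain e where "(fst v, e) \<in> segs" "rR e = t"
      using h segment_column_convex[of "fst v" "snd u" "snd v" t] unfolding V by (metis prod.collapse)
    thus ?thesis unfolding V by (intro bexI[of _ "(fst v, e)"]) simp_all
  qed
qed

text \<open>The grid point given by the ranks of \<open>x\<close> and \<open>y\<close> is occupied
  exactly when \<open>x < y\<close>; applied to the two corners this yields the last two
  inequalities.\<close>

lemma rect_segment_iff:
  assumes "(a, b) \<in> segs" "(c, d) \<in> segs"
  shows "grid.rect (a, b) (c, d) \<longleftrightarrow> pL a \<le> pL c \<and> pR b \<le> pR d \<and> a < d \<and> c < b"
proof -
  have V: "qverts (segment_quiver n P) = segs" by (simp add: segment_quiver_def)
  have abcd: "a < n + 2" "b \<in> {0<..n + 2}" "c < n + 2" "d \<in> {0<..n + 2}"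
    using assms by (auto simp: segment_iff)
  have "grid.occ (rL x) (rR y) \<longleftrightarrow> x < y" if x: "x < n + 2" and y: "y \<in> {0<..n + 2}" for x y
  proof -
    have "grid.occ (rL x) (rR y) \<longleftrightarrow> (x, y) \<in> segs"
    proof
      assume "grid.occ (rL x) (rR y)"
      then obtain v where v: "v \<in> segs" "rL (fst v) = rL x" "rR (snd v) = rR y"
        by (auto simp: grid.occ_def V)
      obtain i j where "v = (i, j)" by (cases v)
      thus "(x, y) \<in> segs"
        using v rL_eq_iff[of i x] rR_eq_iff[of j y] x y by (auto simp: segment_iff)
    next
      assume "(x, y) \<in> segs"
      thus "grid.occ (rL x) (rR y)" unfolding grid.occ_def V by force
    qed
    thus ?thesis using x y by (auto simp: segment_iff)
  qed
  thus ?thesis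
    using abcd assms rL_le_iff[of a c] rR_le_iff[of b d] by (auto simp: grid.rect_def V)
qed

end

section \<open>Splittings compatible with flags\<close>

definition plus_space :: "'b::plus set \<Rightarrow> 'b set \<Rightarrow> 'b set" where
  "plus_space U W = {u + w | u w. u \<in> U \<and> w \<in> W}"

locale ambient_space = vector_space scale
  for scale :: "'k::field \<Rightarrow> 'v::ab_group_add \<Rightarrow> 'v"
begin

text \<open>Bounded growth of dimension is what ends the enlargement of a pair of subspaces.\<close>

lemma dim_strict_mono:
  assumes "subspace S" "S \<subseteq> T" "x \<in> T" "x \<notin> S" "T \<subseteq> span B" "finite B"
  shows "dim S < dim T" and "dim T \<le> card B"
proof -
  obtain C where C: "C \<subseteq> S" "independent C" "S \<subseteq> span C" "card C = dim S"
    using basis_exists by blast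
  have sp: "span C = S" using C(1,3) assms(1) span_minimal by blast
  have ind: "independent (insert x C)" using C(2) assms(4) sp independent_insertI by blast
  obtain D where D: "insert x C \<subseteq> D" "D \<subseteq> T" "independent D" "T \<subseteq> span D"
    using maximal_independent_subset_extend[of "insert x C" T] ind C(1) assms(2,3) by blast
  have fin: "finite D" "card D \<le> card B"
    using independent_span_bound[OF assms(6) D(3)] D(2) assms(5) by auto
  have dimT: "dim T = card D" using D basis_card_eq_dim by auto
  thus "dim T \<le> card B" using fin by simp
  have "x \<notin> C" using C(1) assms(4) by blast
  moreover have "finite C" using finite_subset[OF _ fin(1), of C] D(1) by simp
  ultimately have "card (insert x C) = Suc (dim S)" using C(4) by simp
  moreover have "card (insert x C) \<le> card D" using card_mono[OF fin(1) D(1)] .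
  ultimately show "dim S < dim T" using dimT by simp
qed

lemma plus_space_comm: "plus_space U W = plus_space W (U :: 'v set)"
  unfolding plus_space_def by (auto; metis add.commute)

lemma plus_space_left: "subspace W \<Longrightarrow> u \<in> U \<Longrightarrow> u \<in> plus_space U W"
  unfolding plus_space_def using subspace_0 by force

lemma plus_space_right: "subspace U \<Longrightarrow> w \<in> W \<Longrightarrow> w \<in> plus_space U W"
  unfolding plus_space_def using subspace_0 by force

lemma subspace_plus_space: "subspace U \<Longrightarrow> subspace W \<Longrightarrow> subspace (plus_space U W)"
  unfolding plus_space_def by (rule subspace_sums)

text \<open>The sum of \<open>U\<close> and \<open>W\<close> need not be everything, so that a pair
  can be enlarged vector by vector. Only the component in \<open>U\<close> is tested; for a subspace
  \<open>F\<close> the other one follows.\<close>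

definition splits :: "'v set set \<Rightarrow> 'v set \<Rightarrow> 'v set \<Rightarrow> bool" where
  "splits \<F> U W \<longleftrightarrow> subspace U \<and> subspace W \<and> U \<inter> W = {0} \<and>
     (\<forall>F\<in>\<F>. \<forall>u\<in>U. \<forall>w\<in>W. u + w \<in> F \<longrightarrow> u \<in> F)"

lemma splitsD:
  assumes "splits \<F> U W"
  shows "subspace U" "subspace W" "U \<inter> W = {0}" "F \<in> \<F> \<Longrightarrow> u \<in> U \<Longrightarrow> w \<in> W \<Longrightarrow> u + w \<in> F \<Longrightarrow> u \<in> F"
  using assms by (auto simp: splits_def)

lemma splits_comm:
  assumes "\<And>F. F \<in> \<F> \<Longrightarrow> subspace F" "splits \<F> U W"
  shows "splits \<F> W U"
proof -
  have "w \<in> F" if "F \<in> \<F>" "u \<in> U" "w \<in> W" "w + u \<in> F" for F u w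
  proof -
    have "u \<in> F" using splitsD(4)[OF assms(2) that(1-3)] that(4) by (simp add: add.commute)
    hence "(w + u) - u \<in> F" using subspace_diff assms(1) that by blast
    thus ?thesis by simp
  qed
  thus ?thesis using splitsD[OF assms(2)] by (auto simp: splits_def Int_commute)
qed

text \<open>In a member inside the old sum no vector can involve \<open>u\<close>, so the old
  compatibility applies; in a member containing \<open>u\<close> the multiple of \<open>u\<close>
  can be subtracted first.\<close>

lemma splits_insert:
  assumes sub: "\<And>F. F \<in> \<F> \<Longrightarrow> subspace F" and sp: "splits \<F> U W"
    and u: "u \<notin> plus_space U W" and G: "\<And>G. G \<in> \<F> \<Longrightarrow> G \<subseteq> plus_space U W \<or> u \<in> G"
  shows "splits \<F> (span (insert u U)) W"
proof -
  note UW = splitsD[OF sp]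
  have S: "subspace (plus_space U W)" by (rule subspace_plus_space[OF UW(1,2)])
  have dec: "\<exists>c y. y \<in> U \<and> x = y + scale c u" if "x \<in> span (insert u U)" for x
  proof -
    from that obtain c where "x - scale c u \<in> span U" by (auto simp: span_insert)
    hence "x - scale c u \<in> U" using span_eq_iff UW(1) by metis
    thus ?thesis by (metis diff_add_cancel)
  qed
  have c0: "c = 0" if "scale c u \<in> plus_space U W" for c
  proof (rule ccontr)
    assume "c \<noteq> 0"
    hence "scale (inverse c) (scale c u) = u" by simp
    thus False using u subspace_scale[OF S that, of "inverse c"] by simp
  qed
  have in_S: "y + w \<in> plus_space U W" if "y \<in> U" "w \<in> W" for y w using that by (auto simp: plus_space_def)
  have "x = 0" if "x \<in> span (insert u U)" "x \<in> W" for x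
  proof -
    obtain c y where y: "y \<in> U" "x = y + scale c u" using dec[OF \<open>x \<in> span (insert u U)\<close>] by blast
    have "scale c u = - y + x" using y by simp
    hence "scale c u \<in> plus_space U W" using in_S subspace_neg UW(1) y(1) that(2) by metis
    thus ?thesis using c0[of c] y UW(3) that(2) by auto
  qed
  moreover have "x \<in> F" if F: "F \<in> \<F>" and x: "x \<in> span (insert u U)" "w \<in> W" "x + w \<in> F" for F x w
  proof -
    obtain c y where y: "y \<in> U" "x = y + scale c u" using dec[OF \<open>x \<in> span (insert u U)\<close>] by blast
    consider "F \<subseteq> plus_space U W" | "u \<in> F" using G F by blast
    thus ?thesis
    proof cases
      case 1
      hence "(x + w) - (y + w) \<in> plus_space U W"
        using subspace_diff[OF S] in_S[OF y(1) x(2)] x(3) by blast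
      hence "c = 0" using c0 y by simp
      thus ?thesis using y UW(4)[OF F y(1) x(2)] x(3) by simp
    next
      case 2
      hence cu: "scale c u \<in> F" using subspace_scale sub F by blast
      hence "(x + w) - scale c u \<in> F" using subspace_diff sub F x(3) by blast
      hence "y + w \<in> F" using y by (simp add: algebra_simps)
      hence "y \<in> F" using UW(4)[OF F y(1) x(2)] by blast
      thus ?thesis using y cu subspace_add sub F by blast
    qed
  qed
  moreover have "0 \<in> span (insert u U)" "0 \<in> W" using span_zero subspace_0 UW(2) by auto
  ultimately show ?thesis using UW(2) unfolding splits_def by blast
qed

text \<open>A compatible pair that does not yet fill the top of the chain can be enlarged by a vector of
  the smallest member of the chain which it does not contain.\<close>

lemma splits_extend:
  assumes fin: "finite \<F>" and chain: "\<And>F G. F \<in> \<F> \<Longrightarrow> G \<in> \<F> \<Longrightarrow> F \<subseteq> G \<or> G \<subseteq> F"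
    and sub: "\<And>F. F \<in> \<F> \<Longrightarrow> subspace F"
    and V: "V \<in> \<F>" "V \<subseteq> span B" "finite B" and below: "\<And>F. F \<in> \<F> \<Longrightarrow> F \<subseteq> V"
    and P: "subspace P" "subspace R"
    and cover: "\<And>F v. F \<in> \<F> \<Longrightarrow> v \<in> F \<Longrightarrow> \<exists>u\<in>F \<inter> P. \<exists>w\<in>F \<inter> R. v = u + w"
    and sp: "splits \<F> U0 W0" and U0: "U0 \<subseteq> P" "U0 \<subseteq> V" and W0: "W0 \<subseteq> R" "W0 \<subseteq> V"
  shows "\<exists>U W. splits \<F> U W \<and> plus_space U W = V \<and> U0 \<subseteq> U \<and> U \<subseteq> P \<and> W0 \<subseteq> W \<and> W \<subseteq> R"
  using sp U0 W0
proof (induction "card B - dim (plus_space U0 W0)" arbitrary: U0 W0 rule: less_induct)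
  case less
  let ?S = "plus_space U0 W0"
  note UW = splitsD[OF less.prems(1)]
  have S: "subspace ?S" by (rule subspace_plus_space[OF UW(1,2)])
  have SV: "?S \<subseteq> V" using less.prems(3,5) subspace_add[OF sub[OF V(1)]] by (auto simp: plus_space_def)
  show ?case
  proof (cases "V \<subseteq> ?S")
    case True
    thus ?thesis using less.prems SV by blast
  next
    case False
    hence ne: "{F \<in> \<F>. \<not> F \<subseteq> ?S} \<noteq> {}" using V(1) by blast
    have "finite {F \<in> \<F>. \<not> F \<subseteq> ?S}" using fin by simp
    from finite_has_minimal[OF this ne] obtain F where F: "F \<in> \<F>" "\<not> F \<subseteq> ?S"
      and "\<forall>G\<in>{F \<in> \<F>. \<not> F \<subseteq> ?S}. G \<subseteq> F \<longrightarrow> F = G"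
      unfolding mem_Collect_eq by blast
    hence min: "F = G" if "G \<in> \<F>" "\<not> G \<subseteq> ?S" "G \<subseteq> F" for G
      using that by simp
    \<comment> \<open>By minimality of \<open>F\<close>, every member not yet inside the sum
      contains \<open>F\<close> and therefore the vector about to be added, as
      \<open>splits_insert\<close> requires.\<close>
    have G: "G \<subseteq> ?S \<or> F \<subseteq> G" if "G \<in> \<F>" for G
      using chain[OF that F(1)] min[OF that] by blast
    obtain v where v: "v \<in> F" "v \<notin> ?S" using F(2) by blast
    obtain u w where uw: "u \<in> F" "u \<in> P" "w \<in> F" "w \<in> R" "v = u + w" using cover[OF F(1) v(1)] by blast
    \<comment> \<open>At least one of the two components of \<open>v\<close> is new, and it lies in
      \<open>F\<close> and in the subspace \<open>P\<close> or \<open>R\<close> allowed for its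
      side, so it can be added there.\<close>
    have not_S: "u \<notin> ?S \<or> w \<notin> ?S" using v(2) uw(5) subspace_add[OF S] by blast
    have enlarge: "plus_space U W \<subseteq> V \<and> card B - dim (plus_space U W) < card B - dim ?S"
      if UW: "subspace U" "subspace W" "U0 \<subseteq> U" "W0 \<subseteq> W" "U \<subseteq> V" "W \<subseteq> V" and z: "z \<in> U \<union> W" "z \<notin> ?S" for U W z
    proof -
      have le: "plus_space U W \<subseteq> V"
        using UW(5,6) subspace_add[OF sub[OF V(1)]] by (auto simp: plus_space_def)
      have "?S \<subseteq> plus_space U W" using UW(3,4) unfolding plus_space_def by blast
      moreover have "z \<in> plus_space U W"
        using z(1) plus_space_left[OF UW(2)] plus_space_right[OF UW(1)] by auto
      ultimately have "dim ?S < dim (plus_space U W)" "dim (plus_space U W) \<le> card B"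
        using dim_strict_mono[OF S _ _ z(2) subset_trans[OF le V(2)] V(3)] by simp_all
      with le show ?thesis by linarith
    qed
    from not_S show ?thesis
    proof
      assume u: "u \<notin> ?S"
      let ?U = "span (insert u U0)"
      have spl: "splits \<F> ?U W0" by (rule splits_insert[OF sub less.prems(1) u]) (use G uw(1) in auto)
      have UV: "?U \<subseteq> V" by (rule span_minimal) (use less.prems(3) below[OF F(1)] uw(1) sub[OF V(1)] in auto)
      have UP: "?U \<subseteq> P" by (rule span_minimal) (use less.prems(2) uw(2) P in auto)
      have U0U: "U0 \<subseteq> ?U" "u \<in> ?U" using span_superset[of "insert u U0"] by auto
      have "card B - dim (plus_space ?U W0) < card B - dim ?S"
        using enlarge[OF splitsD(1,2)[OF spl] U0U(1) order_refl UV less.prems(5) _ u] U0U(2) by simp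
      from less.hyps[OF this spl UP UV less.prems(4,5)] show ?thesis using U0U(1) by blast
    next
      assume w: "w \<notin> ?S"
      let ?W = "span (insert w W0)"
      have spW: "splits \<F> ?W U0"
        by (rule splits_insert[OF sub splits_comm[OF sub less.prems(1)]])
          (use w G uw(3) plus_space_comm[of W0 U0] in auto)
      have spl: "splits \<F> U0 ?W" by (rule splits_comm[OF sub spW])
      have WV: "?W \<subseteq> V" by (rule span_minimal) (use less.prems(5) below[OF F(1)] uw(3) sub[OF V(1)] in auto)
      have WP: "?W \<subseteq> R" by (rule span_minimal) (use less.prems(4) uw(4) P in auto)
      have W0W: "W0 \<subseteq> ?W" "w \<in> ?W" using span_superset[of "insert w W0"] by auto
      have "card B - dim (plus_space U0 ?W) < card B - dim ?S"
        using enlarge[OF splitsD(1,2)[OF spl] order_refl W0W(1) less.prems(3) WV _ w] W0W(2) by simp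
      from less.hyps[OF this spl less.prems(2,3) WP WV] show ?thesis using W0W(1) by blast
    qed
  qed
qed

section \<open>Flags propagated along a chain of linear maps\<close>

abbreviation "lin \<equiv> linear_between scale"

lemma linD:
  assumes "lin A B f"
  shows "x \<in> A \<Longrightarrow> f x \<in> B" "x \<in> A \<Longrightarrow> y \<in> A \<Longrightarrow> f (x + y) = f x + f y"
    "x \<in> A \<Longrightarrow> f (scale c x) = scale c (f x)"
  using assms by (auto simp: linear_between_def)

lemma lin_zero: "lin A B f \<Longrightarrow> x \<in> A \<Longrightarrow> f 0 = 0"
  using linD(3)[of A B f x 0] by simp

lemma lin_diff:
  assumes "lin A B f" "subspace A" "x \<in> A" "y \<in> A"
  shows "f (x - y) = f x - f y"
proof -
  have "x - y \<in> A" using subspace_diff assms by blast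
  hence "f ((x - y) + y) = f (x - y) + f y" using linD(2)[OF assms(1)] assms(4) by blast
  thus ?thesis by simp
qed

lemma subspace_image:
  assumes "lin A B f" "subspace F" "F \<subseteq> A"
  shows "subspace (f ` F)"
proof (rule subspaceI)
  show "0 \<in> f ` F"
    using lin_zero[OF assms(1), of 0] subspace_0[OF assms(2)] assms(3) by force
next
  fix x y assume "x \<in> f ` F" "y \<in> f ` F"
  then obtain a b where "a \<in> F" "b \<in> F" "x = f a" "y = f b" by blast
  moreover from this have "x + y = f (a + b)" using linD(2)[OF assms(1), of a b] subsetD[OF assms(3)] by simp
  ultimately show "x + y \<in> f ` F" using subspace_add[OF assms(2)] by blast
next
  fix c x assume "x \<in> f ` F"
  then obtain a where "a \<in> F" "x = f a" by blast
  moreover from this have "scale c x = f (scale c a)" using linD(3)[OF assms(1)] assms(3) by auto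
  ultimately show "scale c x \<in> f ` F" using subspace_scale[OF assms(2)] by blast
qed

lemma subspace_preimage:
  assumes "lin A B f" "subspace A" "subspace F"
  shows "subspace {v \<in> A. f v \<in> F}"
proof (rule subspaceI)
  show "0 \<in> {v \<in> A. f v \<in> F}"
    using lin_zero[OF assms(1), of 0] subspace_0[OF assms(2)] subspace_0[OF assms(3)] by simp
qed (use linD[OF assms(1)] subspace_add[OF assms(2)] subspace_add[OF assms(3)]
      subspace_scale[OF assms(2)] subspace_scale[OF assms(3)] in auto)

text \<open>\<open>h k\<close> maps \<open>V k\<close> to \<open>V (Suc k)\<close> if \<open>d k\<close>, and \<open>V (Suc k)\<close> to \<open>V k\<close> otherwise.\<close>

definition linear_chain :: "(nat \<Rightarrow> 'v set) \<Rightarrow> (nat \<Rightarrow> bool) \<Rightarrow> (nat \<Rightarrow> 'v \<Rightarrow> 'v) \<Rightarrow> nat \<Rightarrow> bool" where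
  "linear_chain V d h m \<longleftrightarrow> (\<forall>k\<le>m. subspace (V k) \<and> (\<exists>B. finite B \<and> V k \<subseteq> span B)) \<and>
     (\<forall>k<m. if d k then lin (V k) (V (Suc k)) (h k)
            else lin (V (Suc k)) (V k) (h k))"

text \<open>The functorial filtration coming from the end \<open>0\<close> of the chain. Inserting
  \<open>{0}\<close> and the full space at each stage makes kernels and images appear as members one
  step later.\<close>

fun flag :: "(nat \<Rightarrow> 'v set) \<Rightarrow> (nat \<Rightarrow> bool) \<Rightarrow> (nat \<Rightarrow> 'v \<Rightarrow> 'v) \<Rightarrow> nat \<Rightarrow> 'v set set" where
  "flag V d h 0 = {{0}, V 0}"
| "flag V d h (Suc k) = {{0}, V (Suc k)} \<union>
     (if d k then (\<lambda>F. h k ` F) ` flag V d h k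
      else (\<lambda>F. {v \<in> V (Suc k). h k v \<in> F}) ` flag V d h k)"

definition is_flag :: "'v set \<Rightarrow> 'v set set \<Rightarrow> bool" where
  "is_flag V \<F> \<longleftrightarrow> finite \<F> \<and> (\<forall>F\<in>\<F>. subspace F \<and> F \<subseteq> V) \<and> {0} \<in> \<F> \<and> V \<in> \<F> \<and>
     (\<forall>F\<in>\<F>. \<forall>G\<in>\<F>. F \<subseteq> G \<or> G \<subseteq> F)"

lemma is_flagD:
  assumes "is_flag V \<F>"
  shows "finite \<F>" "F \<in> \<F> \<Longrightarrow> subspace F" "F \<in> \<F> \<Longrightarrow> F \<subseteq> V" "{0} \<in> \<F>" "V \<in> \<F>"
    "F \<in> \<F> \<Longrightarrow> G \<in> \<F> \<Longrightarrow> F \<subseteq> G \<or> G \<subseteq> F"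
  using assms by (auto simp: is_flag_def)

lemma is_flag_insert:
  assumes "finite \<F>" "\<And>F. F \<in> \<F> \<Longrightarrow> subspace F \<and> F \<subseteq> V" "subspace V"
    "\<And>F G. F \<in> \<F> \<Longrightarrow> G \<in> \<F> \<Longrightarrow> F \<subseteq> G \<or> G \<subseteq> F"
  shows "is_flag V ({{0}, V} \<union> \<F>)"
proof -
  have z: "{0} \<subseteq> F" if "subspace F" for F using subspace_0[OF that] by simp
  have "F \<subseteq> G \<or> G \<subseteq> F" if F: "F \<in> {{0}, V} \<union> \<F>" and G: "G \<in> {{0}, V} \<union> \<F>" for F G
  proof -
    have "subspace F" "subspace G" "F \<subseteq> V" "G \<subseteq> V"
      using F G assms(2,3) z[OF assms(3)] subspace_single_0 by auto
    thus ?thesis using F G assms(4) z[of F] z[of G] by blast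
  qed
  thus ?thesis unfolding is_flag_def
    using assms(1-3) z[OF assms(3)] subspace_single_0 by auto
qed

lemma is_flag_image:
  assumes fl: "is_flag V \<F>" and V': "subspace V'" and mono: "\<And>F G. F \<subseteq> G \<Longrightarrow> \<phi> F \<subseteq> \<phi> G"
    and sub: "\<And>F. subspace F \<Longrightarrow> F \<subseteq> V \<Longrightarrow> subspace (\<phi> F) \<and> \<phi> F \<subseteq> V'"
  shows "is_flag V' ({{0}, V'} \<union> \<phi> ` \<F>)"
proof (rule is_flag_insert[OF _ _ V'])
  show "finite (\<phi> ` \<F>)" using is_flagD(1)[OF fl] by simp
  show "subspace F \<and> F \<subseteq> V'" if "F \<in> \<phi> ` \<F>" for F
    using that sub is_flagD(2,3)[OF fl] by auto
  fix F G assume "F \<in> \<phi> ` \<F>" "G \<in> \<phi> ` \<F>"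
  then obtain F' G' where F': "F' \<in> \<F>" "F = \<phi> F'" and G': "G' \<in> \<F>" "G = \<phi> G'" by blast
  thus "F \<subseteq> G \<or> G \<subseteq> F" using is_flagD(6)[OF fl F'(1) G'(1)] mono by auto
qed

lemma flag_is_flag:
  assumes "linear_chain V d h m" "k \<le> m"
  shows "is_flag (V k) (flag V d h k)"
  using assms(2)
proof (induction k)
  case 0
  hence "subspace (V 0)" using assms(1) by (auto simp: linear_chain_def)
  thus ?case using is_flag_insert[of "{}" "V 0"] by simp
next
  case (Suc k)
  hence sub: "subspace (V (Suc k))" using assms(1) by (auto simp: linear_chain_def)
  have IH: "is_flag (V k) (flag V d h k)" using Suc by simp
  show ?case
  proof (cases "d k")
    case True
    have lin: "lin (V k) (V (Suc k)) (h k)"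
      using assms(1) Suc.prems True by (auto simp: linear_chain_def)
    have "is_flag (V (Suc k)) ({{0}, V (Suc k)} \<union> (\<lambda>F. h k ` F) ` flag V d h k)"
      by (rule is_flag_image[OF IH sub]) (use subspace_image[OF lin] linD(1)[OF lin] in auto)
    thus ?thesis using True by simp
  next
    case False
    have lin: "lin (V (Suc k)) (V k) (h k)"
      using assms(1) Suc.prems False by (auto simp: linear_chain_def)
    have "is_flag (V (Suc k)) ({{0}, V (Suc k)} \<union> (\<lambda>F. {v \<in> V (Suc k). h k v \<in> F}) ` flag V d h k)"
      by (rule is_flag_image[OF IH sub]) (use subspace_preimage[OF lin sub] in auto)
    thus ?thesis using False by simp
  qed
qed

lemma is_flag_extend:
  assumes fl: "is_flag V \<F>" and B: "V \<subseteq> span B" "finite B" and P: "subspace P" "subspace R"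
    and cover: "\<And>F v. F \<in> \<F> \<Longrightarrow> v \<in> F \<Longrightarrow> \<exists>u\<in>F \<inter> P. \<exists>w\<in>F \<inter> R. v = u + w"
    and sp: "splits \<F> U0 W0" and U0: "U0 \<subseteq> P" "U0 \<subseteq> V" and W0: "W0 \<subseteq> R" "W0 \<subseteq> V"
  shows "\<exists>U W. splits \<F> U W \<and> plus_space U W = V \<and> U0 \<subseteq> U \<and> U \<subseteq> P \<and> W0 \<subseteq> W \<and> W \<subseteq> R"
  by (rule splits_extend[OF is_flagD(1)[OF fl] is_flagD(6)[OF fl] is_flagD(2)[OF fl] is_flagD(5)[OF fl]
        B is_flagD(3)[OF fl] P cover sp U0 W0])

definition chain_split :: "(nat \<Rightarrow> 'v set) \<Rightarrow> (nat \<Rightarrow> bool) \<Rightarrow> (nat \<Rightarrow> 'v \<Rightarrow> 'v) \<Rightarrow> nat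
    \<Rightarrow> (nat \<Rightarrow> 'v set) \<Rightarrow> (nat \<Rightarrow> 'v set) \<Rightarrow> bool" where
  "chain_split V d h m U W \<longleftrightarrow>
     (\<forall>k\<le>m. subspace (U k) \<and> subspace (W k) \<and> U k \<inter> W k = {0} \<and> plus_space (U k) (W k) = V k) \<and>
     (\<forall>k<m. if d k then h k ` U k \<subseteq> U (Suc k) \<and> h k ` W k \<subseteq> W (Suc k)
            else h k ` U (Suc k) \<subseteq> U k \<and> h k ` W (Suc k) \<subseteq> W k)"

lemma chain_split_Suc:
  assumes "chain_split V d h k U W"
    and "subspace U'" "subspace W'" "U' \<inter> W' = {0}" "plus_space U' W' = V (Suc k)"
    and "if d k then h k ` U k \<subseteq> U' \<and> h k ` W k \<subseteq> W' else h k ` U' \<subseteq> U k \<and> h k ` W' \<subseteq> W k"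
  shows "chain_split V d h (Suc k) (U(Suc k := U')) (W(Suc k := W'))"
  using assms unfolding chain_split_def by (auto simp: less_Suc_eq le_Suc_eq)

lemma splits_zero:
  assumes "\<And>F. F \<in> \<F> \<Longrightarrow> subspace F"
  shows "splits \<F> {0} {0}"
  using assms subspace_0 subspace_single_0 by (auto simp: splits_def)

text \<open>Compatibility with the image flag means that the \<open>U\<close>-part of
  \<open>h v\<close> has a preimage in the same member \<open>F\<close> as \<open>v\<close>.
  Subtracting it splits \<open>v\<close> inside \<open>F\<close> into a vector over \<open>U\<close>
  and one over \<open>W\<close>, which is the covering condition for an extension from zero.\<close>

lemma split_transfer_forward:
  assumes fl: "is_flag V \<F>" and fin: "V \<subseteq> span B" "finite B" and sub: "subspace V"
    and lin: "lin V V' h"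
    and sp: "splits ((\<lambda>F. h ` F) ` \<F>) U W" and UW: "plus_space U W = V'"
  shows "\<exists>U' W'. splits \<F> U' W' \<and> plus_space U' W' = V \<and> h ` U' \<subseteq> U \<and> h ` W' \<subseteq> W"
proof -
  note S = splitsD[OF sp]
  let ?P = "{v \<in> V. h v \<in> U}" and ?R = "{v \<in> V. h v \<in> W}"
  have P: "subspace ?P" "subspace ?R" using subspace_preimage[OF lin sub] S(1,2) by auto
  have "\<exists>U' W'. splits \<F> U' W' \<and> plus_space U' W' = V \<and> {0} \<subseteq> U' \<and> U' \<subseteq> ?P \<and> {0} \<subseteq> W' \<and> W' \<subseteq> ?R"
  proof (rule is_flag_extend[OF fl fin P _ splits_zero])
    fix F v assume F: "F \<in> \<F>" and v: "v \<in> F"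
    have FV: "F \<subseteq> V" "subspace F" using is_flagD(2,3)[OF fl F] by auto
    have "h v \<in> plus_space U W" using UW linD(1)[OF lin] v FV by blast
    then obtain u w where uw: "u \<in> U" "w \<in> W" "h v = u + w" unfolding plus_space_def by blast
    have "u + w \<in> h ` F" using v uw(3) by (metis imageI)
    hence "u \<in> h ` F" by (rule S(4)[OF imageI[OF F] uw(1,2)])
    then obtain v1 where v1: "v1 \<in> F" "u = h v1" by blast
    have "h (v - v1) = w" using lin_diff[OF lin sub, of v v1] v v1 FV uw(3) by auto
    moreover have "v - v1 \<in> F" using subspace_diff[OF FV(2) v v1(1)] .
    ultimately show "\<exists>u\<in>F \<inter> ?P. \<exists>w\<in>F \<inter> ?R. v = u + w"
      using v1 uw(1,2) FV(1) by (intro bexI[of _ v1] bexI[of _ "v - v1"]) auto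
  qed (use is_flagD(2)[OF fl] subspace_0[OF P(1)] subspace_0[OF P(2)] subspace_0[OF sub] in auto)
  then obtain U' W' where "splits \<F> U' W'" "plus_space U' W' = V" "U' \<subseteq> ?P" "W' \<subseteq> ?R"
    by (elim exE conjE) (rule that)
  thus ?thesis by (intro exI[of _ U'] exI[of _ W'] conjI) auto
qed

text \<open>Since the preimage of \<open>{0}\<close> belongs to the flag, the kernel splits, and so
  the images of \<open>U\<close> and \<open>W\<close> meet only in zero. They are compatible with
  \<open>\<F>\<close> and extend to all of \<open>V\<close> without further constraint.\<close>

lemma split_transfer_backward:
  assumes fl: "is_flag V \<F>" and fin: "V \<subseteq> span B" "finite B" and sub: "subspace V" "subspace V'"
    and lin: "lin V' V h"
    and sp: "splits ((\<lambda>F. {v \<in> V'. h v \<in> F}) ` \<F>) U W" and UW: "plus_space U W = V'"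
  shows "\<exists>U' W'. splits \<F> U' W' \<and> plus_space U' W' = V \<and> h ` U \<subseteq> U' \<and> h ` W \<subseteq> W'"
proof -
  note S = splitsD[OF sp]
  have UV: "U \<subseteq> V'" "W \<subseteq> V'" using plus_space_left[OF S(2)] plus_space_right[OF S(1)] UW by blast+
  have sub': "subspace (h ` U)" "subspace (h ` W)" using subspace_image[OF lin] S(1,2) UV by auto
  have comp: "h u \<in> F" if "F \<in> \<F>" "u \<in> U" "w \<in> W" "h u + h w \<in> F" for F u w
  proof -
    have "h (u + w) = h u + h w" using linD(2)[OF lin, of u w] that(2,3) UV by blast
    hence "h (u + w) \<in> F" using that(4) by simp
    hence "u + w \<in> {v \<in> V'. h v \<in> F}" using that UV subspace_add[OF sub(2)] by blast
    hence "u \<in> {v \<in> V'. h v \<in> F}" using S(4)[OF _ that(2,3)] that(1) by blast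
    thus ?thesis by simp
  qed
  have "x = 0" if "x \<in> h ` U" "x \<in> h ` W" for x
  proof -
    obtain u w where uw: "u \<in> U" "w \<in> W" "x = h u" "x = h w" using \<open>x \<in> h ` U\<close> \<open>x \<in> h ` W\<close> by blast
    have "- w \<in> W" using subspace_neg[OF S(2)] uw by blast
    moreover have "h u + h (- w) = 0"
      using lin_diff[OF lin sub(2), of 0 w] lin_zero[OF lin, of w] uw UV
        subspace_0[OF sub(2)] by auto
    ultimately show ?thesis using comp[OF is_flagD(4)[OF fl] uw(1), of "- w"] uw(3) by simp
  qed
  hence "splits \<F> (h ` U) (h ` W)"
    using sub' comp subspace_0[OF sub'(1)] subspace_0[OF sub'(2)] unfolding splits_def by blast
  moreover have "\<exists>u\<in>F \<inter> V. \<exists>w\<in>F \<inter> V. v = u + w" if "F \<in> \<F>" "v \<in> F" for F v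
    using that is_flagD(2,3)[OF fl that(1)] subspace_0[of F] by (intro bexI[of _ v] bexI[of _ 0]) auto
  moreover have "h ` U \<subseteq> V" "h ` W \<subseteq> V" using UV linD(1)[OF lin] by auto
  ultimately show ?thesis using is_flag_extend[OF fl fin sub(1) sub(1), of "h ` U" "h ` W"] by blast
qed

lemma splits_subset: "splits \<F> U W \<Longrightarrow> \<G> \<subseteq> \<F> \<Longrightarrow> splits \<G> U W"
  unfolding splits_def by blast

text \<open>Each transfer back along one map returns a splitting compatible with the previous flag,
  so the process runs down to the end of the chain.\<close>

lemma chain_split_exists:
  assumes "linear_chain V d h m" "k \<le> m" "splits (flag V d h k) U W" "plus_space U W = V k"
  shows "\<exists>U' W'. chain_split V d h k U' W' \<and> U' k = U \<and> W' k = W"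
  using assms(2-4)
proof (induction k arbitrary: U W)
  case 0
  thus ?case using splitsD(1-3)[OF 0(2)]
    by (intro exI[of _ "\<lambda>_. U"] exI[of _ "\<lambda>_. W"]) (simp add: chain_split_def)
next
  case (Suc k)
  have sub: "subspace (V k)" "subspace (V (Suc k))" and "\<exists>B. finite B \<and> V k \<subseteq> span B"
    using assms(1) Suc.prems by (auto simp: linear_chain_def)
  then obtain B where B: "V k \<subseteq> span B" "finite B" by blast
  have fl: "is_flag (V k) (flag V d h k)" using flag_is_flag[OF assms(1)] Suc.prems by simp
  have "\<exists>U1 W1. splits (flag V d h k) U1 W1 \<and> plus_space U1 W1 = V k \<and>
    (if d k then h k ` U1 \<subseteq> U \<and> h k ` W1 \<subseteq> W else h k ` U \<subseteq> U1 \<and> h k ` W \<subseteq> W1)"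
  proof (cases "d k")
    case True
    have lin: "lin (V k) (V (Suc k)) (h k)"
      using assms(1) Suc.prems True by (auto simp: linear_chain_def)
    have "splits ((\<lambda>F. h k ` F) ` flag V d h k) U W"
      using splits_subset[OF Suc.prems(2)] True by auto
    from split_transfer_forward[OF fl B sub(1) lin this Suc.prems(3)] True show ?thesis by simp
  next
    case False
    have lin: "lin (V (Suc k)) (V k) (h k)"
      using assms(1) Suc.prems False by (auto simp: linear_chain_def)
    have "splits ((\<lambda>F. {v \<in> V (Suc k). h k v \<in> F}) ` flag V d h k) U W"
      using splits_subset[OF Suc.prems(2)] False by auto
    from split_transfer_backward[OF fl B sub lin this Suc.prems(3)] False show ?thesis by simp
  qed
  then obtain U1 W1 where 1: "splits (flag V d h k) U1 W1" "plus_space U1 W1 = V k"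
    "if d k then h k ` U1 \<subseteq> U \<and> h k ` W1 \<subseteq> W else h k ` U \<subseteq> U1 \<and> h k ` W \<subseteq> W1" by blast
  from Suc.IH[OF _ 1(1,2)] Suc.prems(1) obtain U' W' where
    2: "chain_split V d h k U' W'" "U' k = U1" "W' k = W1" by auto
  have "chain_split V d h (Suc k) (U'(Suc k := U)) (W'(Suc k := W))"
    by (rule chain_split_Suc[OF 2(1)]) (use splitsD(1-3)[OF Suc.prems(2)] Suc.prems(3) 1(3) 2 in auto)
  moreover have "(U'(Suc k := U)) (Suc k) = U" "(W'(Suc k := W)) (Suc k) = W" by simp_all
  ultimately show ?case by blast
qed

section \<open>Two flags in one space\<close>

lemma is_flag_least:
  assumes "is_flag V \<F>" "F \<in> \<F>" "p F"
  shows "\<exists>G\<in>\<F>. p G \<and> (\<forall>G'\<in>\<F>. p G' \<longrightarrow> G \<subseteq> G')"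
proof -
  have "finite {F \<in> \<F>. p F}" "{F \<in> \<F>. p F} \<noteq> {}" using is_flagD(1)[OF assms(1)] assms by auto
  from finite_has_minimal[OF this] obtain G where G: "G \<in> {F \<in> \<F>. p F}"
    and min: "\<forall>G'\<in>{F \<in> \<F>. p F}. G' \<subseteq> G \<longrightarrow> G = G'" by (rule bexE)
  have "G \<subseteq> G'" if "G' \<in> \<F>" "p G'" for G'
  proof -
    have "G' \<subseteq> G \<longrightarrow> G = G'" using bspec[OF min, of G'] that by simp
    moreover have "G \<subseteq> G' \<or> G' \<subseteq> G" using is_flagD(6)[OF assms(1)] G that by simp
    ultimately show ?thesis by blast
  qed
  thus ?thesis using G by (intro bexI[of _ G]) simp_all
qed

lemma is_flag_greatest:
  assumes "is_flag V \<F>" "F \<in> \<F>" "p F"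
  shows "\<exists>G\<in>\<F>. p G \<and> (\<forall>G'\<in>\<F>. p G' \<longrightarrow> G' \<subseteq> G)"
proof -
  have "finite {F \<in> \<F>. p F}" "{F \<in> \<F>. p F} \<noteq> {}" using is_flagD(1)[OF assms(1)] assms by auto
  from finite_has_maximal[OF this] obtain G where G: "G \<in> {F \<in> \<F>. p F}"
    and max: "\<forall>G'\<in>{F \<in> \<F>. p F}. G \<subseteq> G' \<longrightarrow> G = G'" by (rule bexE)
  have "G' \<subseteq> G" if "G' \<in> \<F>" "p G'" for G'
  proof -
    have "G \<subseteq> G' \<longrightarrow> G = G'" using bspec[OF max, of G'] that by simp
    moreover have "G \<subseteq> G' \<or> G' \<subseteq> G" using is_flagD(6)[OF assms(1)] G that by simp
    ultimately show ?thesis by blast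
  qed
  thus ?thesis using G by (intro bexI[of _ G]) simp_all
qed

text \<open>For \<open>v\<close> in the intersection of the least nonzero member \<open>F\<close> of one flag with the least member of the
  other flag meeting \<open>F\<close> nontrivially, any complement of \<open>v\<close> that contains the largest member \<open>G\<close> of the
  other flag with \<open>G \<inter> F = 0\<close> is compatible with both flags.\<close>

lemma line_splits_two_flags:
  assumes L: "is_flag V \<L>" and R: "is_flag V \<R>" and B: "V \<subseteq> span B" "finite B" and V: "subspace V" "V \<noteq> {0}"
  shows "\<exists>v W. v \<noteq> 0 \<and> splits \<L> (span {v}) W \<and> splits \<R> (span {v}) W \<and> plus_space (span {v}) W = V"
proof -
  obtain F where F: "F \<in> \<L>" "F \<noteq> {0}" and minF: "\<forall>G\<in>\<L>. G \<noteq> {0} \<longrightarrow> F \<subseteq> G"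
    using is_flag_least[where p = "\<lambda>G. G \<noteq> {0}", OF L is_flagD(5)[OF L] V(2)] by (elim bexE conjE)
  have F0: "0 \<in> F" using subspace_0 is_flagD(2)[OF L F(1)] by blast
  have "{0} \<inter> F = {0}" using F0 by blast
  from is_flag_greatest[where p = "\<lambda>G. G \<inter> F = {0}", OF R is_flagD(4)[OF R] this]
  obtain G where G: "G \<in> \<R>" "G \<inter> F = {0}" and maxG: "\<forall>G'\<in>\<R>. G' \<inter> F = {0} \<longrightarrow> G' \<subseteq> G"
    by (elim bexE conjE)
  have FV: "F \<subseteq> V" using is_flagD(3)[OF L F(1)] .
  have "V \<inter> F \<noteq> {0}" using F(2) FV by blast
  from is_flag_least[where p = "\<lambda>G. G \<inter> F \<noteq> {0}", OF R is_flagD(5)[OF R] this]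
  obtain H where H: "H \<in> \<R>" "H \<inter> F \<noteq> {0}" and minH: "\<forall>G'\<in>\<R>. G' \<inter> F \<noteq> {0} \<longrightarrow> H \<subseteq> G'"
    by (elim bexE conjE)
  have "0 \<in> H \<inter> F" using F0 subspace_0 is_flagD(2)[OF R H(1)] by blast
  then obtain v where v: "v \<in> H" "v \<in> F" "v \<noteq> 0" using H(2) by blast
  have subG: "subspace G" "G \<subseteq> V" using is_flagD(2,3)[OF R G(1)] by auto
  have vV: "v \<in> V" using v(2) FV by blast
  have line: "span {v} \<subseteq> S" if "subspace S" "v \<in> S" for S using span_minimal[of "{v}" S] that by simp
  have GF: "span {v} \<inter> G = {0}"
  proof -
    have "span {v} \<subseteq> F" by (rule line[OF is_flagD(2)[OF L F(1)] v(2)])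
    hence "span {v} \<inter> G \<subseteq> {0}" using G(2) by blast
    thus ?thesis using span_zero[of "{v}"] subspace_0[OF subG(1)] by blast
  qed
  \<comment> \<open>The two-member flag demands no more than independence. With \<open>U\<close>
    confined to the line, extending along this flag enlarges \<open>G\<close> to a complement of the
    line.\<close>
  have triv: "is_flag V {{0}, V}" using is_flag_insert[of "{}" V] V(1) by simp
  have "x \<in> F'" if "F' \<in> {{0}, V}" "x \<in> span {v}" "w \<in> G" "x + w \<in> F'" for F' x w
  proof (cases "F' = V")
    case True
    thus ?thesis using line[OF V(1) vV] that by blast
  next
    case False
    hence "x = - w" using that by (simp add: eq_neg_iff_add_eq_0)
    hence "x \<in> G" using subspace_neg[OF subG(1) that(3)] by simp
    hence "x = 0" using GF that(2) by auto
    thus ?thesis using False that(1) by simp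
  qed
  hence sp: "splits {{0}, V} (span {v}) G"
    using GF subspace_span subG(1) unfolding splits_def by blast
  have "\<exists>U W. splits {{0}, V} U W \<and> plus_space U W = V \<and> span {v} \<subseteq> U \<and> U \<subseteq> span {v} \<and> G \<subseteq> W \<and> W \<subseteq> V"
  proof (rule is_flag_extend[OF triv B subspace_span V(1) _ sp order_refl line[OF V(1) vV] subG(2) subG(2)])
    fix F' x assume "F' \<in> {{0}, V}" "x \<in> F'"
    moreover have "0 \<in> span {v}" "0 \<in> V" using span_zero subspace_0[OF V(1)] by auto
    ultimately show "\<exists>u\<in>F' \<inter> span {v}. \<exists>w\<in>F' \<inter> V. x = u + w"
      by (intro bexI[of _ 0] bexI[of _ x]) auto
  qed
  then obtain W where W: "splits {{0}, V} (span {v}) W" "plus_space (span {v}) W = V" "G \<subseteq> W" by auto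
  note S = splitsD(1-3)[OF W(1)]
  have "splits \<L> (span {v}) W"
    unfolding splits_def
  proof (intro conjI ballI impI S)
    fix F' x w assume *: "F' \<in> \<L>" "x \<in> span {v}" "w \<in> W" "x + w \<in> F'"
    show "x \<in> F'"
    proof (cases "F' = {0}")
      case True
      thus ?thesis using splitsD(4)[OF W(1) _ *(2,3), of "{0}"] * by blast
    next
      case False
      hence "F \<subseteq> F'" using bspec[OF minF *(1)] by simp
      hence "v \<in> F'" using v(2) by (rule subsetD)
      thus ?thesis by (rule subsetD[OF line[OF is_flagD(2)[OF L *(1)]] *(2)])
    qed
  qed
  moreover have "splits \<R> (span {v}) W"
    unfolding splits_def
  proof (intro conjI ballI impI S)
    fix F' x w assume *: "F' \<in> \<R>" "x \<in> span {v}" "w \<in> W" "x + w \<in> F'"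
    have sub: "subspace F'" using is_flagD(2)[OF R *(1)] .
    show "x \<in> F'"
    proof (cases "F' \<inter> F = {0}")
      case True
      hence "F' \<subseteq> W" using bspec[OF maxG *(1)] W(3) by simp
      hence "x + w \<in> W" using *(4) by (rule subsetD)
      hence "(x + w) - w \<in> W" by (rule subspace_diff[OF S(2) _ *(3)])
      hence "x = 0" using S(3) *(2) by auto
      thus ?thesis using subspace_0[OF sub] by simp
    next
      case False
      hence "H \<subseteq> F'" using bspec[OF minH *(1)] by simp
      hence "v \<in> F'" using v(1) by (rule subsetD)
      thus ?thesis by (rule subsetD[OF line[OF sub] *(2)])
    qed
  qed
  ultimately show ?thesis using v(3) W(2) by (intro exI[of _ v] exI[of _ W] conjI)
qed

lemma is_repD:
  assumes "is_rep scale Q M" "i \<in> qverts Q"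
  shows "subspace (space_at M i)" "\<exists>B. finite B \<and> span B = space_at M i"
    "(i, j) \<in> qarrows Q \<Longrightarrow> lin (space_at M i) (space_at M j) (map_at M (i, j))"
  using assms by (auto simp: is_rep_def)

lemma span_line: "z \<in> span {v} \<longleftrightarrow> (\<exists>c. z = scale c v)"
  by (auto simp: span_singleton)

lemma span_line_eq:
  assumes "z \<in> span {v}" "z \<noteq> 0"
  shows "span {z} = span {v}"
proof -
  obtain c where c: "z = scale c v" using assms(1) span_line by blast
  with assms(2) have "c \<noteq> 0" by auto
  hence "v = scale (inverse c) z" using c by simp
  hence "v \<in> span {z}" using span_line by blast
  thus ?thesis using assms(1) by (intro subset_antisym span_minimal) auto
qed

definition line_coeff :: "'v \<Rightarrow> 'v \<Rightarrow> 'k" where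
  "line_coeff x v = (THE c. v = scale c x)"

lemma line_coeff_scale: "x \<noteq> 0 \<Longrightarrow> line_coeff x (scale c x) = c"
  unfolding line_coeff_def by (rule the_equality) auto

end

section \<open>Indecomposable representations and their morphisms\<close>

locale dynkin_reps = ambient_space scale
  for scale :: "'k::field \<Rightarrow> 'v::ab_group_add \<Rightarrow> 'v" +
  fixes N :: nat and Q :: "nat quiver"
  assumes dynkin: "dynkin_A N Q"
begin

abbreviation "arr i j \<equiv> (i, j) \<in> qarrows Q"

lemma qverts_eq: "qverts Q = {1..N}"
  using dynkin by (simp add: dynkin_A_def)

lemma arrow_cases:
  assumes "arr i j"
  shows "i \<in> {1..N} \<and> j \<in> {1..N} \<and> (j = Suc i \<or> i = Suc j)"
proof -
  have "(i, j) \<in> (\<Union>i\<in>{1..<N}. {(i, i + 1), (i + 1, i)})" using dynkin assms by (auto simp: dynkin_A_def)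
  thus ?thesis by auto
qed

lemma arrow_or:
  assumes "1 \<le> i" "i < N"
  shows "arr i (Suc i) \<noteq> arr (Suc i) i"
  using dynkin_A_arrow[OF dynkin assms] .

section \<open>Splitting a representation at a vertex\<close>

definition direct_sum :: "(nat, 'v) rep \<Rightarrow> (nat \<Rightarrow> 'v set) \<Rightarrow> (nat \<Rightarrow> 'v set) \<Rightarrow> bool" where
  "direct_sum M U W \<longleftrightarrow> subrep scale Q M U \<and> subrep scale Q M W \<and>
     (\<forall>i\<in>{1..N}. U i \<inter> W i = {0} \<and> plus_space (U i) (W i) = space_at M i)"

lemma indecomposableD:
  assumes "indecomposable scale Q M"
  shows "is_rep scale Q M" "\<exists>i\<in>{1..N}. space_at M i \<noteq> {0}"
    "direct_sum M U W \<Longrightarrow> (\<forall>i\<in>{1..N}. U i = {0}) \<or> (\<forall>i\<in>{1..N}. W i = {0})"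
proof -
  have ind: "is_rep scale Q M" "\<not> zero_family Q (space_at M)"
    "\<forall>U W. subrep scale Q M U \<and> subrep scale Q M W \<and>
        (\<forall>i\<in>qverts Q. U i \<inter> W i = {0} \<and> {u + w | u w. u \<in> U i \<and> w \<in> W i} = space_at M i)
        \<longrightarrow> zero_family Q U \<or> zero_family Q W"
    using assms unfolding indecomposable_def by simp_all
  show "is_rep scale Q M" by (rule ind(1))
  show "\<exists>i\<in>{1..N}. space_at M i \<noteq> {0}" using ind(2) by (simp add: zero_family_def qverts_eq)
  show "(\<forall>i\<in>{1..N}. U i = {0}) \<or> (\<forall>i\<in>{1..N}. W i = {0})" if "direct_sum M U W"
    using ind(3)[THEN spec, THEN spec, of U W] that
    by (simp add: direct_sum_def zero_family_def qverts_eq plus_space_def)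
qed

lemma direct_sumI:
  assumes "\<And>i. i \<in> {1..N} \<Longrightarrow> subspace (U i) \<and> subspace (W i) \<and> U i \<inter> W i = {0} \<and> plus_space (U i) (W i) = space_at M i"
    and "\<And>i j. arr i j \<Longrightarrow> map_at M (i, j) ` U i \<subseteq> U j \<and> map_at M (i, j) ` W i \<subseteq> W j"
  shows "direct_sum M U W"
proof -
  have "U i \<subseteq> space_at M i \<and> W i \<subseteq> space_at M i" if "i \<in> {1..N}" for i
  proof -
    have "U i \<subseteq> plus_space (U i) (W i)" "W i \<subseteq> plus_space (U i) (W i)"
      using plus_space_left plus_space_right assms(1)[OF that] by auto
    thus ?thesis using assms(1)[OF that] by simp
  qed
  moreover have "map_at M (a, b) x \<in> U b" if "arr a b" "x \<in> U a" for a b x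
    using assms(2)[OF that(1)] that(2) by blast
  moreover have "map_at M (a, b) x \<in> W b" if "arr a b" "x \<in> W a" for a b x
    using assms(2)[OF that(1)] that(2) by blast
  ultimately show ?thesis using assms(1)
    unfolding direct_sum_def subrep_def qverts_eq by (intro conjI ballI) auto
qed

text \<open>A walk \<open>\<sigma>\<close> along the quiver, in either direction, turns a representation into a linear chain.\<close>

definition walk_dir :: "(nat \<Rightarrow> nat) \<Rightarrow> nat \<Rightarrow> bool" where
  "walk_dir \<sigma> k \<longleftrightarrow> arr (\<sigma> k) (\<sigma> (Suc k))"

definition walk_map :: "(nat, 'v) rep \<Rightarrow> (nat \<Rightarrow> nat) \<Rightarrow> nat \<Rightarrow> 'v \<Rightarrow> 'v" where
  "walk_map M \<sigma> k = map_at M (if walk_dir \<sigma> k then (\<sigma> k, \<sigma> (Suc k)) else (\<sigma> (Suc k), \<sigma> k))"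

definition walk_flag :: "(nat, 'v) rep \<Rightarrow> (nat \<Rightarrow> nat) \<Rightarrow> nat \<Rightarrow> 'v set set" where
  "walk_flag M \<sigma> = flag (\<lambda>k. space_at M (\<sigma> k)) (walk_dir \<sigma>) (walk_map M \<sigma>)"

definition is_walk :: "(nat \<Rightarrow> nat) \<Rightarrow> nat \<Rightarrow> bool" where
  "is_walk \<sigma> m \<longleftrightarrow> (\<forall>k\<le>m. \<sigma> k \<in> {1..N}) \<and>
     (\<forall>k<m. arr (\<sigma> k) (\<sigma> (Suc k)) \<noteq> arr (\<sigma> (Suc k)) (\<sigma> k))"

lemma left_walk: "m < N \<Longrightarrow> is_walk Suc m"
  using arrow_or by (auto simp: is_walk_def)

lemma right_walk:
  assumes "m < N"
  shows "is_walk ((-) N) m"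
  unfolding is_walk_def
proof (intro conjI allI impI)
  fix k assume "k < m"
  hence "1 \<le> N - Suc k" "N - Suc k < N" "Suc (N - Suc k) = N - k" using assms by auto
  thus "arr (N - k) (N - Suc k) \<noteq> arr (N - Suc k) (N - k)"
    using arrow_or[of "N - Suc k"] by simp
qed (use assms in auto)

lemma walk_linear_chain:
  assumes "is_rep scale Q M" "is_walk \<sigma> m"
  shows "linear_chain (\<lambda>k. space_at M (\<sigma> k)) (walk_dir \<sigma>) (walk_map M \<sigma>) m"
  unfolding linear_chain_def
proof (intro conjI allI impI)
  fix k assume "k \<le> m"
  hence k: "\<sigma> k \<in> qverts Q" using assms(2) by (simp add: qverts_eq is_walk_def)
  show "subspace (space_at M (\<sigma> k))" "\<exists>B. finite B \<and> space_at M (\<sigma> k) \<subseteq> span B"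
    using is_repD(1,2)[OF assms(1) k] by auto
next
  fix k assume "k < m"
  hence k: "\<sigma> k \<in> qverts Q" "\<sigma> (Suc k) \<in> qverts Q"
    and or: "arr (\<sigma> k) (\<sigma> (Suc k)) \<noteq> arr (\<sigma> (Suc k)) (\<sigma> k)"
    using assms(2) by (simp_all add: qverts_eq is_walk_def)
  show "if walk_dir \<sigma> k then lin (space_at M (\<sigma> k)) (space_at M (\<sigma> (Suc k))) (walk_map M \<sigma> k)
      else lin (space_at M (\<sigma> (Suc k))) (space_at M (\<sigma> k)) (walk_map M \<sigma> k)"
    using is_repD(3)[OF assms(1) k(1)] is_repD(3)[OF assms(1) k(2)] or
    unfolding walk_map_def walk_dir_def by simp
qed

lemma walk_flag_is_flag:
  "is_rep scale Q M \<Longrightarrow> is_walk \<sigma> m \<Longrightarrow> is_flag (space_at M (\<sigma> m)) (walk_flag M \<sigma> m)"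
  unfolding walk_flag_def using flag_is_flag[OF walk_linear_chain order_refl] by blast

text \<open>Arrows along and against the walk are treated alike, so that the decompositions on the
  two sides of a vertex can be glued.\<close>

definition splits_along :: "(nat, 'v) rep \<Rightarrow> (nat \<Rightarrow> nat) \<Rightarrow> nat \<Rightarrow> (nat \<Rightarrow> 'v set) \<Rightarrow> (nat \<Rightarrow> 'v set) \<Rightarrow> bool" where
  "splits_along M \<sigma> m U W \<longleftrightarrow>
     (\<forall>k\<le>m. subspace (U k) \<and> subspace (W k) \<and> U k \<inter> W k = {0} \<and> plus_space (U k) (W k) = space_at M (\<sigma> k)) \<and>
     (\<forall>k\<le>m. \<forall>l\<le>m. (l = Suc k \<or> k = Suc l) \<and> arr (\<sigma> k) (\<sigma> l) \<longrightarrow>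
        map_at M (\<sigma> k, \<sigma> l) ` U k \<subseteq> U l \<and> map_at M (\<sigma> k, \<sigma> l) ` W k \<subseteq> W l)"

lemma walk_split:
  assumes "is_rep scale Q M" "is_walk \<sigma> m" "splits (walk_flag M \<sigma> m) U W" "plus_space U W = space_at M (\<sigma> m)"
  obtains U' W' where "U' m = U" "W' m = W" "splits_along M \<sigma> m U' W'"
proof -
  from chain_split_exists[OF walk_linear_chain[OF assms(1,2)] order_refl assms(3)[unfolded walk_flag_def] assms(4)]
  obtain U' W' where s: "chain_split (\<lambda>k. space_at M (\<sigma> k)) (walk_dir \<sigma>) (walk_map M \<sigma>) m U' W'"
    and UW: "U' m = U" "W' m = W" by (elim exE conjE)
  note step = s[unfolded chain_split_def, THEN conjunct2, THEN spec, THEN mp]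
  show thesis
  proof (rule that[of U' W', OF UW], unfold splits_along_def, intro conjI[OF s[unfolded chain_split_def, THEN conjunct1]] allI impI, elim conjE)
    fix k l assume kl: "k \<le> m" "l \<le> m" "l = Suc k \<or> k = Suc l" "arr (\<sigma> k) (\<sigma> l)"
    from kl(3) show "map_at M (\<sigma> k, \<sigma> l) ` U' k \<subseteq> U' l \<and> map_at M (\<sigma> k, \<sigma> l) ` W' k \<subseteq> W' l"
    proof
      assume "l = Suc k"
      thus ?thesis using step[of k] kl by (simp add: walk_map_def walk_dir_def)
    next
      assume l: "k = Suc l"
      hence "\<not> arr (\<sigma> l) (\<sigma> k)" using assms(2) kl by (auto simp: is_walk_def)
      thus ?thesis using step[of l] kl l by (simp add: walk_map_def walk_dir_def)
    qed
  qed
qed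

text \<open>The decompositions of the two sides agree at \<open>i\<close>, where both are
  \<open>U\<close> and \<open>W\<close>, and no arrow jumps over \<open>i\<close>.\<close>

lemma direct_sum_from_vertex:
  assumes rep: "is_rep scale Q M" and i: "i \<in> {1..N}"
    and L: "splits (walk_flag M Suc (i - 1)) U W" and R: "splits (walk_flag M ((-) N) (N - i)) U W"
    and UW: "plus_space U W = space_at M i"
  shows "\<exists>U' W'. direct_sum M U' W' \<and> U' i = U"
proof -
  \<comment> \<open>Vertex \<open>i\<close> has position \<open>i - 1\<close> on the walk starting
    at \<open>1\<close> and position \<open>N - i\<close> on the walk starting at
    \<open>N\<close>.\<close>
  have lt: "i - 1 < N" "N - i < N" and eq: "Suc (i - 1) = i" "N - (N - i) = i" using i by auto
  obtain UL WL where l: "UL (i - 1) = U" "WL (i - 1) = W" "splits_along M Suc (i - 1) UL WL"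
    using walk_split[OF rep left_walk[OF lt(1)] L] UW unfolding eq by metis
  obtain UR WR where r: "UR (N - i) = U" "WR (N - i) = W" "splits_along M ((-) N) (N - i) UR WR"
    using walk_split[OF rep right_walk[OF lt(2)] R] UW unfolding eq by metis
  note l' = l(3)[unfolded splits_along_def] and r' = r(3)[unfolded splits_along_def]
  define U' where "U' j = (if j \<le> i then UL (j - 1) else UR (N - j))" for j
  define W' where "W' j = (if j \<le> i then WL (j - 1) else WR (N - j))" for j
  have lU: "U' j = UL (j - 1)" "W' j = WL (j - 1)" if "j \<le> i" for j
    using that by (auto simp: U'_def W'_def)
  have rU: "U' j = UR (N - j)" "W' j = WR (N - j)" if "i \<le> j" for j
    using that l(1,2) r(1,2) by (auto simp: U'_def W'_def)
  have "direct_sum M U' W'"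
  proof (rule direct_sumI)
    fix j assume j: "j \<in> {1..N}"
    thus "subspace (U' j) \<and> subspace (W' j) \<and> U' j \<inter> W' j = {0} \<and> plus_space (U' j) (W' j) = space_at M j"
      using l'[THEN conjunct1, THEN spec, of "j - 1"] r'[THEN conjunct1, THEN spec, of "N - j"]
        lU[of j] rU[of j] by (cases "j \<le> i") auto
  next
    fix s t assume st: "arr s t"
    note V = arrow_cases[OF st]
    show "map_at M (s, t) ` U' s \<subseteq> U' t \<and> map_at M (s, t) ` W' s \<subseteq> W' t"
    proof (cases "s \<le> i \<and> t \<le> i")
      case True
      hence pre: "s - 1 \<le> i - 1" "t - 1 \<le> i - 1" "t - 1 = Suc (s - 1) \<or> s - 1 = Suc (t - 1)"
        and S: "Suc (s - 1) = s" "Suc (t - 1) = t" using V by auto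
      have "map_at M (s, t) ` UL (s - 1) \<subseteq> UL (t - 1) \<and> map_at M (s, t) ` WL (s - 1) \<subseteq> WL (t - 1)"
        by (rule l'[THEN conjunct2, THEN spec, THEN mp, THEN spec, THEN mp, OF pre(1,2), unfolded S, THEN mp])
          (use pre(3)[unfolded S] st in simp)
      thus ?thesis using lU True by simp
    next
      case False
      hence pre: "N - s \<le> N - i" "N - t \<le> N - i" "N - t = Suc (N - s) \<or> N - s = Suc (N - t)"
        and S: "N - (N - s) = s" "N - (N - t) = t" "i \<le> s" "i \<le> t" using V by auto
      have "map_at M (s, t) ` UR (N - s) \<subseteq> UR (N - t) \<and> map_at M (s, t) ` WR (N - s) \<subseteq> WR (N - t)"
        by (rule r'[THEN conjunct2, THEN spec, THEN mp, THEN spec, THEN mp, OF pre(1,2), unfolded S(1,2), THEN mp])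
          (use pre(3) st in simp)
      thus ?thesis using rU S(3,4) by simp
    qed
  qed
  moreover have "U' i = U" using l(1) by (simp add: U'_def)
  ultimately show ?thesis by blast
qed

lemma indecomposable_thin:
  assumes "indecomposable scale Q M" "i \<in> {1..N}"
  shows "\<exists>v. space_at M i = span {v}"
proof (cases "space_at M i = {0}")
  case True
  thus ?thesis by (intro exI[of _ 0]) (simp add: span_singleton)
next
  case False
  have rep: "is_rep scale Q M" using indecomposableD(1)[OF assms(1)] .
  have iV: "i \<in> qverts Q" using assms(2) by (simp add: qverts_eq)
  obtain B where B: "finite B" "space_at M i \<subseteq> span B" using is_repD(2)[OF rep iV] by auto
  have lt: "i - 1 < N" "N - i < N" and eq: "Suc (i - 1) = i" "N - (N - i) = i" using assms(2) by auto
  have L: "is_flag (space_at M i) (walk_flag M Suc (i - 1))"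
    using walk_flag_is_flag[OF rep left_walk[OF lt(1)]] eq by simp
  have R: "is_flag (space_at M i) (walk_flag M ((-) N) (N - i))"
    using walk_flag_is_flag[OF rep right_walk[OF lt(2)]] eq by simp
  from line_splits_two_flags[OF L R B(2,1) is_repD(1)[OF rep iV] False]
  obtain v W where v: "v \<noteq> 0" "splits (walk_flag M Suc (i - 1)) (span {v}) W"
    "splits (walk_flag M ((-) N) (N - i)) (span {v}) W"
    "plus_space (span {v}) W = space_at M i" by (elim exE conjE)
  from direct_sum_from_vertex[OF rep assms(2) v(2,3,4)] obtain U' W' where
    d: "direct_sum M U' W'" "U' i = span {v}" by (elim exE conjE)
  have "v \<in> span {v}" by (simp add: span_base)
  hence "U' i \<noteq> {0}" using v(1) d(2) by auto
  hence "\<forall>j\<in>{1..N}. W' j = {0}" using indecomposableD(3)[OF assms(1) d(1)] assms(2) by blast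
  hence "plus_space (U' i) {0} = space_at M i" using d(1) assms(2) unfolding direct_sum_def by metis
  hence "space_at M i = U' i" by (simp add: plus_space_def)
  thus ?thesis using d(2) by blast
qed

text \<open>The segment joining \<open>a\<close> and \<open>b\<close> corresponds to the representation supported on the
  interval \<open>a + 1, \<dots>, b\<close>.\<close>

definition framed :: "(nat, 'v) rep \<Rightarrow> nat \<Rightarrow> nat \<Rightarrow> (nat \<Rightarrow> 'v) \<Rightarrow> bool" where
  "framed M a b x \<longleftrightarrow> is_rep scale Q M \<and> a < b \<and> b \<le> N \<and> (\<forall>i\<in>{a<..b}. x i \<noteq> 0) \<and>
     (\<forall>i\<in>{1..N}. space_at M i = (if i \<in> {a<..b} then span {x i} else {0})) \<and>
     (\<forall>(i, j)\<in>qarrows Q. i \<in> {a<..b} \<and> j \<in> {a<..b} \<longrightarrow> map_at M (i, j) (x i) = x j)"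

lemma framedD:
  assumes "framed M a b x"
  shows "is_rep scale Q M" "a < b" "b \<le> N" "i \<in> {a<..b} \<Longrightarrow> x i \<noteq> 0"
    "i \<in> {a<..b} \<Longrightarrow> space_at M i = span {x i}"
    "i \<in> {1..N} \<Longrightarrow> i \<notin> {a<..b} \<Longrightarrow> space_at M i = {0}"
    "arr i j \<Longrightarrow> i \<in> {a<..b} \<Longrightarrow> j \<in> {a<..b} \<Longrightarrow> map_at M (i, j) (x i) = x j"
  using assms unfolding framed_def by auto

lemma map_linear:
  assumes "is_rep scale Q M" "arr i j"
  shows "lin (space_at M i) (space_at M j) (map_at M (i, j))"
  using is_repD(3)[OF assms(1)] assms(2) arrow_cases[OF assms(2)] by (simp add: qverts_eq)

lemma rep_zero_mem: "is_rep scale Q M \<Longrightarrow> i \<in> {1..N} \<Longrightarrow> 0 \<in> space_at M i"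
  using is_repD(1)[of Q M i] subspace_0 by (simp add: qverts_eq)

lemma map_zero: "is_rep scale Q M \<Longrightarrow> arr i j \<Longrightarrow> map_at M (i, j) 0 = 0"
  using lin_zero[OF map_linear, of M i j 0] rep_zero_mem[of M i] arrow_cases[of i j] by auto

section \<open>Indecomposables are interval representations\<close>

text \<open>If the map between \<open>k\<close> and \<open>Suc k\<close> vanished, the spaces up to
  \<open>k\<close> and those beyond it would form complementary subrepresentations, nonzero at
  \<open>lo\<close> and at \<open>hi\<close> respectively.\<close>

lemma indecomposable_cut:
  assumes ind: "indecomposable scale Q M" and k: "lo \<le> k" "k < hi"
    and lo: "lo \<in> {1..N}" "space_at M lo \<noteq> {0}" and hi: "hi \<in> {1..N}" "space_at M hi \<noteq> {0}"
    and ij: "arr i j" "(i, j) \<in> {(k, Suc k), (Suc k, k)}"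
  shows "\<exists>y\<in>space_at M i. map_at M (i, j) y \<noteq> 0"
proof (rule ccontr)
  assume no: "\<not> (\<exists>y\<in>space_at M i. map_at M (i, j) y \<noteq> 0)"
  have rep: "is_rep scale Q M" using indecomposableD(1)[OF ind] .
  let ?U = "\<lambda>l. if l \<le> k then space_at M l else {0}"
  let ?W = "\<lambda>l. if l \<le> k then {0} else space_at M l"
  have "direct_sum M ?U ?W"
  proof (rule direct_sumI)
    fix l assume l: "l \<in> {1..N}"
    hence "subspace (space_at M l)" "0 \<in> space_at M l"
      using is_repD(1)[OF rep] rep_zero_mem[OF rep] by (auto simp: qverts_eq)
    thus "subspace (?U l) \<and> subspace (?W l) \<and> ?U l \<inter> ?W l = {0} \<and> plus_space (?U l) (?W l) = space_at M l"
      by (auto simp: plus_space_def subspace_single_0)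
  next
    fix s t assume st: "arr s t"
    have lin: "map_at M (s, t) y \<in> space_at M t" if "y \<in> space_at M s" for y
      using linD(1)[OF map_linear[OF rep st] that] .
    have 0: "map_at M (s, t) 0 = 0" "0 \<in> space_at M t"
      using map_zero[OF rep st] rep_zero_mem[OF rep] arrow_cases[OF st] by auto
    have "(s, t) = (i, j)" if "(s \<le> k) \<noteq> (t \<le> k)"
    proof -
      have "(s, t) \<in> {(k, Suc k), (Suc k, k)}" using arrow_cases[OF st] that by auto
      thus ?thesis using st ij arrow_or[of k] k lo(1) hi(1) by auto
    qed
    hence "map_at M (s, t) y = 0" if "(s \<le> k) \<noteq> (t \<le> k)" "y \<in> space_at M s" for y
      using that no by auto
    thus "map_at M (s, t) ` ?U s \<subseteq> ?U t \<and> map_at M (s, t) ` ?W s \<subseteq> ?W t"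
      using lin 0 by auto
  qed
  hence "(\<forall>l\<in>{1..N}. ?U l = {0}) \<or> (\<forall>l\<in>{1..N}. ?W l = {0})" by (rule indecomposableD(3)[OF ind])
  hence "?U lo = {0} \<or> ?W hi = {0}" using lo(1) hi(1) by blast
  thus False using k lo(2) hi(2) by simp
qed

text \<open>By \<open>indecomposable_cut\<close> every inner map is nonzero, so the support has no
  gaps and a basis vector can be passed on from vertex to vertex, as an image or as a preimage
  according to the arrow.\<close>

lemma indecomposable_framed:
  assumes ind: "indecomposable scale Q M"
  shows "\<exists>a b x. framed M a b x"
proof -
  have rep: "is_rep scale Q M" using indecomposableD(1)[OF ind] .
  define S where "S = {i \<in> {1..N}. space_at M i \<noteq> {0}}"
  have S: "finite S" "S \<noteq> {}" using indecomposableD(2)[OF ind] by (auto simp: S_def)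
  define lo where "lo = Min S"
  define hi where "hi = Max S"
  have lo: "lo \<in> {1..N}" "space_at M lo \<noteq> {0}" using Min_in[OF S] by (auto simp: S_def lo_def)
  have hi: "hi \<in> {1..N}" "space_at M hi \<noteq> {0}" using Max_in[OF S] by (auto simp: S_def hi_def)
  have le: "lo \<le> hi" using Min_le[OF S(1) Max_in[OF S]] by (simp add: lo_def hi_def)
  have out: "space_at M i = {0}" if "i \<in> {1..N}" "i \<notin> {lo..hi}" for i
  proof (rule ccontr)
    assume "space_at M i \<noteq> {0}"
    hence "i \<in> S" using that by (simp add: S_def)
    thus False using that(2) Min_le[OF S(1)] Max_ge[OF S(1)] by (simp add: lo_def hi_def)
  qed
  let ?good = "\<lambda>x m. (\<forall>i\<in>{lo..lo + m}. x i \<noteq> 0 \<and> space_at M i = span {x i}) \<and>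
    (\<forall>i j. arr i j \<and> i \<in> {lo..lo + m} \<and> j \<in> {lo..lo + m} \<longrightarrow> map_at M (i, j) (x i) = x j)"
  have "\<exists>x. ?good x m" if "lo + m \<le> hi" for m
    using that
  proof (induction m)
    case 0
    obtain v where v: "space_at M lo = span {v}" using indecomposable_thin[OF ind lo(1)] by blast
    have "v \<noteq> 0" using lo(2) v by (auto simp: span_singleton)
    moreover have "\<not> arr i j" if "i = lo" "j = lo" for i j using arrow_cases[of i j] that by auto
    ultimately have "?good (\<lambda>_. v) 0" using v by auto
    thus ?case by (rule exI[of _ "\<lambda>_. v"])
  next
    case (Suc m)
    then obtain x where x: "?good x m" by auto
    define k where "k = lo + m"
    have k: "lo \<le> k" "k < hi" "k \<in> {1..N}" "Suc k \<in> {1..N}" using Suc.prems lo(1) hi(1) by (auto simp: k_def)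
    have xk: "x k \<noteq> 0" "space_at M k = span {x k}" using x by (auto simp: k_def)
    obtain v where v: "space_at M (Suc k) = span {v}" using indecomposable_thin[OF ind k(4)] by blast
    have "\<exists>z. z \<noteq> 0 \<and> z \<in> span {v} \<and> (arr k (Suc k) \<longrightarrow> map_at M (k, Suc k) (x k) = z) \<and>
        (arr (Suc k) k \<longrightarrow> map_at M (Suc k, k) z = x k)"
    proof (cases "arr k (Suc k)")
      case True
      hence no: "\<not> arr (Suc k) k" using arrow_or[of k] k by auto
      note lin = map_linear[OF rep True]
      obtain y where y: "y \<in> space_at M k" "map_at M (k, Suc k) y \<noteq> 0"
        using indecomposable_cut[OF ind k(1,2) lo hi True] by auto
      obtain c where c: "y = scale c (x k)" using y(1) xk(2) span_line by auto
      have xin: "x k \<in> space_at M k" using xk(2) by (simp add: span_base)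
      have "map_at M (k, Suc k) (x k) \<noteq> 0"
        using y(2) linD(3)[OF lin xin, of c] c by auto
      moreover have "map_at M (k, Suc k) (x k) \<in> span {v}" using linD(1)[OF lin xin] v by simp
      ultimately show ?thesis using no by blast
    next
      case False
      hence arr: "arr (Suc k) k" using arrow_or[of k] k by auto
      note lin = map_linear[OF rep arr]
      obtain y where y: "y \<in> space_at M (Suc k)" "map_at M (Suc k, k) y \<noteq> 0"
        using indecomposable_cut[OF ind k(1,2) lo hi arr] by auto
      have "map_at M (Suc k, k) y \<in> span {x k}" using linD(1)[OF lin y(1)] xk(2) by simp
      then obtain c where c: "map_at M (Suc k, k) y = scale c (x k)" using span_line by blast
      hence c0: "c \<noteq> 0" using y(2) by auto
      \<comment> \<open>Dividing by \<open>c\<close> makes the preimage map exactly onto the frame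
        vector already chosen at \<open>k\<close>.\<close>
      let ?z = "scale (inverse c) y"
      have "map_at M (Suc k, k) ?z = x k" using linD(3)[OF lin y(1), of "inverse c"] c c0 by simp
      moreover have "?z \<in> span {v}" using y(1) v span_scale by simp
      moreover have "?z \<noteq> 0" using \<open>map_at M (Suc k, k) ?z = x k\<close> xk(1) map_zero[OF rep arr] by auto
      ultimately show ?thesis using False by blast
    qed
    then obtain z where z: "z \<noteq> 0" "z \<in> span {v}" "arr k (Suc k) \<Longrightarrow> map_at M (k, Suc k) (x k) = z"
      "arr (Suc k) k \<Longrightarrow> map_at M (Suc k, k) z = x k" by blast
    have "space_at M (Suc k) = span {z}" using v span_line_eq[OF z(2,1)] by simp
    hence 1: "\<forall>i\<in>{lo..lo + Suc m}. (x(Suc k := z)) i \<noteq> 0 \<and> space_at M i = span {(x(Suc k := z)) i}"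
      using x z(1) by (auto simp: k_def le_Suc_eq)
    have 2: "map_at M (i, j) ((x(Suc k := z)) i) = (x(Suc k := z)) j"
      if ij: "arr i j" "i \<in> {lo..lo + Suc m}" "j \<in> {lo..lo + Suc m}" for i j
    proof -
      consider "i = Suc k" "j = k" | "i = k" "j = Suc k" | "i \<noteq> Suc k" "j \<noteq> Suc k"
        using arrow_cases[OF ij(1)] ij(2,3) unfolding k_def atLeastAtMost_iff
        by (cases "i = Suc (lo + m)"; cases "j = Suc (lo + m)") auto
      thus ?thesis
      proof cases
        case 1 thus ?thesis using z(4) ij(1) by simp
      next
        case 2 thus ?thesis using z(3) ij(1) by simp
      next
        case 3
        hence "i \<in> {lo..lo + m}" "j \<in> {lo..lo + m}" using ij(2,3) by (auto simp: k_def)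
        thus ?thesis using 3 x ij(1) by simp
      qed
    qed
    have "?good (x(Suc k := z)) (Suc m)" using 1 2 by blast
    thus ?case by (rule exI[of _ "x(Suc k := z)"])
  qed
  from this[of "hi - lo"] le obtain x where x: "?good x (hi - lo)" by auto
  \<comment> \<open>\<open>lo\<close> is at least \<open>1\<close>, so the subtraction is not
    truncated and the half-open interval starts at \<open>lo\<close>.\<close>
  have int: "{lo - 1<..hi} = {lo..hi}" using lo(1) by auto
  have "framed M (lo - 1) hi x"
    unfolding framed_def int using rep lo(1) hi(1) le x out by auto
  thus ?thesis by blast
qed

lemma direct_sum_map:
  assumes "direct_sum M U W" "arr i j"
  shows "map_at M (i, j) ` U i \<subseteq> U j" "map_at M (i, j) ` W i \<subseteq> W j"
proof -
  have "(\<forall>(i, j)\<in>qarrows Q. map_at M (i, j) ` U i \<subseteq> U j) \<and> (\<forall>(i, j)\<in>qarrows Q. map_at M (i, j) ` W i \<subseteq> W j)"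
    using assms(1) unfolding direct_sum_def subrep_def by (elim conjE, intro conjI)
  note * = this[THEN conjunct1] this[THEN conjunct2]
  show "map_at M (i, j) ` U i \<subseteq> U j" "map_at M (i, j) ` W i \<subseteq> W j"
    using bspec[OF *(1) assms(2)] bspec[OF *(2) assms(2)] by simp_all
qed

text \<open>A line has no proper splitting, so each frame vector lies in one of the summands; the
  arrows carry frame vectors to frame vectors, so it is the same summand along the whole interval
  and the other one vanishes.\<close>

lemma framed_indecomposable:
  assumes fr: "framed M a b x"
  shows "indecomposable scale Q M"
proof -
  note F = framedD[OF fr]
  have V: "{a<..b} \<subseteq> {1..N}" using F(3) by auto
  have "zero_family Q U \<or> zero_family Q W" if UW: "direct_sum M U W" for U W
  proof -
    have sub: "subspace (U i)" "subspace (W i)" "U i \<inter> W i = {0}" "plus_space (U i) (W i) = space_at M i"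
      "U i \<subseteq> space_at M i" "W i \<subseteq> space_at M i" if "i \<in> {1..N}" for i
      using UW that unfolding direct_sum_def subrep_def qverts_eq by auto
    have mapU: "map_at M (i, j) y \<in> U j" if "arr i j" "y \<in> U i" for i j y
      using direct_sum_map(1)[OF UW that(1)] that(2) by (rule subsetD[OF _ imageI])
    have mapW: "map_at M (i, j) y \<in> W j" if "arr i j" "y \<in> W i" for i j y
      using direct_sum_map(2)[OF UW that(1)] that(2) by (rule subsetD[OF _ imageI])
    have or: "x i \<in> U i \<or> x i \<in> W i" if i: "i \<in> {a<..b}" for i
    proof -
      have iV: "i \<in> {1..N}" using V i by blast
      have "x i \<in> plus_space (U i) (W i)" using F(5)[OF i] sub(4)[OF iV] by (simp add: span_base)
      then obtain u w where uw: "u \<in> U i" "w \<in> W i" "x i = u + w" by (auto simp: plus_space_def)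
      have "u \<in> span {x i}" using subsetD[OF sub(5)[OF iV] uw(1)] F(5)[OF i] by simp
      then obtain c where c: "u = scale c (x i)" using span_line by blast
      show ?thesis
      proof (cases "c = 0")
        case True
        hence "x i = w" using uw(3) c by simp
        thus ?thesis using uw(2) by simp
      next
        case False
        hence "x i = scale (inverse c) u" using c by simp
        thus ?thesis using subspace_scale[OF sub(1)[OF iV] uw(1)] by metis
      qed
    qed
    have notboth: "\<not> (x i \<in> U i \<and> x i \<in> W i)" if i: "i \<in> {a<..b}" for i
    proof
      assume "x i \<in> U i \<and> x i \<in> W i"
      hence "x i \<in> U i \<inter> W i" by simp
      also have "U i \<inter> W i = {0}" using sub(3)[of i] subsetD[OF V i] .
      finally show False using F(4)[OF i] by simp
    qed
    have next_U: "x i \<in> U i \<longleftrightarrow> x (Suc i) \<in> U (Suc i)" if i: "i \<in> {a<..b}" "Suc i \<in> {a<..b}" for i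
    proof -
      have "1 \<le> i" "i < N" using F(3) i by auto
      from arrow_or[OF this] consider "arr i (Suc i)" | "arr (Suc i) i" by blast
      thus ?thesis
      proof cases
        case 1
        thus ?thesis using F(7)[OF 1 i] mapU[OF 1, of "x i"] mapW[OF 1, of "x i"]
            or[OF i(1)] notboth[OF i(2)] by auto
      next
        case 2
        thus ?thesis using F(7)[OF 2 i(2,1)] mapU[OF 2, of "x (Suc i)"] mapW[OF 2, of "x (Suc i)"]
            or[OF i(2)] notboth[OF i(1)] by auto
      qed
    qed
    have all: "x i \<in> U i \<longleftrightarrow> x (Suc a) \<in> U (Suc a)" if "i \<in> {a<..b}" for i
    proof -
      from that have "Suc a \<le> i" "i \<le> b" by auto
      thus ?thesis
      proof (induction i rule: dec_induct)
        case (step i)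
        thus ?case using next_U[of i] by simp
      qed simp
    qed
    have zero: "Z i = {0}" if h: "i \<in> {1..N}" "subspace (Z i)" "Z i \<subseteq> space_at M i" "i \<in> {a<..b} \<Longrightarrow> x i \<notin> Z i" for Z :: "nat \<Rightarrow> 'v set" and i
    proof -
      have "z = 0" if zZ: "z \<in> Z i" for z
      proof (rule ccontr)
        assume z: "z \<noteq> 0"
        hence i: "i \<in> {a<..b}" using F(6)[of i] h(1) zZ h(3) by auto
        have "z \<in> span {x i}" using subsetD[OF h(3) zZ] F(5)[OF i] by simp
        then obtain c where c: "z = scale c (x i)" using span_line by blast
        hence "x i = scale (inverse c) z" using z by auto
        thus False using subspace_scale[OF h(2) zZ] h(4)[OF i] by metis
      qed
      thus ?thesis using subspace_0[OF h(2)] by blast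
    qed
    show ?thesis
    proof (cases "x (Suc a) \<in> U (Suc a)")
      case True
      have "W i = {0}" if i: "i \<in> {1..N}" for i
        using zero[of i W, OF i sub(2,6)[OF i]] all[of i] notboth[of i] True by blast
      thus ?thesis by (simp add: zero_family_def qverts_eq)
    next
      case False
      have "U i = {0}" if i: "i \<in> {1..N}" for i
        using zero[of i U, OF i sub(1,5)[OF i]] all[of i] False by blast
      thus ?thesis by (simp add: zero_family_def qverts_eq)
    qed
  qed
  moreover have "\<not> zero_family Q (space_at M)"
  proof -
    have b: "b \<in> {a<..b}" "b \<in> {1..N}" using F(2,3) by auto
    hence "x b \<in> space_at M b" using F(5)[OF b(1)] by (simp add: span_base)
    thus ?thesis using F(4)[OF b(1)] b(2) by (auto simp: zero_family_def qverts_eq)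
  qed
  ultimately show ?thesis using F(1) unfolding indecomposable_def direct_sum_def plus_space_def qverts_eq
    by blast
qed

definition interval_rep :: "nat \<Rightarrow> nat \<Rightarrow> 'v \<Rightarrow> (nat, 'v) rep" where
  "interval_rep a b e = \<lparr>space_at = (\<lambda>i. if i \<in> {a<..b} then span {e} else {0}),
     map_at = (\<lambda>(i, j) v. if i \<in> {a<..b} \<and> j \<in> {a<..b} then v else 0)\<rparr>"

lemma interval_rep_framed:
  assumes "a < b" "b \<le> N" "e \<noteq> 0"
  shows "framed (interval_rep a b e) a b (\<lambda>_. e)"
proof -
  have "\<exists>B. finite B \<and> span B = {0}" by (rule exI[of _ "{}"]) simp
  moreover have "\<exists>B. finite B \<and> span B = span {e}" by (rule exI[of _ "{e}"]) simp
  ultimately have "is_rep scale Q (interval_rep a b e)"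
    unfolding is_rep_def interval_rep_def linear_between_def
    using span_zero by (auto simp: subspace_single_0)
  thus ?thesis using assms unfolding framed_def by (auto simp: interval_rep_def)
qed

section \<open>Morphisms between interval representations\<close>

text \<open>The supports overlap, and the overlap is a quotient of the first representation and a
  subrepresentation of the second: at its ends, arrows point out of the overlap towards the rest of
  the first support, and into it from the rest of the second.\<close>

definition interval_hom :: "nat \<Rightarrow> nat \<Rightarrow> nat \<Rightarrow> nat \<Rightarrow> bool" where
  "interval_hom a b c d \<longleftrightarrow> a < d \<and> c < b \<and>
     (a < c \<longrightarrow> arr (Suc c) c) \<and> (c < a \<longrightarrow> arr a (Suc a)) \<and>
     (b < d \<longrightarrow> arr (Suc b) b) \<and> (d < b \<longrightarrow> arr d (Suc d))"

text \<open>The graph map that sends frame to frame on the overlap, extended by zero to a total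
  function as \<open>rep_hom\<close> demands.\<close>

definition canon_hom :: "nat \<Rightarrow> nat \<Rightarrow> (nat \<Rightarrow> 'v) \<Rightarrow> nat \<Rightarrow> nat \<Rightarrow> (nat \<Rightarrow> 'v) \<Rightarrow> nat \<Rightarrow> 'v \<Rightarrow> 'v" where
  "canon_hom a b x c d y i v =
     (if i \<in> {a<..b} \<and> i \<in> {c<..d} \<and> v \<in> span {x i} then scale (line_coeff (x i) v) (y i) else 0)"

lemma canon_hom_scale:
  assumes "x i \<noteq> 0" "i \<in> {a<..b}" "i \<in> {c<..d}"
  shows "canon_hom a b x c d y i (scale t (x i)) = scale t (y i)"
  using assms line_coeff_scale span_line by (auto simp: canon_hom_def)

lemma canon_hom_outside:
  "i \<notin> {a<..b} \<or> i \<notin> {c<..d} \<Longrightarrow> canon_hom a b x c d y i v = 0"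
  by (auto simp: canon_hom_def)

lemma rep_homD:
  assumes "f \<in> rep_hom scale Q M L"
  shows "i \<in> {1..N} \<Longrightarrow> lin (space_at M i) (space_at L i) (f i)"
    "i \<in> {1..N} \<Longrightarrow> v \<notin> space_at M i \<Longrightarrow> f i v = 0"
    "i \<notin> {1..N} \<Longrightarrow> f i v = 0"
    "arr i j \<Longrightarrow> v \<in> space_at M i \<Longrightarrow> f j (map_at M (i, j) v) = map_at L (i, j) (f i v)"
  using assms unfolding rep_hom_def qverts_eq by auto

lemma canon_hom_in_rep_hom:
  assumes M: "framed M a b x" and L: "framed L c d y" and h: "interval_hom a b c d"
  shows "canon_hom a b x c d y \<in> rep_hom scale Q M L"
proof -
  note F = framedD[OF M] and G = framedD[OF L]
  let ?f = "canon_hom a b x c d y"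
  have vM: "\<exists>t. v = scale t (x i)" if "i \<in> {a<..b}" "v \<in> space_at M i" for i v
    using F(5)[OF that(1)] that(2) span_line by auto
  have f: "?f i (scale t (x i)) = (if i \<in> {c<..d} then scale t (y i) else 0)" if "i \<in> {a<..b}" for i t
    using canon_hom_scale[of x i a b c d y t] canon_hom_outside[of i a b c d] F(4)[OF that] that by auto
  have lin: "lin (space_at M i) (space_at L i) (?f i)" if i: "i \<in> {1..N}" for i
  proof (cases "i \<in> {a<..b} \<and> i \<in> {c<..d}")
    case False
    thus ?thesis
      using canon_hom_outside[of i a b c d x y] rep_zero_mem[OF G(1) i]
      by (auto simp: linear_between_def)
  next
    case True
    hence x: "x i \<noteq> 0" "space_at M i = span {x i}" and y: "space_at L i = span {y i}"
      using F(4,5) G(5) by auto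
    have f': "?f i (scale t (x i)) = scale t (y i)" for t using f True by simp
    show ?thesis
      unfolding linear_between_def
    proof (intro conjI ballI allI)
      show "?f i ` space_at M i \<subseteq> space_at L i"
        unfolding x(2) y span_singleton using f' by auto
    next
      fix u v assume "u \<in> space_at M i" "v \<in> space_at M i"
      then obtain s t where st: "u = scale s (x i)" "v = scale t (x i)" using vM True by meson
      have "u + v = scale (s + t) (x i)" using st by (simp add: scale_left_distrib)
      hence "?f i (u + v) = scale (s + t) (y i)" by (simp only: f')
      thus "?f i (u + v) = ?f i u + ?f i v" using f' st by (simp add: scale_left_distrib)
    next
      fix r v assume "v \<in> space_at M i"
      then obtain t where t: "v = scale t (x i)" using vM True by meson
      have "scale r v = scale (r * t) (x i)" using t by simp
      thus "?f i (scale r v) = scale r (?f i v)" using f' t by simp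
    qed
  qed
  have nat: "?f j (map_at M (i, j) v) = map_at L (i, j) (?f i v)"
    if ij: "arr i j" and v: "v \<in> space_at M i" for i j v
  proof -
    have V: "i \<in> {1..N}" "j \<in> {1..N}" "j = Suc i \<or> i = Suc j" using arrow_cases[OF ij] by auto
    note linM = map_linear[OF F(1) ij] and linL = map_linear[OF G(1) ij]
    have f0: "?f j 0 = 0"
      using lin_zero[OF lin[OF V(2)]] rep_zero_mem[OF F(1) V(2)] by blast
    show ?thesis
    proof (cases "i \<in> {a<..b}")
      case False
      hence "v = 0" using F(6)[OF V(1)] v by simp
      thus ?thesis using f0 map_zero[OF F(1) ij] map_zero[OF G(1) ij] canon_hom_outside False by simp
    next
      case iM: True
      obtain t where t: "v = scale t (x i)" using vM[OF iM v] by blast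
      have xi: "x i \<in> space_at M i" using F(5)[OF iM] by (simp add: span_base)
      have mL: "map_at L (i, j) (?f i v) = (if i \<in> {c<..d} \<and> j \<in> {c<..d} then scale t (y j) else 0)"
      proof (cases "i \<in> {c<..d}")
        case True
        have yi: "y i \<in> space_at L i" using G(5)[OF True] by (simp add: span_base)
        have eq: "map_at L (i, j) (?f i v) = scale t (map_at L (i, j) (y i))"
          using f[OF iM] True t linD(3)[OF linL yi] by simp
        show ?thesis
        proof (cases "j \<in> {c<..d}")
          case j: True
          thus ?thesis using eq G(7)[OF ij True j] True by simp
        next
          case False
          hence "map_at L (i, j) (y i) = 0" using linD(1)[OF linL yi] G(6)[OF V(2)] by simp
          hence "map_at L (i, j) (?f i v) = 0" using eq by simp
          thus ?thesis using False by presburger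
        qed
      next
        case False
        thus ?thesis using f[OF iM] t map_zero[OF G(1) ij] by auto
      qed
      show ?thesis
      proof (cases "j \<in> {a<..b}")
        case jM: True
        have "map_at M (i, j) v = scale t (x j)"
          using t linD(3)[OF linM xi] F(7)[OF ij iM jM] by simp
        hence l: "?f j (map_at M (i, j) v) = (if j \<in> {c<..d} then scale t (y j) else 0)"
          using f[OF jM] by simp
        \<comment> \<open>Otherwise the arrow would enter the overlap from a vertex of
          \<open>M\<close> outside \<open>L\<close>, and the overlap would not be a quotient of
          \<open>M\<close>.\<close>
        have "i \<in> {c<..d}" if j: "j \<in> {c<..d}"
        proof (rule ccontr)
          assume i: "i \<notin> {c<..d}"
          then consider "i = c" "j = Suc c" "a < c" | "i = Suc d" "j = d" "d < b"
            using V(3) j iM by auto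
          thus False
            using h ij arrow_or[of c] arrow_or[of d] V unfolding interval_hom_def by cases auto
        qed
        thus ?thesis using l mL by auto
      next
        case jM: False
        hence "map_at M (i, j) v = 0" using linD(1)[OF linM v] F(6)[OF V(2)] by simp
        hence l: "?f j (map_at M (i, j) v) = 0" using f0 by simp
        \<comment> \<open>Otherwise the arrow would leave the overlap within \<open>L\<close>, and
          the overlap would not be a subrepresentation of \<open>L\<close>.\<close>
        have "\<not> (i \<in> {c<..d} \<and> j \<in> {c<..d})"
        proof
          assume cd: "i \<in> {c<..d} \<and> j \<in> {c<..d}"
          then consider "i = Suc a" "j = a" "c < a" | "i = b" "j = Suc b" "b < d"
            using V(3) jM iM by auto
          thus False
            using h ij arrow_or[of a] arrow_or[of b] V unfolding interval_hom_def by cases auto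
        qed
        thus ?thesis using l mL by (simp only: if_False)
      qed
    qed
  qed
  have out: "?f i v = 0" if "i \<in> {1..N}" "v \<notin> space_at M i" for i v
    using that F(5)[of i] by (auto simp: canon_hom_def)
  have out': "?f i = (\<lambda>v. 0)" if "i \<notin> {1..N}" for i
    using that F(3) by (intro ext canon_hom_outside) auto
  show ?thesis
    unfolding rep_hom_def qverts_eq mem_Collect_eq
    using lin out out' nat by (intro conjI ballI allI impI) auto
qed

text \<open>On the overlap every component is a scalar with respect to the frames. Inner arrows
  equate neighbouring scalars, and a wrongly directed arrow at an end forces the scalar there, hence
  all of them, to be zero.\<close>

lemma rep_hom_framed:
  assumes M: "framed M a b x" and L: "framed L c d y" and f: "f \<in> rep_hom scale Q M L"
  shows "\<exists>k. (k = 0 \<or> interval_hom a b c d) \<and> f = (\<lambda>i v. scale k (canon_hom a b x c d y i v))"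
proof -
  note F = framedD[OF M] and G = framedD[OF L] and H = rep_homD[OF f]
  have xM: "x i \<in> space_at M i" if "i \<in> {a<..b}" for i using F(5)[OF that] by (simp add: span_base)
  have yL: "y i \<in> space_at L i" if "i \<in> {c<..d}" for i using G(5)[OF that] by (simp add: span_base)
  have "\<exists>k. f i (x i) = scale k (y i)" if i: "i \<in> {a<..b}" "i \<in> {c<..d}" for i
  proof -
    have "i \<in> {1..N}" using i F(3) by auto
    hence "f i (x i) \<in> span {y i}" using linD(1)[OF H(1) xM[OF i(1)]] G(5)[OF i(2)] by simp
    thus ?thesis using span_line by blast
  qed
  then obtain k where k: "f i (x i) = scale (k i) (y i)" if "i \<in> {a<..b}" "i \<in> {c<..d}" for i by metis
  have k_arrow: "k i = k j" if ij: "arr i j" "i \<in> {a<..b} \<inter> {c<..d}" "j \<in> {a<..b} \<inter> {c<..d}" for i j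
  proof -
    have i: "i \<in> {a<..b}" "i \<in> {c<..d}" and j: "j \<in> {a<..b}" "j \<in> {c<..d}" using ij by auto
    have "scale (k j) (y j) = f j (map_at M (i, j) (x i))" using k[OF j] F(7)[OF ij(1) i(1) j(1)] by simp
    also have "\<dots> = map_at L (i, j) (f i (x i))" using H(4)[OF ij(1) xM[OF i(1)]] .
    also have "\<dots> = scale (k i) (y j)"
      using k[OF i] linD(3)[OF map_linear[OF G(1) ij(1)] yL[OF i(2)]] G(7)[OF ij(1) i(2) j(2)] by simp
    finally show ?thesis using G(4)[OF j(2)] by simp
  qed
  define lo where "lo = Suc (max a c)"
  have in_both: "i \<in> {a<..b} \<inter> {c<..d} \<longleftrightarrow> lo \<le> i \<and> i \<le> min b d" for i by (auto simp: lo_def)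
  have k_const: "k i = k lo" if "lo \<le> i" "i \<le> min b d" for i
    using that
  proof (induction i rule: dec_induct)
    case (step i)
    have le: "lo \<le> i" "Suc i \<le> min b d" by fact+
    hence i: "i \<in> {a<..b} \<inter> {c<..d}" "Suc i \<in> {a<..b} \<inter> {c<..d}" by (auto simp: lo_def)
    have "1 \<le> i" "i < N" using le F(3) by (auto simp: lo_def)
    from arrow_or[OF this] have "k (Suc i) = k i" using k_arrow[OF _ i] k_arrow[OF _ i(2,1)] by metis
    moreover have "k i = k lo" using step.IH le by simp
    ultimately show ?case by simp
  qed simp
  have zero: "k lo = 0" if no: "\<not> interval_hom a b c d" and ne: "lo \<le> min b d"
  proof -
    have both: "k i = 0 \<Longrightarrow> i \<in> {a<..b} \<inter> {c<..d} \<Longrightarrow> k lo = 0" for i using k_const[of i] in_both[of i] by simp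
    have lin0: "f i 0 = 0" if "i \<in> {1..N}" for i
      using lin_zero[OF H(1)[OF that] rep_zero_mem[OF F(1) that]] .
    have k0: "k i = 0" if "f i (x i) = 0" "i \<in> {a<..b} \<inter> {c<..d}" for i
      using k[of i] that G(4)[of i] by auto
    have acbd: "a < d" "c < b" using ne by (auto simp: lo_def)
    \<comment> \<open>In cases 1 and 4 the offending arrow starts where \<open>L\<close> is zero; in
      cases 2 and 3 it ends where \<open>M\<close> is zero. Naturality along it kills the
      scalar.\<close>
    then consider (1) "a < c" "\<not> arr (Suc c) c" | (2) "c < a" "\<not> arr a (Suc a)"
      | (3) "b < d" "\<not> arr (Suc b) b" | (4) "d < b" "\<not> arr d (Suc d)"
      using no unfolding interval_hom_def by blast
    thus ?thesis
    proof cases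
      case 1
      hence ar: "arr c (Suc c)" using arrow_or[of c] acbd F(3) by auto
      have m: "c \<in> {a<..b}" "Suc c \<in> {a<..b}" "Suc c \<in> {c<..d}" "c \<in> {1..N}" using 1 acbd F(3) G(2) by auto
      have "f c (x c) = 0" using linD(1)[OF H(1)[OF m(4)] xM[OF m(1)]] G(6)[OF m(4)] by simp
      hence "f (Suc c) (x (Suc c)) = 0"
        using H(4)[OF ar xM[OF m(1)]] F(7)[OF ar m(1,2)] map_zero[OF G(1) ar] by simp
      thus ?thesis using k0[of "Suc c"] both[of "Suc c"] m by simp
    next
      case 2
      hence ar: "arr (Suc a) a" using arrow_or[of a] acbd G(3) by auto
      have m: "a \<in> {c<..d}" "Suc a \<in> {a<..b}" "Suc a \<in> {c<..d}" "a \<in> {1..N}" using 2 acbd G(3) F(2) by auto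
      have "map_at M (Suc a, a) (x (Suc a)) = 0"
        using linD(1)[OF map_linear[OF F(1) ar] xM[OF m(2)]] F(6)[OF m(4)] by simp
      hence "map_at L (Suc a, a) (f (Suc a) (x (Suc a))) = 0"
        using H(4)[OF ar xM[OF m(2)]] lin0[OF m(4)] by simp
      hence "scale (k (Suc a)) (y a) = 0"
        using k[OF m(2,3)] linD(3)[OF map_linear[OF G(1) ar] yL[OF m(3)]] G(7)[OF ar m(3,1)] by simp
      thus ?thesis using G(4)[OF m(1)] both[of "Suc a"] m by simp
    next
      case 3
      hence ar: "arr b (Suc b)" using arrow_or[of b] acbd G(3) by auto
      have m: "b \<in> {a<..b}" "b \<in> {c<..d}" "Suc b \<in> {c<..d}" "Suc b \<in> {1..N}" using 3 acbd G(3) F(2) by auto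
      have "map_at M (b, Suc b) (x b) = 0"
        using linD(1)[OF map_linear[OF F(1) ar] xM[OF m(1)]] F(6)[OF m(4)] by simp
      hence "map_at L (b, Suc b) (f b (x b)) = 0"
        using H(4)[OF ar xM[OF m(1)]] lin0[OF m(4)] by simp
      hence "scale (k b) (y (Suc b)) = 0"
        using k[OF m(1,2)] linD(3)[OF map_linear[OF G(1) ar] yL[OF m(2)]] G(7)[OF ar m(2,3)] by simp
      thus ?thesis using G(4)[OF m(3)] both[of b] m by simp
    next
      case 4
      hence ar: "arr (Suc d) d" using arrow_or[of d] acbd F(3) by auto
      have m: "d \<in> {a<..b}" "Suc d \<in> {a<..b}" "d \<in> {c<..d}" "Suc d \<in> {1..N}" using 4 acbd F(3) G(2) by auto
      have "f (Suc d) (x (Suc d)) = 0"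
        using linD(1)[OF H(1)[OF m(4)] xM[OF m(2)]] G(6)[OF m(4)] by simp
      hence "f d (x d) = 0"
        using H(4)[OF ar xM[OF m(2)]] F(7)[OF ar m(2,1)] map_zero[OF G(1) ar] by simp
      thus ?thesis using k0[of d] both[of d] m by simp
    qed
  qed
  define K where "K = (if interval_hom a b c d then k lo else 0)"
  have K: "f i (x i) = scale K (y i)" if i: "i \<in> {a<..b}" "i \<in> {c<..d}" for i
  proof -
    have "lo \<le> i" "i \<le> min b d" using i by (auto simp: lo_def)
    hence "k i = K" using k_const[of i] zero by (auto simp: K_def)
    thus ?thesis using k[OF i] by simp
  qed
  have "f i v = scale K (canon_hom a b x c d y i v)" for i v
  proof (cases "i \<in> {1..N} \<and> v \<in> space_at M i")
    case False
    hence "canon_hom a b x c d y i v = 0" using F(3,5) by (auto simp: canon_hom_def)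
    thus ?thesis using H(2,3) False by auto
  next
    case True
    show ?thesis
    proof (cases "i \<in> {a<..b}")
      case False
      hence "v = 0" using True F(6) by auto
      thus ?thesis using False lin_zero[OF H(1)] True canon_hom_outside[of i a b c d x y v] by auto
    next
      case iM: True
      then obtain t where t: "v = scale t (x i)" using True F(5) span_line by auto
      show ?thesis
      proof (cases "i \<in> {c<..d}")
        case iL: True
        have "f i v = scale t (f i (x i))" using t linD(3)[OF H(1) xM[OF iM]] True by simp
        thus ?thesis using K[OF iM iL] canon_hom_scale[of x i a b c d y t, OF F(4)[OF iM] iM iL] t
          by (simp add: mult.commute)
      next
        case False
        hence "f i v = 0" using linD(1)[OF H(1), of i v] True G(6) by auto
        thus ?thesis using canon_hom_outside[of i a b c d x y v] False by simp
      qed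
    qed
  qed
  thus ?thesis by (intro exI[of _ K]) (auto simp: K_def fun_eq_iff)
qed

text \<open>Frames go to frames, so only a vertex of \<open>M\<close> and \<open>R\<close> outside
  \<open>L\<close> could spoil the equality; there the arrow at the nearby end of \<open>L\<close>
  would have to point both ways.\<close>

lemma canon_hom_comp:
  assumes M: "framed M a b x" and L: "framed L c d y" and R: "framed R e f z"
    and h: "interval_hom a b c d" "interval_hom c d e f" "interval_hom a b e f"
  shows "canon_hom c d y e f z i (canon_hom a b x c d y i v) = canon_hom a b x e f z i v"
proof -
  note F = framedD[OF M] and G = framedD[OF L] and H = framedD[OF R]
  have z: "canon_hom c d y e f z i 0 = 0"
    using canon_hom_scale[of y i c d e f z 0] canon_hom_outside[of i c d e f y z 0] G(4)[of i] by auto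
  show ?thesis
  proof (cases "i \<in> {a<..b} \<and> v \<in> span {x i}")
    case False
    thus ?thesis using z by (auto simp: canon_hom_def)
  next
    case True
    then obtain t where t: "v = scale t (x i)" using span_line by blast
    have iM: "i \<in> {a<..b}" and x: "x i \<noteq> 0" using True F(4) by auto
    show ?thesis
    proof (cases "i \<in> {c<..d}")
      case iL: True
      hence "canon_hom a b x c d y i v = scale t (y i)"
        using canon_hom_scale[where x = x and i = i, OF x iM iL] t by simp
      thus ?thesis
        using canon_hom_scale[where x = x and i = i, OF x iM, of e f z t] canon_hom_scale[where x = y and i = i, OF G(4)[OF iL] iL, of e f z t]
          canon_hom_outside[of i a b e f x z v] canon_hom_outside[of i c d e f y z] t
        by (cases "i \<in> {e<..f}") auto
    next
      case False
      have "i \<notin> {e<..f}"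
      proof
        assume i: "i \<in> {e<..f}"
        from False consider "a < c" "e < c" | "d < b" "d < f" using iM i by force
        thus False
        proof cases
          case 1
          thus ?thesis using h arrow_or[of c] G(2,3) unfolding interval_hom_def by auto
        next
          case 2
          thus ?thesis using h arrow_or[of d] G(2) F(3) unfolding interval_hom_def by auto
        qed
      qed
      thus ?thesis using canon_hom_outside[of i a b e f x z v] canon_hom_outside[of i c d e f y z]
        by simp
    qed
  qed
qed

lemma canon_hom_nonzero:
  assumes M: "framed M a b x" and L: "framed L c d y" and h: "interval_hom a b c d"
  shows "\<exists>i v. canon_hom a b x c d y i v \<noteq> 0"
proof -
  let ?i = "Suc (max a c)"
  have i: "?i \<in> {a<..b}" "?i \<in> {c<..d}"
    using h framedD(2)[OF M] framedD(2)[OF L] by (auto simp: interval_hom_def)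
  have "canon_hom a b x c d y ?i (scale 1 (x ?i)) = y ?i"
    using canon_hom_scale[where x = x and i = ?i, OF framedD(4)[OF M i(1)] i, of y 1] by simp
  thus ?thesis using framedD(4)[OF L i(2)] by metis
qed

section \<open>The category of representations and its isomorphism classes\<close>

text \<open>Morphisms vanish outside their domains, which turns the unit laws into equalities of
  total functions.\<close>

lemma rep_cat_is_category:
  assumes I: "\<And>M. M \<in> I \<Longrightarrow> is_rep scale Q M"
  shows "is_category (ind_category scale Q I)"
proof -
  have idm: "(\<lambda>i v. if i \<in> qverts Q \<and> v \<in> space_at M i then v else 0) \<in> rep_hom scale Q M M"
    if "M \<in> I" for M
  proof -
    note rep = I[OF that]
    have "v + w \<in> space_at M i" "scale c v \<in> space_at M i"
      if "i \<in> qverts Q" "v \<in> space_at M i" "w \<in> space_at M i" for i v w c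
      using subspace_add subspace_scale is_repD(1)[OF rep that(1)] that(2,3) by auto
    moreover have "map_at M (i, j) v \<in> space_at M j" "i \<in> qverts Q" "j \<in> qverts Q"
      if "arr i j" "v \<in> space_at M i" for i j v
      using linD(1)[OF map_linear[OF rep that(1)] that(2)] arrow_cases[OF that(1)] by (auto simp: qverts_eq)
    ultimately show ?thesis unfolding rep_hom_def linear_between_def by (auto 0 3)
  qed
  have cmp: "(\<lambda>i v. g i (f i v)) \<in> rep_hom scale Q L R"
    if L: "L \<in> I" "M \<in> I" and f: "f \<in> rep_hom scale Q L M" and g: "g \<in> rep_hom scale Q M R" for L M R f g
  proof -
    note F = rep_homD[OF f] and G = rep_homD[OF g]
    have g0: "g i 0 = 0" if "i \<in> {1..N}" for i
      using lin_zero[OF G(1)[OF that] rep_zero_mem[OF I[OF L(2)] that]] .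
    have "lin (space_at L i) (space_at R i) (\<lambda>v. g i (f i v))" if "i \<in> {1..N}" for i
      using linD[OF F(1)[OF that]] linD[OF G(1)[OF that]]
      unfolding linear_between_def by auto
    moreover have "g j (f j (map_at L (i, j) v)) = map_at R (i, j) (g i (f i v))"
      if ij: "arr i j" and v: "v \<in> space_at L i" for i j v
    proof -
      have "f i v \<in> space_at M i" using linD(1)[OF F(1) v] arrow_cases[OF ij] by simp
      thus ?thesis using F(4)[OF ij v] G(4)[OF ij] by simp
    qed
    ultimately show ?thesis
      unfolding rep_hom_def qverts_eq mem_Collect_eq using F(2) g0 G(3)
      by (intro conjI ballI allI impI) auto
  qed
  have idr: "(\<lambda>i v. f i (if i \<in> qverts Q \<and> v \<in> space_at L i then v else 0)) = f"
    if L: "L \<in> I" and f: "f \<in> rep_hom scale Q L M" for L M f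
  proof (intro ext)
    fix i v
    note F = rep_homD[OF f]
    have "f i 0 = 0" if "i \<in> {1..N}"
      using lin_zero[OF F(1)[OF that] rep_zero_mem[OF I[OF L] that]] .
    thus "f i (if i \<in> qverts Q \<and> v \<in> space_at L i then v else 0) = f i v"
      using F(2)[of i v] F(3)[of i] by (cases "i \<in> {1..N}") (simp_all add: qverts_eq)
  qed
  have idl: "(\<lambda>i v. if i \<in> qverts Q \<and> f i v \<in> space_at M i then f i v else 0) = f"
    if L: "L \<in> I" and f: "f \<in> rep_hom scale Q L M" for L M f
  proof (intro ext)
    fix i v
    note F = rep_homD[OF f]
    show "(if i \<in> qverts Q \<and> f i v \<in> space_at M i then f i v else 0) = f i v"
    proof (cases "i \<in> {1..N} \<and> v \<in> space_at L i")
      case True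
      thus ?thesis using linD(1)[OF F(1)] by (simp add: qverts_eq)
    next
      case False
      thus ?thesis using F(2,3) by (auto simp: qverts_eq)
    qed
  qed
  show ?thesis
    unfolding is_category_def full_subcategory_def rep_category_def
    using idm cmp idr idl by simp
qed

lemma rep_hom_zero:
  assumes "is_rep scale Q L"
  shows "(\<lambda>i v. 0) \<in> rep_hom scale Q M L"
proof -
  have "lin (space_at M i) (space_at L i) (\<lambda>v. 0)" if "i \<in> {1..N}" for i
    using rep_zero_mem[OF assms that] by (auto simp: linear_between_def)
  thus ?thesis
    unfolding rep_hom_def qverts_eq mem_Collect_eq using map_zero[OF assms]
    by (intro conjI ballI allI impI) auto
qed

lemma rep_hom_scale:
  assumes L: "is_rep scale Q L" and f: "f \<in> rep_hom scale Q M L"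
  shows "(\<lambda>i v. scale c (f i v)) \<in> rep_hom scale Q M L"
proof -
  note F = rep_homD[OF f]
  have "lin (space_at M i) (space_at L i) (\<lambda>v. scale c (f i v))" if i: "i \<in> {1..N}" for i
  proof -
    have "subspace (space_at L i)" using is_repD(1)[OF L] i by (simp add: qverts_eq)
    thus ?thesis using linD[OF F(1)[OF i]] subspace_scale
      unfolding linear_between_def by (auto simp: scale_right_distrib mult.commute)
  qed
  moreover have "scale c (f j (map_at M (i, j) v)) = map_at L (i, j) (scale c (f i v))"
    if ij: "arr i j" and v: "v \<in> space_at M i" for i j v
  proof -
    have "f i v \<in> space_at L i" using linD(1)[OF F(1) v] arrow_cases[OF ij] by simp
    thus ?thesis using F(4)[OF ij v] linD(3)[OF map_linear[OF L ij]] by simp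
  qed
  ultimately show ?thesis
    unfolding rep_hom_def qverts_eq mem_Collect_eq using F(2,3)
    by (intro conjI ballI allI impI) auto
qed

lemma interval_hom_refl: "a < b \<Longrightarrow> interval_hom a b a b"
  by (simp add: interval_hom_def)

lemma idm_rep: "idm (rep_category scale Q) M = (\<lambda>i v. if i \<in> {1..N} \<and> v \<in> space_at M i then v else 0)"
  by (simp add: rep_category_def qverts_eq)

lemma canon_hom_self:
  assumes "framed M a b x"
  shows "canon_hom a b x a b x = idm (rep_category scale Q) M"
proof (intro ext)
  fix i v
  note F = framedD[OF assms]
  show "canon_hom a b x a b x i v = idm (rep_category scale Q) M i v"
  proof (cases "i \<in> {a<..b}")
    case True
    hence i: "i \<in> {1..N}" using F(3) by auto
    show ?thesis
    proof (cases "v \<in> span {x i}")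
      case v: True
      then obtain t where "v = scale t (x i)" using span_line by blast
      thus ?thesis using canon_hom_scale[where x = x and i = i, OF F(4)[OF True] True True, of x t]
        v F(5)[OF True] i by (simp add: idm_rep)
    next
      case False
      thus ?thesis using F(5)[OF True] by (simp add: idm_rep canon_hom_def)
    qed
  next
    case False
    thus ?thesis using F(6)[of i] canon_hom_outside[of i a b a b x x v] by (auto simp: idm_rep)
  qed
qed

abbreviation "rep_iso \<equiv> isomorphic_in (rep_category scale Q)"

text \<open>Canonical morphisms between equal intervals compose to the canonical endomorphism, which
  is the identity.\<close>

lemma framed_isomorphic:
  assumes M: "framed M a b x" and L: "framed L a b y"
  shows "rep_iso M L"
proof -
  have h: "interval_hom a b a b" using interval_hom_refl framedD(2)[OF M] .
  have "(\<lambda>i v. canon_hom a b y a b x i (canon_hom a b x a b y i v)) = idm (rep_category scale Q) M"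
    using canon_hom_comp[OF M L M h h h] canon_hom_self[OF M] by (simp add: fun_eq_iff)
  moreover have "(\<lambda>i v. canon_hom a b x a b y i (canon_hom a b y a b x i v)) = idm (rep_category scale Q) L"
    using canon_hom_comp[OF L M L h h h] canon_hom_self[OF L] by (simp add: fun_eq_iff)
  moreover have "canon_hom a b x a b y \<in> rep_hom scale Q M L" "canon_hom a b y a b x \<in> rep_hom scale Q L M"
    using canon_hom_in_rep_hom[OF M L h] canon_hom_in_rep_hom[OF L M h] by auto
  ultimately show ?thesis
    unfolding isomorphic_in_def isomorphism_in_def by (auto simp: rep_category_def)
qed

lemma isomorphic_zero_space:
  assumes "rep_iso M L" "is_rep scale Q M" "i \<in> {1..N}"
  shows "space_at L i = {0} \<Longrightarrow> space_at M i = {0}"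
proof -
  assume z: "space_at L i = {0}"
  obtain f g where f: "f \<in> rep_hom scale Q M L" and g: "g \<in> rep_hom scale Q L M"
    and gf: "(\<lambda>i v. g i (f i v)) = idm (rep_category scale Q) M"
    using assms(1) unfolding isomorphic_in_def isomorphism_in_def by (auto simp: rep_category_def)
  have "v = 0" if v: "v \<in> space_at M i" for v
  proof -
    have "f i v = 0" using linD(1)[OF rep_homD(1)[OF f assms(3)] v] z by simp
    moreover have "g i 0 = 0" using lin_zero[OF rep_homD(1)[OF g assms(3)], of 0] z by simp
    moreover have "g i (f i v) = v" using fun_cong[OF fun_cong[OF gf, of i], of v] v assms(3) by (simp add: idm_rep)
    ultimately show ?thesis by simp
  qed
  thus "space_at M i = {0}" using rep_zero_mem[OF assms(2,3)] by blast
qed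

lemma isomorphic_in_sym: "isomorphic_in C M L \<Longrightarrow> isomorphic_in C L M"
  unfolding isomorphic_in_def isomorphism_in_def by blast

lemma framed_space_zero_iff:
  assumes "framed M a b x" "i \<in> {1..N}"
  shows "space_at M i = {0} \<longleftrightarrow> i \<notin> {a<..b}"
proof (cases "i \<in> {a<..b}")
  case True
  hence "x i \<in> space_at M i" using framedD(5)[OF assms(1)] by (simp add: span_base)
  thus ?thesis using framedD(4)[OF assms(1) True] True by auto
qed (use framedD(6)[OF assms(1,2)] in auto)

text \<open>Isomorphic representations have the same support, and a nonempty half-open interval
  determines its ends.\<close>

lemma isomorphic_framed_eq:
  assumes iso: "rep_iso M L" and M: "framed M a b x" and L: "framed L c d y"
  shows "a = c \<and> b = d"
proof -
  have eq: "i \<in> {a<..b} \<longleftrightarrow> i \<in> {c<..d}" if "i \<in> {1..N}" for i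
    using framed_space_zero_iff[OF M that] framed_space_zero_iff[OF L that]
      isomorphic_zero_space[OF iso framedD(1)[OF M] that]
      isomorphic_zero_space[OF isomorphic_in_sym[OF iso] framedD(1)[OF L] that] by metis
  have "a < b" "b \<le> N" "c < d" "d \<le> N" using framedD(2,3)[OF M] framedD(2,3)[OF L] by auto
  thus ?thesis using eq[of b] eq[of d] eq[of "Suc a"] eq[of "Suc c"] by auto
qed

lemma representative_exists:
  assumes I: "ind_representatives scale Q I" and e: "(e :: 'v) \<noteq> 0" and ab: "a < b" "b \<le> N"
  shows "\<exists>M\<in>I. \<exists>x. framed M a b x"
proof -
  have fr: "framed (interval_rep a b e) a b (\<lambda>_. e)" using interval_rep_framed[OF ab e] .
  obtain M where M: "M \<in> I" "rep_iso (interval_rep a b e) M"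
    using I framed_indecomposable[OF fr] unfolding ind_representatives_def by blast
  hence "indecomposable scale Q M" using I unfolding ind_representatives_def by blast
  then obtain c d x where x: "framed M c d x" using indecomposable_framed by blast
  hence "framed M a b x" using isomorphic_framed_eq[OF M(2) fr x] by simp
  thus ?thesis using M(1) by blast
qed

lemma representative_unique:
  assumes I: "ind_representatives scale Q I" and M: "M \<in> I" "framed M a b x" and L: "L \<in> I" "framed L a b y"
  shows "M = L"
proof -
  have "\<exists>!K. K \<in> I \<and> rep_iso M K"
    using I framed_indecomposable[OF M(2)] unfolding ind_representatives_def by blast
  thus ?thesis using M(1) L(1) framed_isomorphic[OF M(2) M(2)] framed_isomorphic[OF M(2) L(2)] by blast
qed

text \<open>Composites are compared as total functions, so this is needed for all ambient vectors;
  for those off the line both sides vanish.\<close>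

lemma canon_hom_homogeneous:
  assumes M: "framed M a b x"
  shows "canon_hom a b x c d y i (scale r v) = scale r (canon_hom a b x c d y i v)"
proof (cases "i \<in> {a<..b} \<and> i \<in> {c<..d}")
  case False
  thus ?thesis using canon_hom_outside[of i a b c d] by simp
next
  case True
  hence i: "i \<in> {a<..b}" "i \<in> {c<..d}" by auto
  note c = canon_hom_scale[where x = x and i = i, OF framedD(4)[OF M i(1)] i, of y]
  show ?thesis
  proof (cases "v \<in> span {x i}")
    case True
    then obtain t where t: "v = scale t (x i)" using span_line by blast
    have "scale r v = scale (r * t) (x i)" using t by simp
    hence "canon_hom a b x c d y i (scale r v) = scale (r * t) (y i)" by (simp only: c)
    thus ?thesis using c[of t] t by simp
  next
    case False
    hence z: "canon_hom a b x c d y i v = 0" by (simp add: canon_hom_def)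
    show ?thesis
    proof (cases "r = 0")
      case True
      thus ?thesis using c[of 0] z by simp
    next
      case False
      have "scale r v \<notin> span {x i}"
      proof
        assume "scale r v \<in> span {x i}"
        hence "scale (inverse r) (scale r v) \<in> span {x i}" by (rule span_scale)
        thus False using False \<open>v \<notin> span {x i}\<close> by simp
      qed
      thus ?thesis using z by (simp add: canon_hom_def)
    qed
  qed
qed

end

section \<open>The equivalence\<close>

locale segment_reps = polygon n Q P + dynkin_reps scale "n + 2" Q
  for n :: nat and Q :: "nat quiver" and P :: "nat \<Rightarrow> real \<times> real"
    and scale :: "'k::field \<Rightarrow> 'v::ab_group_add \<Rightarrow> 'v"
begin

text \<open>Of two left endpoints the larger label decides the comparison of \<open>pL\<close>, by
  the side on which it lies, and that side encodes the direction of its arrow. For right endpoints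
  and \<open>pR\<close> the smaller label decides.\<close>

lemma rect_iff_interval_hom:
  assumes "(a, b) \<in> segs" "(c, d) \<in> segs"
  shows "grid.rect (a, b) (c, d) \<longleftrightarrow> interval_hom a b c d"
proof -
  have up: "i \<in> up \<longleftrightarrow> arr i (Suc i)" "i \<notin> up \<longleftrightarrow> arr (Suc i) i" if "0 < i" "i < n + 2" for i
    using that arrow_or[of i] by (auto simp: upper_barred_def)
  have abcd: "a < n + 2" "b \<in> {0<..n + 2}" "c < n + 2" "d \<in> {0<..n + 2}"
    using assms by (auto simp: segment_iff)
  have "pL a \<le> pL c \<longleftrightarrow> (a < c \<longrightarrow> arr (Suc c) c) \<and> (c < a \<longrightarrow> arr a (Suc a))"
    using up(2)[of c] up(1)[of a] abcd(1,3) by (cases a c rule: linorder_cases) (auto simp: pos_def)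
  moreover have "pR b \<le> pR d \<longleftrightarrow> (b < d \<longrightarrow> arr (Suc b) b) \<and> (d < b \<longrightarrow> arr d (Suc d))"
    using up(2)[of b] up(1)[of d] abcd(2,4) by (cases b d rule: linorder_cases) (auto simp: pR_def)
  ultimately show ?thesis unfolding rect_segment_iff[OF assms] interval_hom_def by blast
qed

lemma segment_category_equivalence:
  assumes I: "ind_representatives scale Q I" and e: "(e :: 'v) \<noteq> 0"
  shows "\<exists>F. is_equivalence (segment_category n P :: (_, (_ \<Rightarrow> 'k) set, 'k) linear_category_data)
        (ind_category scale Q I) F \<and>
      preserves_linear_structure (segment_category n P) (ind_category scale Q I) F"
proof -
  have "\<exists>M x. M \<in> I \<and> framed M (fst s) (snd s) x" if "s \<in> segs" for s
  proof -
    have "fst s < snd s" "snd s \<le> n + 2" using that by (auto simp: line_segments_def)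
    from representative_exists[OF I e this] show ?thesis by blast
  qed
  then obtain S X where SX: "S s \<in> I" "framed (S s) (fst s) (snd s) (X s)" if "s \<in> segs" for s
    by metis
  have V: "qverts (segment_quiver n P) = segs" by (simp add: segment_quiver_def)
  let ?C = "segment_category n P :: (nat \<times> nat, ((nat \<times> nat) list \<Rightarrow> 'k) set, 'k) linear_category_data"
  let ?D = "ind_category scale Q I"
  have objC: "obj ?C = segs" by (simp add: mesh_category_def V)
  have D: "obj ?D = I" "hom ?D = rep_hom scale Q" "cmp ?D = (\<lambda>L M N g f i x. g i (f i x))"
    "idm ?D = idm (rep_category scale Q)" "hadd ?D = (\<lambda>M N f g i x. f i x + g i x)"
    "hscale ?D = (\<lambda>M N c f i x. scale c (f i x))"
    by (simp_all add: full_subcategory_def rep_category_def)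
  have repI: "is_rep scale Q M" if "M \<in> I" for M
    using I that unfolding ind_representatives_def indecomposable_def by blast
  have catD: "is_category ?D" using rep_cat_is_category repI by blast
  define \<phi> where "\<phi> s t = canon_hom (fst s) (snd s) (X s) (fst t) (snd t) (X t)" for s t
  define m :: "nat \<times> nat \<Rightarrow> nat \<times> nat \<Rightarrow> ((nat \<times> nat) list \<Rightarrow> 'k) set \<Rightarrow> nat \<Rightarrow> 'v \<Rightarrow> 'v"
    where "m s t F = (\<lambda>i v. scale (grid.class_coeff s t F) (\<phi> s t i v))" for s t F
  have rect: "grid.rect s t \<longleftrightarrow> interval_hom (fst s) (snd s) (fst t) (snd t)"
    if "s \<in> segs" "t \<in> segs" for s t
    using rect_iff_interval_hom[of "fst s" "snd s" "fst t" "snd t"] that by simp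
  have bijS: "bij_betw S (segs) I"
    unfolding bij_betw_def
  proof
    show "inj_on S (segs)"
    proof (rule inj_onI)
      fix s t assume st: "s \<in> segs" "t \<in> segs" "S s = S t"
      have "rep_iso (S s) (S t)"
        using framed_isomorphic[OF SX(2)[OF st(1)] SX(2)[OF st(1)]] st(3) by simp
      from isomorphic_framed_eq[OF this SX(2)[OF st(1)] SX(2)[OF st(2)]] show "s = t"
        by (simp add: prod_eq_iff)
    qed
    have "M \<in> S ` segs" if M: "M \<in> I" for M
    proof -
      have "indecomposable scale Q M" using I M unfolding ind_representatives_def by blast
      then obtain a b x where x: "framed M a b x" using indecomposable_framed by blast
      hence s: "(a, b) \<in> segs" using framedD(2,3)[OF x] by (simp add: line_segments_def)
      have "M = S (a, b)" by (rule representative_unique[OF I M x]) (use SX[OF s] in simp_all)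
      thus ?thesis using s by blast
    qed
    thus "S ` segs = I" using SX(1) by blast
  qed
  have phi_hom: "(\<lambda>i v. scale c (\<phi> s t i v)) \<in> rep_hom scale Q (S s) (S t)"
    if st: "s \<in> segs" "t \<in> segs" and c: "grid.rect s t \<or> c = 0" for s t c
  proof -
    note M = SX(2)[OF st(1)] and L = SX(2)[OF st(2)]
    show ?thesis
    proof (cases "c = 0")
      case True
      thus ?thesis using rep_hom_zero[OF framedD(1)[OF L], of "S s"] by simp
    next
      case False
      hence "\<phi> s t \<in> rep_hom scale Q (S s) (S t)"
        unfolding \<phi>_def using c rect[OF st] by (intro canon_hom_in_rep_hom[OF M L]) simp
      thus ?thesis by (rule rep_hom_scale[OF framedD(1)[OF L]])
    qed
  qed
  have hom_phi: "\<exists>c. (grid.rect s t \<or> c = 0) \<and> f = (\<lambda>i v. scale c (\<phi> s t i v))"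
    if st: "s \<in> segs" "t \<in> segs" and f: "f \<in> rep_hom scale Q (S s) (S t)" for s t f
    using rep_hom_framed[OF SX(2)[OF st(1)] SX(2)[OF st(2)] f] rect[OF st] unfolding \<phi>_def by blast
  have phi_inj: "c = d"
    if st: "s \<in> segs" "t \<in> segs" and c: "grid.rect s t \<or> c = 0" and d: "grid.rect s t \<or> d = 0"
      and eq: "(\<lambda>i v. scale c (\<phi> s t i v)) = (\<lambda>i v. scale d (\<phi> s t i v))" for s t c d
  proof (cases "grid.rect s t")
    case True
    then obtain i v where "\<phi> s t i v \<noteq> 0"
      using canon_hom_nonzero[OF SX(2)[OF st(1)] SX(2)[OF st(2)]] rect[OF st] unfolding \<phi>_def by blast
    moreover have "scale c (\<phi> s t i v) = scale d (\<phi> s t i v)" using fun_cong[OF fun_cong[OF eq]] .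
    ultimately show ?thesis by simp
  qed (use c d in simp)
  have bijm: "bij_betw (m s t) (hom ?C s t) (hom ?D (S s) (S t))"
    if st: "s \<in> segs" "t \<in> segs" for s t
  proof -
    \<comment> \<open>The same set of scalars parametrises the cosets through
      \<open>class_coeff\<close>, so \<open>m s t\<close> is a composite of two bijections.\<close>
    have "bij_betw (\<lambda>c i v. scale c (\<phi> s t i v)) {c. grid.rect s t \<or> c = 0} (rep_hom scale Q (S s) (S t))"
      unfolding bij_betw_def
    proof
      show "inj_on (\<lambda>c i v. scale c (\<phi> s t i v)) {c. grid.rect s t \<or> c = 0}"
        by (rule inj_onI, rule phi_inj[OF st]) simp_all
      show "(\<lambda>c i v. scale c (\<phi> s t i v)) ` {c. grid.rect s t \<or> c = 0} = rep_hom scale Q (S s) (S t)"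
        using phi_hom[OF st] hom_phi[OF st] by blast
    qed
    moreover have "m s t = (\<lambda>c i v. scale c (\<phi> s t i v)) \<circ> grid.class_coeff s t"
      by (simp add: fun_eq_iff m_def)
    ultimately show ?thesis using bij_betw_trans[OF grid.class_coeff_bij] st by (simp add: V D)
  qed
  have coeff_rect: "grid.rect s t" if "s \<in> segs" "t \<in> segs" "F \<in> hom ?C s t"
    "grid.class_coeff s t F \<noteq> 0" for s t F
    using bij_betwE[OF grid.class_coeff_bij[of s t, where 'k = 'k]] that V by auto
  have cmp_m: "m s u (cmp ?C s t u G F) = cmp ?D (S s) (S t) (S u) (m t u G) (m s t F)"
    if s: "s \<in> segs" "t \<in> segs" "u \<in> segs"
      and F: "F \<in> hom ?C s t" and G: "G \<in> hom ?C t u" for s t u F G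
  proof -
    let ?c = "grid.class_coeff s t F" and ?d = "grid.class_coeff t u G"
    have val: "grid.class_coeff s u (cmp ?C s t u G F) = (if grid.rect s u then ?d * ?c else 0)"
      using grid.cmp_mesh_cat(2)[OF F G] .
    have rhs: "cmp ?D (S s) (S t) (S u) (m t u G) (m s t F) = (\<lambda>i v. scale (?d * ?c) (\<phi> t u i (\<phi> s t i v)))"
      unfolding D m_def \<phi>_def using canon_hom_homogeneous[OF SX(2)[OF s(2)]] by simp
    show ?thesis
    proof (cases "grid.rect s u")
      case True
      have eq: "scale (?d * ?c) (\<phi> t u i (\<phi> s t i v)) = scale (?d * ?c) (\<phi> s u i v)" for i v
      proof (cases "?c = 0 \<or> ?d = 0")
        case False
        hence "grid.rect s t" "grid.rect t u" using coeff_rect s F G by blast+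
        hence "\<phi> t u i (\<phi> s t i v) = \<phi> s u i v"
          unfolding \<phi>_def using True rect s
          by (intro canon_hom_comp[OF SX(2)[OF s(1)] SX(2)[OF s(2)] SX(2)[OF s(3)]]) simp_all
        thus ?thesis by simp
      qed auto
      show ?thesis unfolding rhs unfolding m_def val if_P[OF True] eq ..
    next
      case False
      \<comment> \<open>Without a filled rectangle every morphism from \<open>S s\<close> to
        \<open>S u\<close> is zero, so it is enough that the composite is a morphism.\<close>
      have "cmp ?D (S s) (S t) (S u) (m t u G) (m s t F) \<in> rep_hom scale Q (S s) (S u)"
      proof -
        have "m s t F \<in> hom ?D (S s) (S t)" "m t u G \<in> hom ?D (S t) (S u)"
          using bij_betwE[OF bijm[OF s(1,2)]] bij_betwE[OF bijm[OF s(2,3)]] F G by auto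
        hence "cmp ?D (S s) (S t) (S u) (m t u G) (m s t F) \<in> hom ?D (S s) (S u)"
          using catD SX(1) s unfolding is_category_def D(1) by blast
        thus ?thesis by (simp add: D)
      qed
      from hom_phi[OF s(1,3) this] False
      have "cmp ?D (S s) (S t) (S u) (m t u G) (m s t F) = (\<lambda>i v. 0)" by auto
      thus ?thesis using False by (simp add: m_def val)
    qed
  qed
  let ?F = "\<lparr>fobj = S, fmor = m\<rparr>"
  have "is_equivalence ?C ?D ?F"
  proof (rule transported_equivalence[OF catD])
    show "bij_betw S (obj ?C) (obj ?D)" using bijS by (simp add: objC D)
    show "bij_betw (m s t) (hom ?C s t) (hom ?D (S s) (S t))" if "s \<in> obj ?C" "t \<in> obj ?C" for s t
      using bijm that unfolding objC by blast
    show "idm ?C s \<in> hom ?C s s" if "s \<in> obj ?C" for s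
      using grid.idm_mesh_cat(1) that unfolding objC V .
    show "m s s (idm ?C s) = idm ?D (S s)" if "s \<in> obj ?C" for s
    proof -
      have s: "s \<in> segs" using that by (simp add: objC)
      have "grid.class_coeff s s (idm ?C s) = 1" using grid.idm_mesh_cat(2) s by (simp add: V)
      thus ?thesis using canon_hom_self[OF SX(2)[OF s]] by (simp add: m_def \<phi>_def D)
    qed
    show "cmp ?C s t u G F \<in> hom ?C s u" if "F \<in> hom ?C s t" "G \<in> hom ?C t u" for s t u F G
      using grid.cmp_mesh_cat(1)[OF that] .
    show "m s u (cmp ?C s t u G F) = cmp ?D (S s) (S t) (S u) (m t u G) (m s t F)"
      if "s \<in> obj ?C" "t \<in> obj ?C" "u \<in> obj ?C" "F \<in> hom ?C s t" "G \<in> hom ?C t u" for s t u F G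
      using cmp_m that unfolding objC by blast
  qed
  moreover have "preserves_linear_structure ?C ?D ?F"
    unfolding preserves_linear_structure_def
  proof (intro ballI conjI allI)
    fix s t F G c assume F: "F \<in> hom ?C s t"
    show "fmor ?F s t (hscale ?C s t c F) =
        hscale ?D (fobj ?F s) (fobj ?F t) c (fmor ?F s t F)"
      using grid.hscale_mesh_cat[OF F] by (simp add: D m_def)
    assume G: "G \<in> hom ?C s t"
    show "fmor ?F s t (hadd ?C s t F G) =
        hadd ?D (fobj ?F s) (fobj ?F t)
          (fmor ?F s t F) (fmor ?F s t G)"
      using grid.hadd_mesh_cat[OF F G] by (simp add: D m_def scale_left_distrib)
  qed
  ultimately show ?thesis by blast
qed

end

theorem theorem1:
  fixes n :: nat
    and Q :: "nat quiver"
    and P :: "nat \<Rightarrow> real \<times> real"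
    and scale :: "'k::alg_closed_field \<Rightarrow> 'v::ab_group_add \<Rightarrow> 'v"
    and I :: "(nat, 'v) rep set"
  assumes "dynkin_A (n + 2) Q"
    and "is_polygon n Q P"
    and "vector_space scale"
    and "\<not> (\<exists>B. finite B \<and> module.span scale B = UNIV)"
    and "ind_representatives scale Q I"
  shows "\<exists>F :: (nat \<times> nat, ((nat \<times> nat) list \<Rightarrow> 'k) set, (nat, 'v) rep, nat \<Rightarrow> 'v \<Rightarrow> 'v) functor_data.
           is_equivalence (segment_category n P) (ind_category scale Q I) F \<and>
           preserves_linear_structure (segment_category n P) (ind_category scale Q I) F"
proof -
  interpret segment_reps n Q P scale
    using assms(1-3) by (intro segment_reps.intro polygon.intro dynkin_reps.intro ambient_space.intro
        dynkin_reps_axioms.intro)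
  obtain e :: 'v where "e \<noteq> 0"
  proof -
    \<comment> \<open>A zero ambient space would be spanned by the empty set; a nonzero vector is
      needed to realise the interval representations.\<close>
    have "span {} \<noteq> UNIV" using assms(4) by blast
    then show thesis using that by auto
  qed
  then show ?thesis using segment_category_equivalence[OF assms(5)] by blast
qed

end
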